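(* Let $G$ be a Lie group with Lie algebra $\mathfrak g$, and let $\alpha:G\to G$ be a continuous endomorphism. Then $\alpha$ has shadowing if and only if the differential $\mathrm d\alpha:\mathfrak g\to\mathfrak g$ (the differential of $\alpha$ at the identity) is hyperbolic.
   Context: All topological spaces are Hausdorff. Lie groups are finite-dimensional real Lie groups (not assumed connected or compact). A continuous homomorphism between Lie groups is automatically smooth, so its differential at the identity is a well-defined linear map of Lie algebras. Shadowing (with respect to the left uniformity): let $G$ be a topological group with identity $e$ and $\alpha:G\to G$ a continuous endomorphism. For a neighbourhood $V$ of $e$, a sequence $(x_k)_{k\ge 0}$ in $G$ is a $V$-pseudo-orbit for $\alpha$ if $\alpha(x_k)^{-1}x_{k+1}\in V$ for all $k\ge 0$. For a neighbourhood $U$ of $e$, the sequence is $U$-shadowed by $x\in G$ if $\alpha^k(x)^{-1}x_k\in U$ for all $k\ge 0$. The endomorphism $\alpha$ has shadowing if for every neighbourhood $U$ of $e$ there is a neighbourhood $V$ of $e$ such that every one-sided infinite $V$-pseudo-orbit for $\alpha$ is $U$-shadowed by some point of $G$. A linear endomorphism $T$ of a finite-dimensional real vector space is hyperbolic if the spectrum of its complexification is disjoint from the unit circle $\{z\in\mathbb C:|z|=1\}$; zero eigenvalues are allowed. *)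

theory Defs
  imports "HOL-Analysis.Analysis" "HOL-Library.Function_Algebras"
begin

instantiation "fun" :: (type, real_vector) real_vector
begin

definition scaleR_fun :: "real \<Rightarrow> ('a \<Rightarrow> 'b) \<Rightarrow> 'a \<Rightarrow> 'b"
  where "scaleR_fun r f = (\<lambda>x. r *\<^sub>R f x)"

instance
  by standard (simp_all add: scaleR_fun_def fun_eq_iff scaleR_add_right scaleR_add_left)

end

text \<open>
  Model spaces of charts. The class \<^class>\<open>euclidean_space\<close> demands a nonempty basis, hence excludes
  dimension 0 and with it the discrete Lie groups; this class consists of all spaces isometric
  to some \<open>\<real>\<^sup>n\<close> with \<open>n \<ge> 0\<close>.
\<close>

class finite_dim_inner = real_inner +
  assumes finite_dim: "\<exists>B. finite B \<and> (\<forall>x. \<exists>u. x = (\<Sum>b\<in>B. u b *\<^sub>R b))"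

instance euclidean_space \<subseteq> finite_dim_inner
  by standard (metis finite_Basis euclidean_representation)

text \<open>
  For an open subset \<open>S\<close> of a finite-dimensional space, \<open>C_on n S f\<close> says that \<open>f\<close> is of class
  \<open>C\<^sup>n\<close> on \<open>S\<close>, by recursion on all directional derivatives.
\<close>

primrec C_on :: "nat \<Rightarrow> 'a::real_normed_vector set \<Rightarrow> ('a \<Rightarrow> 'b::real_normed_vector) \<Rightarrow> bool"
  where
    "C_on 0 S f \<longleftrightarrow> continuous_on S f"
  | "C_on (Suc n) S f \<longleftrightarrow>
       (\<forall>x\<in>S. f differentiable at x) \<and> (\<forall>v. C_on n S (\<lambda>x. frechet_derivative f (at x) v))"

definition smooth_on :: "'a::real_normed_vector set \<Rightarrow> ('a \<Rightarrow> 'b::real_normed_vector) \<Rightarrow> bool"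
  where "smooth_on S f \<longleftrightarrow> (\<forall>n. C_on n S f)"

text \<open>A chart is a pair of its domain and a coordinate map, whose values off the domain are irrelevant.\<close>

type_synonym ('m, 'e) chart = "'m set \<times> ('m \<Rightarrow> 'e)"

definition is_chart :: "('m::topological_space, 'e::real_normed_vector) chart \<Rightarrow> bool"
  where "is_chart c \<longleftrightarrow> open (fst c) \<and> open (snd c ` fst c) \<and>
     homeomorphism (fst c) (snd c ` fst c) (snd c) (inv_into (fst c) (snd c))"

definition local_rep :: "('m, 'e) chart \<Rightarrow> ('n, 'f) chart \<Rightarrow> ('m \<Rightarrow> 'n) \<Rightarrow> 'e \<Rightarrow> 'f"
  where "local_rep c d f = snd d \<circ> f \<circ> inv_into (fst c) (snd c)"

definition local_dom :: "('m, 'e) chart \<Rightarrow> ('n, 'f) chart \<Rightarrow> ('m \<Rightarrow> 'n) \<Rightarrow> 'e set"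
  where "local_dom c d f = snd c ` (fst c \<inter> f -` fst d)"

definition smooth_atlas :: "('m::topological_space, 'e::real_normed_vector) chart set \<Rightarrow> bool"
  where "smooth_atlas A \<longleftrightarrow>
     (\<forall>c\<in>A. is_chart c) \<and> (\<Union>c\<in>A. fst c) = UNIV \<and>
     (\<forall>c\<in>A. \<forall>d\<in>A. smooth_on (local_dom c d id) (local_rep c d id))"

definition smooth_map ::
    "('m::topological_space, 'e::real_normed_vector) chart set \<Rightarrow>
     ('n::topological_space, 'f::real_normed_vector) chart set \<Rightarrow> ('m \<Rightarrow> 'n) \<Rightarrow> bool"
  where "smooth_map A B f \<longleftrightarrow> continuous_on UNIV f \<and>
     (\<forall>c\<in>A. \<forall>d\<in>B. smooth_on (local_dom c d f) (local_rep c d f))"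

definition prod_atlas :: "('m, 'e) chart set \<Rightarrow> ('n, 'f) chart set \<Rightarrow> ('m \<times> 'n, 'e \<times> 'f) chart set"
  where "prod_atlas A B = {(fst c \<times> fst d, map_prod (snd c) (snd d)) | c d. c \<in> A \<and> d \<in> B}"

definition charts_at :: "('m, 'e) chart set \<Rightarrow> 'm \<Rightarrow> ('m, 'e) chart set"
  where "charts_at A p = {c \<in> A. p \<in> fst c}"

text \<open>
  A tangent vector at \<open>p\<close> is the family of its coordinate vectors in all charts around \<open>p\<close>, where
  the coordinate vectors are related by the derivatives of the chart transitions. The value 0 at
  the other charts makes the tangent space a linear subspace.
\<close>

definition tangent_space ::
    "('m, 'e::real_normed_vector) chart set \<Rightarrow> 'm \<Rightarrow> (('m, 'e) chart \<Rightarrow> 'e) set"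
  where "tangent_space A p = {v.
     (\<forall>c. c \<notin> charts_at A p \<longrightarrow> v c = 0) \<and>
     (\<forall>c\<in>charts_at A p. \<forall>d\<in>charts_at A p.
        v d = frechet_derivative (local_rep c d id) (at (snd c p)) (v c))}"

text \<open>
  The value \<open>differential A B f p v\<close> is the tangent vector at \<open>f p\<close> given in coordinates by the
  derivative of the local representations of \<open>f\<close>. It is meaningful for \<open>f\<close> differentiable at \<open>p\<close>.
\<close>

definition differential ::
    "('m, 'e::real_normed_vector) chart set \<Rightarrow> ('n, 'f::real_normed_vector) chart set \<Rightarrow>
     ('m \<Rightarrow> 'n) \<Rightarrow> 'm \<Rightarrow> (('m, 'e) chart \<Rightarrow> 'e) \<Rightarrow> (('n, 'f) chart \<Rightarrow> 'f)"
  where "differential A B f p v = (THE w. w \<in> tangent_space B (f p) \<and>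
     (\<forall>c\<in>charts_at A p. \<forall>d\<in>charts_at B (f p).
        w d = frechet_derivative (local_rep c d f) (at (snd c p)) (v c)))"

text \<open>
  Groups are written additively, following \<^class>\<open>topological_group_add\<close>, but are not assumed
  commutative: \<open>x + y\<close>, \<open>- x\<close> and \<open>0\<close> are the product, the inverse and the identity.
\<close>

definition lie_group ::
    "('g::{topological_group_add, t2_space}, 'e::finite_dim_inner) chart set \<Rightarrow> bool"
  where "lie_group A \<longleftrightarrow> smooth_atlas A \<and>
     smooth_map (prod_atlas A A) A (\<lambda>(x, y). x + y) \<and> smooth_map A A uminus"

text \<open>
  Only the vector space structure of the Lie algebra is used; the bracket is omitted.
\<close>

abbreviation lie_algebra ::
    "('g::{topological_group_add, t2_space}, 'e::finite_dim_inner) chart set \<Rightarrow>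
     (('g, 'e) chart \<Rightarrow> 'e) set"
  where "lie_algebra A \<equiv> tangent_space A 0"

definition pseudo_orbit :: "('g::group_add \<Rightarrow> 'g) \<Rightarrow> 'g set \<Rightarrow> (nat \<Rightarrow> 'g) \<Rightarrow> bool"
  where "pseudo_orbit \<alpha> V x \<longleftrightarrow> (\<forall>k. - \<alpha> (x k) + x (Suc k) \<in> V)"

definition shadowed_by :: "('g::group_add \<Rightarrow> 'g) \<Rightarrow> 'g set \<Rightarrow> (nat \<Rightarrow> 'g) \<Rightarrow> 'g \<Rightarrow> bool"
  where "shadowed_by \<alpha> U x y \<longleftrightarrow> (\<forall>k. - (\<alpha> ^^ k) y + x k \<in> U)"

definition has_shadowing :: "('g::topological_group_add \<Rightarrow> 'g) \<Rightarrow> bool"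
  where "has_shadowing \<alpha> \<longleftrightarrow>
     (\<forall>U. 0 \<in> interior U \<longrightarrow>
        (\<exists>V. 0 \<in> interior V \<and> (\<forall>x. pseudo_orbit \<alpha> V x \<longrightarrow> (\<exists>y. shadowed_by \<alpha> U x y))))"

text \<open>
  The complexification of a subspace \<open>V\<close> is \<open>V \<times> V\<close>, where \<open>(u, w)\<close> stands for \<open>u + \<i> w\<close>; the
  complexification of an endomorphism \<open>T\<close> of \<open>V\<close> is \<open>map_prod T T\<close>.
\<close>

definition scaleC :: "complex \<Rightarrow> 'v::real_vector \<times> 'v \<Rightarrow> 'v \<times> 'v"
  where "scaleC z x =
     (Re z *\<^sub>R fst x - Im z *\<^sub>R snd x, Im z *\<^sub>R fst x + Re z *\<^sub>R snd x)"

definition complex_spectrum :: "'v::real_vector set \<Rightarrow> ('v \<Rightarrow> 'v) \<Rightarrow> complex set"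
  where "complex_spectrum V T =
     {z. \<not> bij_betw (\<lambda>x. map_prod T T x - scaleC z x) (V \<times> V) (V \<times> V)}"

definition hyperbolic_on :: "'v::real_vector set \<Rightarrow> ('v \<Rightarrow> 'v) \<Rightarrow> bool"
  where "hyperbolic_on V T \<longleftrightarrow> complex_spectrum V T \<inter> {z. cmod z = 1} = {}"

end

theory Submission
  imports Defs "HOL-Computational_Algebra.Fundamental_Theorem_Algebra"
begin

text \<open>
  Writing \<open>x\<^sub>k = \<alpha>\<^sup>k y + u\<^sub>k\<close>, a point \<open>y\<close> shadows a pseudo-orbit iff the errors \<open>u\<^sub>k\<close>, which satisfy
  \<open>u\<^sub>k\<^sub>+\<^sub>1 = \<alpha> u\<^sub>k + v\<^sub>k\<close> with the jumps \<open>v\<^sub>k\<close>, stay small. So shadowing is a local property at the identity,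
  and in logarithmic coordinates, where \<open>\<alpha>\<close> is the linear map \<open>L = d\<alpha>\<close>, the recursion becomes
  \<open>u\<^sub>k\<^sub>+\<^sub>1 = L u\<^sub>k + w\<^sub>k + o(|w\<^sub>k|)\<close>. If \<open>L\<close> is hyperbolic, the linear recursion has bounded solutions
  for bounded \<open>w\<close>, and a contraction argument absorbs the error term. If \<open>L\<close> has an eigenvalue
  \<open>z\<close> with \<open>|z| = 1\<close>, then jumps in the direction \<open>z\<^sup>k\<close> make \<open>z\<^sup>-\<^sup>k u\<^sub>k\<close> drift away along an eigenfunctional.

  The logarithmic coordinates come from \<open>exp x = lim 2\<^sup>n \<cdot> (2\<^sup>-\<^sup>n x)\<close>, where \<open>2\<^sup>n \<cdot>\<close> is iterated doubling in
  the group and \<open>2\<^sup>-\<^sup>n x\<close> is scaling in a chart. A continuous homomorphism commutes with doubling,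
  and is therefore linear near \<open>0\<close> in these coordinates.
\<close>

section \<open>Finite-dimensional inner product spaces\<close>

text \<open>The group is given by charts only and the homomorphism is merely continuous, so neither
  an exponential map nor a derivative of \<open>\<alpha>\<close> at the identity can be presupposed;
  both come out of doubling. The tool throughout is strict differentiability of the group law at the
  identity: differences of two products are compared with differences of sums. Two errors with the
  same jump give a perturbation that is Lipschitz with a small constant, as the contraction argument
  requires; the jumps \<open>w\<close> and 0 with the same error give a remainder small relative to
  \<open>w\<close> alone, as the drift argument requires. Two failures of uniqueness shape the rest.
  Bounded solutions of the linear recursion are not unique, so the nonlinear recursion is solved by
  successive corrections instead of inverting an operator. The polynomial found to annihilate
  \<open>L\<close> need not be minimal, so it may have roots on the unit circle although
  \<open>L\<close> is hyperbolic. The model space may have dimension 0, hence the basic facts on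
  finite dimension are derived for the class \<open>finite_dim_inner\<close>.\<close>

lemma ex_orthogonal_basis:
  "\<exists>B :: 'a::finite_dim_inner set. finite B \<and> (\<forall>x. x = (\<Sum>b\<in>B. (x \<bullet> b / (b \<bullet> b)) *\<^sub>R b))"
proof -
  obtain B0 :: "'a set" where B0: "finite B0" "\<And>x. \<exists>u. x = (\<Sum>b\<in>B0. u b *\<^sub>R b)"
    using finite_dim by blast
  obtain C where C: "finite C" "span C = span B0" "pairwise orthogonal C"
    using basis_orthogonal[OF B0(1)] by blast
  have sp: "x \<in> span C" for x
    unfolding C(2) span_finite[OF B0(1)] using B0(2)[of x] by blast
  let ?B = "C - {0}"
  show ?thesis
  proof (intro exI[of _ ?B] conjI allI)
    show "finite ?B" using C by auto
    fix x
    have "x \<in> span ?B" using sp by (simp add: span_delete_0)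
    then obtain u where u: "x = (\<Sum>b\<in>?B. u b *\<^sub>R b)"
      unfolding span_finite[OF \<open>finite ?B\<close>] by blast
    have "x \<bullet> b = u b * (b \<bullet> b)" if b: "b \<in> ?B" for b
    proof -
      have "x \<bullet> b = (\<Sum>b'\<in>?B. u b' * (b' \<bullet> b))"
        unfolding u by (simp add: inner_sum_left)
      also have "\<dots> = (\<Sum>b'\<in>?B. if b' = b then u b * (b \<bullet> b) else 0)"
        using C(3) b by (intro sum.cong) (auto simp: pairwise_def orthogonal_def)
      also have "\<dots> = u b * (b \<bullet> b)" using b C(1) by (simp add: sum.delta)
      finally show ?thesis .
    qed
    then have "(\<Sum>b\<in>?B. (x \<bullet> b / (b \<bullet> b)) *\<^sub>R b) = (\<Sum>b\<in>?B. u b *\<^sub>R b)"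
      by (intro sum.cong) auto
    then show "x = (\<Sum>b\<in>?B. (x \<bullet> b / (b \<bullet> b)) *\<^sub>R b)"
      using u by (rule trans[OF _ sym, rotated])
  qed
qed

text \<open>The coefficients are inner products with fixed vectors, hence bounded linear in
  \<open>x\<close>; completeness and the boundedness of linear maps rest on this.\<close>

definition ortho_basis :: "'a::finite_dim_inner set" where
  "ortho_basis = (SOME B. finite B \<and> (\<forall>x. x = (\<Sum>b\<in>B. (x \<bullet> b / (b \<bullet> b)) *\<^sub>R b)))"

lemma finite_ortho_basis: "finite (ortho_basis :: 'a::finite_dim_inner set)"
  and ortho_basis_expansion:
    "(\<Sum>b\<in>ortho_basis. (x \<bullet> b / (b \<bullet> b)) *\<^sub>R b) = (x :: 'a)"
  using someI_ex[OF ex_orthogonal_basis[where ?'a = 'a], folded ortho_basis_def]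
  by (blast, metis)

instance finite_dim_inner \<subseteq> complete_space
proof
  fix X :: "nat \<Rightarrow> 'a::finite_dim_inner"
  assume X: "Cauchy X"
  let ?B = "ortho_basis :: 'a set"
  have "convergent (\<lambda>n. X n \<bullet> b)" for b
    using bounded_linear.Cauchy[OF bounded_linear_inner_left X] Cauchy_convergent by blast
  then obtain l where l: "\<And>b. (\<lambda>n. X n \<bullet> b) \<longlonglongrightarrow> l b"
    unfolding convergent_def by metis
  have "(\<lambda>n. \<Sum>b\<in>?B. (X n \<bullet> b * inverse (b \<bullet> b)) *\<^sub>R b) \<longlonglongrightarrow> (\<Sum>b\<in>?B. (l b * inverse (b \<bullet> b)) *\<^sub>R b)"
    by (intro tendsto_intros l)
  moreover have "(\<lambda>n. \<Sum>b\<in>?B. (X n \<bullet> b * inverse (b \<bullet> b)) *\<^sub>R b) = X"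
    by (simp add: divide_inverse[symmetric] ortho_basis_expansion)
  ultimately show "convergent X"
    unfolding convergent_def by auto
qed

instance finite_dim_inner \<subseteq> banach ..

text \<open>The complexification of \<open>'v\<close> is modelled on \<open>'v \<times> 'v\<close>,
  so the spectral arguments need this class for products.\<close>

instance prod :: (finite_dim_inner, finite_dim_inner) finite_dim_inner
proof
  let ?B = "ortho_basis :: 'a set"
  let ?C = "ortho_basis :: 'b set"
  let ?D = "(\<lambda>b. (b, 0)) ` ?B \<union> (\<lambda>c. (0, c)) ` ?C"
  have fin: "finite ?D" by (simp add: finite_ortho_basis)
  have "x \<in> span ?D" for x :: "'a \<times> 'b"
  proof -
    have "(\<Sum>b\<in>?B. (fst x \<bullet> b / (b \<bullet> b)) *\<^sub>R (b, 0)) + (\<Sum>c\<in>?C. (snd x \<bullet> c / (c \<bullet> c)) *\<^sub>R (0, c)) \<in> span ?D"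
      by (intro span_add span_sum span_scale span_base) auto
    also have "(\<Sum>b\<in>?B. (fst x \<bullet> b / (b \<bullet> b)) *\<^sub>R (b, 0 :: 'b)) + (\<Sum>c\<in>?C. (snd x \<bullet> c / (c \<bullet> c)) *\<^sub>R (0 :: 'a, c)) = x"
      by (rule prod_eqI) (simp_all add: fst_sum snd_sum ortho_basis_expansion)
    finally show ?thesis .
  qed
  then show "\<exists>B. finite B \<and> (\<forall>x :: 'a \<times> 'b. \<exists>u. x = (\<Sum>b\<in>B. u b *\<^sub>R b))"
    using fin span_finite[OF fin] by blast
qed

lemma linear_imp_bounded_linear:
  fixes f :: "'a::finite_dim_inner \<Rightarrow> 'b::real_normed_vector"
  assumes "linear f"
  shows "bounded_linear f"
proof -
  let ?B = "ortho_basis :: 'a set"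
  have "f x = (\<Sum>b\<in>?B. (x \<bullet> b / (b \<bullet> b)) *\<^sub>R f b)" for x
    using arg_cong[OF ortho_basis_expansion[of x, symmetric], of f] by (simp only: linear_sum[OF assms] linear_scale[OF assms])
  then have "f = (\<lambda>x. \<Sum>b\<in>?B. ((x \<bullet> b) * inverse (b \<bullet> b)) *\<^sub>R f b)"
    unfolding divide_inverse by (rule ext)
  moreover have "bounded_linear \<dots>"
    by (intro bounded_linear_sum bounded_linear_compose[OF bounded_linear_scaleR_left]
        bounded_linear_compose[OF bounded_linear_mult_left] bounded_linear_inner_left)
  ultimately show ?thesis by simp
qed

text \<open>Gives access to dimension counting, both for annihilating polynomials and for the step
  from surjective to injective endomorphisms.\<close>

lemma finite_dim_inner_basis:
  obtains B :: "'a::finite_dim_inner set" where "finite_dimensional_vector_space scaleR B"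
proof -
  obtain B0 :: "'a set" where B0: "finite B0" "\<And>x. \<exists>u. x = (\<Sum>b\<in>B0. u b *\<^sub>R b)"
    using finite_dim by blast
  have "span B0 = UNIV" using B0(2) span_finite[OF B0(1)] by blast
  moreover obtain B where "B \<subseteq> B0" "independent B" "B0 \<subseteq> span B"
    using maximal_independent_subset by blast
  ultimately have "finite B" "independent B" "span B = UNIV"
    using B0(1) by (auto simp: finite_subset) (metis (full_types) UNIV_I span_mono span_span subsetD)
  then show thesis
    by (intro that[of B] finite_dimensional_vector_space.intro real_vector.vector_space_axioms
        finite_dimensional_vector_space_axioms.intro) (auto simp: dependent_raw_def span_raw_def)
qed

section \<open>Local analysis in normed spaces\<close>

text \<open>\<open>C_on\<close> controls directional derivatives one direction at a time. As
  \<open>K\<close> is uniform in \<open>f\<close> and \<open>M\<close>, bounds along finitely many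
  basis vectors become operator norm bounds valid on a whole neighbourhood.\<close>

lemma linear_bound_on_basis:
  "\<exists>K>0. \<forall>(f :: 'a::finite_dim_inner \<Rightarrow> 'b::real_normed_vector) M x. linear f \<longrightarrow> M \<ge> 0 \<longrightarrow>
     (\<forall>b\<in>ortho_basis. norm (f b) \<le> M) \<longrightarrow> norm (f x) \<le> K * M * norm x"
proof -
  define k where "k = (\<Sum>b\<in>(ortho_basis :: 'a set). norm b / (b \<bullet> b))"
  have k0: "k \<ge> 0" unfolding k_def by (intro sum_nonneg) auto
  have "norm (f x) \<le> (1 + k) * M * norm x"
    if f: "linear f" and M: "M \<ge> 0" and b: "\<And>b. b \<in> ortho_basis \<Longrightarrow> norm (f b) \<le> M"
    for f :: "'a \<Rightarrow> 'b" and M x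
  proof -
    have "f x = (\<Sum>b\<in>ortho_basis. (x \<bullet> b / (b \<bullet> b)) *\<^sub>R f b)"
      using arg_cong[OF ortho_basis_expansion[of x, symmetric], of f]
      by (simp only: linear_sum[OF f] linear_scale[OF f])
    also have "norm \<dots> \<le> (\<Sum>b\<in>(ortho_basis :: 'a set). norm x * M * (norm b / (b \<bullet> b)))"
    proof (rule sum_norm_le)
      fix b :: 'a assume "b \<in> ortho_basis"
      have "norm ((x \<bullet> b / (b \<bullet> b)) *\<^sub>R f b) = \<bar>x \<bullet> b\<bar> / (b \<bullet> b) * norm (f b)" by simp
      also have "\<dots> \<le> (norm x * norm b) / (b \<bullet> b) * M"
        by (intro mult_mono divide_right_mono Cauchy_Schwarz_ineq2 b \<open>b \<in> ortho_basis\<close>) auto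
      finally show "norm ((x \<bullet> b / (b \<bullet> b)) *\<^sub>R f b) \<le> norm x * M * (norm b / (b \<bullet> b))"
        by (simp add: mult_ac)
    qed
    also have "\<dots> = k * M * norm x" by (simp add: k_def sum_distrib_left mult_ac)
    also have "\<dots> \<le> (1 + k) * M * norm x" using M by (intro mult_right_mono) auto
    finally show ?thesis .
  qed
  then show ?thesis using k0 by (intro exI[of _ "1 + k"]) auto
qed

text \<open>The double difference vanishes both for \<open>x = 0\<close> and for
  \<open>y = y'\<close>, so two successive mean value estimates bound it by a mixed second
  derivative times both increments. In the application \<open>i\<close> and \<open>j\<close> are the
  inclusions of the two factors and \<open>f\<close> is the group law in a chart; this is how
  smoothness enters the construction of logarithmic coordinates.\<close>

lemma C2_mixed_difference:
  fixes f :: "'p::real_normed_vector \<Rightarrow> 'c::real_normed_vector"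
    and i :: "'x::finite_dim_inner \<Rightarrow> 'p" and j :: "'y::finite_dim_inner \<Rightarrow> 'p"
  assumes f: "C_on 2 S f" and S: "open S" "p \<in> S" and i: "bounded_linear i" and j: "bounded_linear j"
  shows "\<exists>C>0. \<exists>r>0. \<forall>x y y'. norm x < r \<longrightarrow> norm y < r \<longrightarrow> norm y' < r \<longrightarrow>
    norm (f (p + i x + j y) - f (p + i x + j y') - (f (p + j y) - f (p + j y')))
      \<le> C * norm x * norm (y - y')"
proof -
  define D where "D q = frechet_derivative f (at q)" for q
  define g where "g b q = D q (j b)" for b q
  define Dg where "Dg b q = frechet_derivative (g b) (at q)" for b q
  have f': "(f has_derivative D q) (at q)" if "q \<in> S" for q
    using f that by (auto simp: numeral_2_eq_2 D_def frechet_derivative_works)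
  have g': "(g b has_derivative Dg b q) (at q)" if "q \<in> S" for b q
    using f that unfolding numeral_2_eq_2 C_on.simps Dg_def g_def[abs_def] D_def 
    by (auto simp: frechet_derivative_works)
  have cont: "continuous_on S (\<lambda>q. Dg b q v)" for b v
    using f unfolding numeral_2_eq_2 C_on.simps Dg_def g_def[abs_def] D_def by auto
  \<comment> \<open>The summand 1 makes the bound strict at \<open>p\<close>, so that it persists
    near \<open>p\<close> by continuity.\<close>
  define M where "M = 1 + (\<Sum>b\<in>(ortho_basis :: 'y set). \<Sum>b'\<in>(ortho_basis :: 'x set). norm (Dg b p (i b')))"
  have M1: "M > 0" unfolding M_def by (intro add_pos_nonneg sum_nonneg) auto
  have MM: "norm (Dg b p (i b')) < M" if "b \<in> ortho_basis" "b' \<in> ortho_basis" for b b'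
  proof -
    have "norm (Dg b p (i b')) \<le> (\<Sum>b'\<in>ortho_basis. norm (Dg b p (i b')))"
      by (intro member_le_sum that finite_ortho_basis) auto
    also have "\<dots> \<le> (\<Sum>b\<in>ortho_basis. \<Sum>b'\<in>ortho_basis. norm (Dg b p (i b')))"
      by (intro member_le_sum[of b _ "\<lambda>b. \<Sum>b'\<in>ortho_basis. norm (Dg b p (i b'))"]
          that finite_ortho_basis sum_nonneg) auto
    finally show ?thesis by (simp add: M_def)
  qed
  have "\<forall>\<^sub>F q in nhds p. q \<in> S \<and> (\<forall>b\<in>(ortho_basis :: 'y set). \<forall>b'\<in>(ortho_basis :: 'x set). norm (Dg b q (i b')) < M)"
  proof (intro eventually_conj eventually_nhds_in_open S eventually_ball_finite finite_ortho_basis ballI)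
    fix b :: 'y and b' :: 'x assume b: "b \<in> ortho_basis" "b' \<in> ortho_basis"
    have "((\<lambda>q. Dg b q (i b')) \<longlongrightarrow> Dg b p (i b')) (nhds p)"
      using cont[of b "i b'"] S unfolding continuous_on_eq_continuous_at[OF S(1)]
      by (auto simp: isCont_def tendsto_at_iff_tendsto_nhds[of "\<lambda>q. Dg b q (i b')" p])
    from order_tendstoD(2)[OF tendsto_norm[OF this] MM[OF b]]
    show "\<forall>\<^sub>F q in nhds p. norm (Dg b q (i b')) < M" .
  qed
  then obtain R where R: "R > 0" "\<And>q. dist q p < R \<Longrightarrow> q \<in> S"
      "\<And>q b b'. dist q p < R \<Longrightarrow> b \<in> ortho_basis \<Longrightarrow> b' \<in> ortho_basis \<Longrightarrow> norm (Dg b q (i b')) < M"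
    unfolding eventually_nhds_metric by blast
  obtain Ki where Ki: "Ki > 0" "\<And>x. norm (i x) \<le> norm x * Ki"
    using bounded_linear.pos_bounded[OF i] by blast
  obtain Kj where Kj: "Kj > 0" "\<And>x. norm (j x) \<le> norm x * Kj"
    using bounded_linear.pos_bounded[OF j] by blast
  define r where "r = R / (Ki + Kj)"
  have r: "r > 0" using R(1) Ki(1) Kj(1) by (simp add: r_def)
  have near: "dist (p + i x + j y) p < R" if "norm x < r" "norm y < r" for x y
  proof -
    have "dist (p + i x + j y) p = norm (i x + j y)" by (simp add: dist_norm)
    also have "\<dots> \<le> norm x * Ki + norm y * Kj"
      by (intro norm_triangle_le add_mono Ki Kj)
    also have "\<dots> < r * Ki + r * Kj" using that Ki(1) Kj(1) by (intro add_strict_mono mult_strict_right_mono)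
    also have "\<dots> = r * (Ki + Kj)" by (simp add: algebra_simps)
    also have "\<dots> = R" using Ki(1) Kj(1) by (simp add: r_def)
    finally show ?thesis .
  qed
  have near0: "dist (p + j y) p < R" if "norm y < r" for y
    using near[of 0 y] r that by (simp add: bounded_linear.linear[OF i] linear_0)
  obtain K where K: "K > 0" "\<And>(f :: 'x \<Rightarrow> 'c) M x. linear f \<Longrightarrow> M \<ge> 0 \<Longrightarrow>
     (\<forall>b\<in>ortho_basis. norm (f b) \<le> M) \<Longrightarrow> norm (f x) \<le> K * M * norm x"
    using linear_bound_on_basis[where ?'a = 'x and ?'b = 'c] by blast
  obtain K' where K': "K' > 0" "\<And>(f :: 'y \<Rightarrow> 'c) M x. linear f \<Longrightarrow> M \<ge> 0 \<Longrightarrow>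
     (\<forall>b\<in>ortho_basis. norm (f b) \<le> M) \<Longrightarrow> norm (f x) \<le> K' * M * norm x"
    using linear_bound_on_basis[where ?'a = 'y and ?'b = 'c] by blast
  have aff_i: "((\<lambda>x. p + i x + j y) has_derivative i) (at x within A)" for x y A
    using i by (auto intro!: derivative_eq_intros bounded_linear_imp_has_derivative)
  have aff_j: "((\<lambda>y. p + i x + j y) has_derivative j) (at y within A)" for x y A
    using j by (auto intro!: derivative_eq_intros bounded_linear_imp_has_derivative)
  have aff_j0: "((\<lambda>y. p + j y) has_derivative j) (at y within A)" for y A
    using j by (auto intro!: derivative_eq_intros bounded_linear_imp_has_derivative)
  \<comment> \<open>Mean value estimate in \<open>x\<close> for the derivatives of \<open>f\<close>
    along \<open>j b\<close>. It bounds the \<open>y\<close>-derivative of the double difference by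
    a multiple of \<open>norm x\<close>, and the second estimate integrates this in
    \<open>y\<close>.\<close>
  have step1: "norm (g b (p + i x + j y) - g b (p + j y)) \<le> K * M * norm x"
    if "norm x < r" "norm y < r" "b \<in> ortho_basis" for x y b
  proof -
    have "norm (g b (p + i x + j y) - g b (p + i 0 + j y)) \<le> K * M * norm (x - 0)"
    proof (rule differentiable_bound[of "ball 0 r" "\<lambda>x. g b (p + i x + j y)" "\<lambda>x v. Dg b (p + i x + j y) (i v)"])
      fix x assume x: "x \<in> ball (0 :: 'x) r"
      have d: "dist (p + i x + j y) p < R" using x that by (intro near) auto
      show der: "((\<lambda>x. g b (p + i x + j y)) has_derivative (\<lambda>v. Dg b (p + i x + j y) (i v))) (at x within ball 0 r)"
        using has_derivative_compose[OF aff_i g'[OF R(2)[OF d]]] .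
      show "onorm (\<lambda>v. Dg b (p + i x + j y) (i v)) \<le> K * M"
      proof (rule onorm_bound)
        fix v
        show "norm (Dg b (p + i x + j y) (i v)) \<le> K * M * norm v"
          using K(2)[OF has_derivative_linear[OF der], of M v] R(3)[OF d \<open>b \<in> _\<close>] M1 by (auto simp: less_imp_le)
      qed (use K(1) M1 in simp)
    qed (use that r in auto)
    then show ?thesis by (simp add: bounded_linear.linear[OF i] linear_0)
  qed
  have "norm (f (p + i x + j y) - f (p + i x + j y') - (f (p + j y) - f (p + j y')))
      \<le> (K' * K * M) * norm x * norm (y - y')"
    if x: "norm x < r" and "norm y < r" "norm y' < r" for x y y'
  proof -
    have "norm ((f (p + i x + j y) - f (p + j y)) - (f (p + i x + j y') - f (p + j y')))
      \<le> (K' * (K * M * norm x)) * norm (y - y')"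
    proof (rule differentiable_bound[of "ball 0 r" "\<lambda>y. f (p + i x + j y) - f (p + j y)"
        "\<lambda>y v. D (p + i x + j y) (j v) - D (p + j y) (j v)"])
      fix y assume y: "y \<in> ball (0 :: 'y) r"
      have d: "dist (p + i x + j y) p < R" "dist (p + j y) p < R" using x y by (auto intro: near near0)
      show der: "((\<lambda>y. f (p + i x + j y) - f (p + j y)) has_derivative 
           (\<lambda>v. D (p + i x + j y) (j v) - D (p + j y) (j v))) (at y within ball 0 r)"
        by (intro has_derivative_diff has_derivative_compose[OF aff_j] has_derivative_compose[OF aff_j0]
            f' R(2) d)
      show "onorm (\<lambda>v. D (p + i x + j y) (j v) - D (p + j y) (j v)) \<le> K' * (K * M * norm x)"
      proof (rule onorm_bound)
        fix v
        show "norm (D (p + i x + j y) (j v) - D (p + j y) (j v)) \<le> K' * (K * M * norm x) * norm v"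
          using K'(2)[OF has_derivative_linear[OF der], of "K * M * norm x" v] step1[OF x, of y] y K(1) M1
          by (auto simp: g_def)
      qed (use K(1) K'(1) M1 in simp)
    qed (use that in auto)
    then show ?thesis by (simp add: algebra_simps)
  qed
  then show ?thesis using r K(1) K'(1) M1 by (intro exI[of _ "K' * K * M"] conjI exI[of _ r]) auto
qed

lemma near_identity_expands:
  fixes p :: "'a::real_normed_vector \<Rightarrow> 'a"
  assumes "norm (p x - p y) \<le> 1/2 * norm (x - y)"
  shows "norm (x - y) \<le> 2 * norm ((x + p x) - (y + p y))"
  using assms norm_triangle_ineq4[of "(x + p x) - (y + p y)" "p x - p y"] by (simp add: algebra_simps)

text \<open>Solving \<open>w + p w = y\<close> is the fixed point problem
  \<open>w = y - p w\<close>, a contraction with constant 1/2. If \<open>y\<close> is within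
  \<open>d/2\<close> of \<open>z\<close>, this map preserves the ball of radius \<open>d\<close>
  around \<open>x\<close>: one half of \<open>d\<close> pays for \<open>z - y\<close>, the other for
  the variation of \<open>p\<close>.\<close>

lemma near_identity_open:
  fixes p :: "'a::banach \<Rightarrow> 'a"
  assumes lip: "\<And>x y. x \<in> U \<Longrightarrow> y \<in> U \<Longrightarrow> norm (p x - p y) \<le> 1/2 * norm (x - y)"
    and U: "open U"
  shows "open ((\<lambda>x. x + p x) ` U)"
  unfolding open_contains_ball
proof
  fix z assume "z \<in> (\<lambda>x. x + p x) ` U"
  then obtain x where x: "x \<in> U" "z = x + p x" by blast
  obtain d where d: "d > 0" "cball x d \<subseteq> U" using U x(1) open_contains_cball by blast
  have "y \<in> (\<lambda>x. x + p x) ` U" if y: "y \<in> ball z (d/2)" for y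
  proof -
    have "\<exists>!w\<in>cball x d. y - p w = w"
    proof (rule Banach_fix[of _ "1/2"])
      show "complete (cball x d)" by (simp add: complete_eq_closed)
      show "(\<lambda>w. y - p w) ` cball x d \<subseteq> cball x d"
      proof safe
        fix w assume w: "w \<in> cball x d"
        have "norm (x - (y - p w)) = norm ((z - y) + (p w - p x))" using x(2) by (simp add: algebra_simps)
        also have "\<dots> \<le> d/2 + 1/2 * d"
        proof (intro norm_triangle_le add_mono)
          show "norm (z - y) \<le> d/2" using y by (simp add: dist_norm)
          have "norm (p w - p x) \<le> 1/2 * norm (w - x)" using w d x by (intro lip) auto
          also have "\<dots> \<le> 1/2 * d" using w by (simp add: dist_norm norm_minus_commute)
          finally show "norm (p w - p x) \<le> 1/2 * d" .
        qed
        finally show "y - p w \<in> cball x d" by (simp add: dist_norm)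
      qed
      fix v w assume "v \<in> cball x d" "w \<in> cball x d"
      then have "norm (p w - p v) \<le> 1/2 * norm (w - v)" using d by (intro lip) auto
      then show "dist (y - p v) (y - p w) \<le> 1/2 * dist v w"
        by (simp add: dist_norm norm_minus_commute)
    qed (use d in auto)
    then obtain w where "w \<in> cball x d" "y - p w = w" by blast
    then show ?thesis using d(2) by (intro image_eqI[of _ _ w]) (auto simp: algebra_simps)
  qed
  then show "\<exists>e>0. ball z e \<subseteq> (\<lambda>x. x + p x) ` U"
    using d(1) by (intro exI[of _ "d/2"]) auto
qed

text \<open>Additivity gives homogeneity for integers. Multiplied by \<open>n\<close>, the defect
  \<open>L (t x) - t L x\<close> equals the defect for the fractional part of \<open>n t\<close>,
  which is bounded independently of \<open>n\<close>; hence the defect is 0.\<close>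

lemma additive_bounded_imp_bounded_linear:
  fixes L :: "'a::real_normed_vector \<Rightarrow> 'b::real_normed_vector"
  assumes add: "\<And>x y. L (x + y) = L x + L y" and bound: "\<And>x. norm (L x) \<le> K * norm x"
  shows "bounded_linear L"
proof (rule bounded_linear_intro[where K = K])
  show "L (x + y) = L x + L y" for x y by (rule add)
  show "norm (L x) \<le> norm x * K" for x using bound[of x] by (simp add: mult.commute)
  interpret additive L by (standard) (rule add)
  have nat: "L (real n *\<^sub>R x) = real n *\<^sub>R L x" for n x
    by (induction n) (simp_all add: zero add scaleR_add_left)
  have int: "L (real_of_int n *\<^sub>R x) = real_of_int n *\<^sub>R L x" for n x
  proof (cases "n \<ge> 0")
    case True then show ?thesis using nat[of "nat n" x] by simp
  next
    case False then show ?thesis using nat[of "nat (- n)" x] by (simp add: minus)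
  qed
  fix t :: real and x
  have *: "real n * norm (L (t *\<^sub>R x) - t *\<^sub>R L x) \<le> 2 * (\<bar>K\<bar> * norm x)" for n :: nat
  proof -
    define f where "f = frac (n * t)"
    have f: "0 \<le> f" "f \<le> 1" by (auto simp: f_def less_imp_le[OF frac_lt_1])
    have nt: "n * t = of_int \<lfloor>n * t\<rfloor> + f" by (simp add: f_def frac_def)
    have "real n *\<^sub>R L (t *\<^sub>R x) = L ((n * t) *\<^sub>R x)" by (simp flip: nat)
    also have "\<dots> = of_int \<lfloor>n * t\<rfloor> *\<^sub>R L x + L (f *\<^sub>R x)"
      by (subst nt) (simp add: scaleR_add_left add int)
    also have "\<dots> = (n * t) *\<^sub>R L x + (L (f *\<^sub>R x) - f *\<^sub>R L x)"
      by (subst (2) nt) (simp add: scaleR_add_left)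
    finally have "real n *\<^sub>R (L (t *\<^sub>R x) - t *\<^sub>R L x) = L (f *\<^sub>R x) - f *\<^sub>R L x"
      by (simp add: scaleR_diff_right)
    then have "real n * norm (L (t *\<^sub>R x) - t *\<^sub>R L x) = norm (L (f *\<^sub>R x) - f *\<^sub>R L x)"
      by (metis norm_scaleR abs_of_nat)
    also have "\<dots> \<le> norm (L (f *\<^sub>R x)) + norm (f *\<^sub>R L x)" by (rule norm_triangle_ineq4)
    also have "\<dots> \<le> \<bar>K\<bar> * norm x + \<bar>K\<bar> * norm x"
    proof (rule add_mono)
      have "norm (L y) \<le> \<bar>K\<bar> * norm y" for y
        using bound[of y] mult_right_mono[of K "\<bar>K\<bar>" "norm y"] by (meson abs_ge_self norm_ge_zero order_trans)
      note B = this
      have "norm (L (f *\<^sub>R x)) \<le> \<bar>K\<bar> * (f * norm x)" using B[of "f *\<^sub>R x"] f by simp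
      also have "\<dots> \<le> \<bar>K\<bar> * (1 * norm x)" using f by (intro mult_left_mono mult_right_mono) auto
      finally show "norm (L (f *\<^sub>R x)) \<le> \<bar>K\<bar> * norm x" by simp
      have "norm (f *\<^sub>R L x) \<le> 1 * norm (L x)" unfolding norm_scaleR using f by (intro mult_right_mono) auto
      then show "norm (f *\<^sub>R L x) \<le> \<bar>K\<bar> * norm x" using B[of x] by simp
    qed
    finally show ?thesis by simp
  qed
  have "norm (L (t *\<^sub>R x) - t *\<^sub>R L x) \<le> 0"
  proof (rule ccontr)
    assume "\<not> ?thesis"
    then obtain n :: nat where "2 * (\<bar>K\<bar> * norm x) < real n * norm (L (t *\<^sub>R x) - t *\<^sub>R L x)"
      by (metis ex_less_of_nat_mult not_le)
    with *[of n] show False by simp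
  qed
  then show "L (t *\<^sub>R x) = t *\<^sub>R L x" by simp
qed

lemma ex_scaled_small:
  fixes x :: "'a::real_normed_vector"
  assumes "s > 0"
  shows "\<exists>n. norm ((1/2)^n *\<^sub>R x) < s"
proof -
  have "(\<lambda>n. (1/2)^n *\<^sub>R x) \<longlonglongrightarrow> 0 *\<^sub>R x"
    by (intro tendsto_scaleR tendsto_const LIMSEQ_power_zero) auto
  then have "\<forall>\<^sub>F n in sequentially. norm ((1/2)^n *\<^sub>R x) < s"
    using assms by (auto simp: tendsto_iff)
  then show ?thesis by (auto simp: eventually_sequentially)
qed

text \<open>Additivity makes \<open>T\<close> homogeneous under halving, so
  \<open>2^n T (x / 2^n)\<close> does not depend on \<open>n\<close> once \<open>x / 2^n\<close>
  lies in the ball, and this value defines the extension.\<close>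

lemma local_additive_extends:
  fixes T :: "'a::real_normed_vector \<Rightarrow> 'b::real_normed_vector"
  assumes s: "s > 0"
    and add: "\<And>x y. norm x < s \<Longrightarrow> norm y < s \<Longrightarrow> norm (x + y) < s \<Longrightarrow> T (x + y) = T x + T y"
    and bound: "\<And>x. norm x < s \<Longrightarrow> norm (T x) \<le> K * norm x"
  shows "\<exists>L. bounded_linear L \<and> (\<forall>x. norm x < s \<longrightarrow> L x = T x)"
proof -
  \<comment> \<open>The least admissible exponent is only a choice; the fact \<open>L\<close> below
    allows any other.\<close>
  define N where "N x = (LEAST n. norm ((1/2)^n *\<^sub>R x) < s)" for x :: 'a
  define L where "L x = 2 ^ N x *\<^sub>R T ((1/2) ^ N x *\<^sub>R x)" for x
  have half: "T x = 2 *\<^sub>R T ((1/2) *\<^sub>R x)" if "norm x < s" for x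
    using add[of "(1/2) *\<^sub>R x" "(1/2) *\<^sub>R x"] that norm_ge_zero[of x]
    by (simp add: scaleR_left_distrib[symmetric] scaleR_2[symmetric] del: scaleR_half_double)
  have halves: "T x = 2 ^ n *\<^sub>R T ((1/2) ^ n *\<^sub>R x)" if "norm x < s" for x n
  proof (induction n)
    case (Suc n)
    have "norm ((1/2) ^ n *\<^sub>R x) \<le> 1 * norm x"
      unfolding norm_scaleR by (intro mult_right_mono) (auto simp: power_le_one)
    from half[of "(1/2) ^ n *\<^sub>R x"] this that Suc show ?case by (simp add: mult_ac)
  qed simp
  have L: "L x = 2 ^ n *\<^sub>R T ((1/2) ^ n *\<^sub>R x)" if "norm ((1/2)^n *\<^sub>R x) < s" for x n
  proof -
    have Nx: "norm ((1/2)^N x *\<^sub>R x) < s" "N x \<le> n"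
      unfolding N_def by (rule LeastI[of _ n], rule that) (rule Least_le, rule that)
    have "T ((1/2) ^ N x *\<^sub>R x) = 2 ^ (n - N x) *\<^sub>R T ((1/2) ^ (n - N x) *\<^sub>R (1/2) ^ N x *\<^sub>R x)"
      by (rule halves) (rule Nx)
    then show ?thesis using Nx(2) by (simp add: L_def power_add[symmetric])
  qed
  have "bounded_linear L"
  proof (rule additive_bounded_imp_bounded_linear[where K = K])
    show "norm (L x) \<le> K * norm x" for x
    proof -
      obtain n where n: "norm ((1/2)^n *\<^sub>R x) < s" using ex_scaled_small[OF s] by blast
      have "norm (L x) = 2 ^ n * norm (T ((1/2) ^ n *\<^sub>R x))" unfolding L[OF n] by simp
      also have "\<dots> \<le> 2 ^ n * (K * norm ((1/2) ^ n *\<^sub>R x))" by (intro mult_left_mono bound n) auto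
      also have "\<dots> = K * norm x" by (simp add: power_divide)
      finally show ?thesis .
    qed
    fix x y :: 'a
    obtain n where n: "norm ((1/2)^n *\<^sub>R x) < s/2" using ex_scaled_small[of "s/2" x] s by auto
    obtain m where m: "norm ((1/2)^m *\<^sub>R y) < s/2" using ex_scaled_small[of "s/2" y] s by auto
    have le: "norm ((1/2)^(a + b) *\<^sub>R z) < s/2" if "norm ((1/2)^a *\<^sub>R z) < s/2" for a b and z :: 'a
    proof -
      have "norm ((1/2)^(a + b) *\<^sub>R z) = (1/2)^b * norm ((1/2)^a *\<^sub>R z)" by (simp add: power_add mult_ac)
      also have "\<dots> \<le> 1 * norm ((1/2)^a *\<^sub>R z)" by (intro mult_right_mono) (auto simp: power_le_one)
      finally show ?thesis using that by simp
    qed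
    have x: "norm ((1/2)^(n+m) *\<^sub>R x) < s/2" and y: "norm ((1/2)^(n+m) *\<^sub>R y) < s/2"
      using le[OF n, of m] le[OF m, of n] by (simp_all add: add.commute)
    have xy: "norm ((1/2)^(n+m) *\<^sub>R (x + y)) < s"
      using x y norm_triangle_ineq[of "(1/2)^(n+m) *\<^sub>R x" "(1/2)^(n+m) *\<^sub>R y"]
      by (simp only: scaleR_add_right)
    have x': "norm ((1/2)^(n+m) *\<^sub>R x) < s" and y': "norm ((1/2)^(n+m) *\<^sub>R y) < s"
      using x y s by linarith+
    show "L (x + y) = L x + L y"
      unfolding L[OF xy] L[OF x'] L[OF y']
      using add[OF x' y'] xy by (simp only: scaleR_add_right[symmetric])
  qed
  moreover have "L x = T x" if "norm x < s" for x using L[of 0 x] that by simp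
  ultimately show ?thesis by blast
qed

text \<open>
  The equation for \<open>p\<close> says that \<open>E = id + p\<close> satisfies \<open>E (2 x) = 2 E x + Q (E x)\<close>, so \<open>E\<close> linearizes
  the perturbed doubling map.
\<close>

lemma ex_conjugation_of_doubling:
  fixes Q :: "'a::banach \<Rightarrow> 'a"
  assumes R: "R > 0" and C: "C \<ge> 0" and Q0: "Q 0 = 0"
    and Q: "\<And>x y. norm x < R \<Longrightarrow> norm y < R \<Longrightarrow>
      norm (Q x - Q y) \<le> C * max (norm x) (norm y) * norm (x - y)"
  obtains r K p where "r > 0" "r \<le> R/2" "K \<ge> 0" "K * r \<le> 1/2" "p 0 = 0"
    "\<And>x y. norm x < r \<Longrightarrow> norm y < r \<Longrightarrow> norm (p x - p y) \<le> K * max (norm x) (norm y) * norm (x - y)"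
    "\<And>x. norm x < r \<Longrightarrow> p x = 2 *\<^sub>R p ((1/2) *\<^sub>R x) + Q ((1/2) *\<^sub>R x + p ((1/2) *\<^sub>R x))"
proof -
  \<comment> \<open>One iteration step turns the constant \<open>K\<close> in \<open>Lip\<close>
    into at most \<open>K/2 + (3/4)^2 * C\<close>: halving the argument gains a factor 1/4 against
    the doubling, and \<open>Q\<close> is evaluated at points of size at most 3/4 of that of
    \<open>x\<close>. This stays below \<open>K\<close> for \<open>K = 2 * C\<close>. The second
    entry of \<open>r\<close> enforces \<open>C * r \<le> 1/4\<close>.\<close>
  define K where "K = 2 * C"
  define r where "r = min (R/2) (1 / (4 * C + 4))"
  have r: "r > 0" "r \<le> R/2" using R C by (auto simp: r_def)
  have "C * r \<le> C * (1 / (4 * C + 4))" unfolding r_def using C by (intro mult_left_mono) auto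
  also have "\<dots> \<le> 1/4" using C by (simp add: field_simps)
  finally have Cr: "C * r \<le> 1/4" .
  have K: "K \<ge> 0" "K * r \<le> 1/2" using C Cr by (auto simp: K_def)
  define Lip where "Lip p \<longleftrightarrow> (\<forall>x y. norm x < r \<longrightarrow> norm y < r \<longrightarrow>
     norm (p x - p y) \<le> K * max (norm x) (norm y) * norm (x - y))" for p :: "'a \<Rightarrow> 'a"
  have small: "norm (p x) \<le> 1/2 * norm x" if "p 0 = 0" "Lip p" "norm x < r" for p x
  proof -
    have "norm (p x) \<le> K * norm x * norm x" using that r unfolding Lip_def by (metis diff_zero max_0R max.absorb1 norm_ge_zero norm_zero)
    also have "\<dots> \<le> K * r * norm x" using that K by (intro mult_right_mono mult_left_mono) auto
    also have "\<dots> \<le> 1/2 * norm x" using K by (intro mult_right_mono) auto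
    finally show ?thesis .
  qed
  have arg: "norm ((1/2) *\<^sub>R x + p ((1/2) *\<^sub>R x)) \<le> 3/4 * norm x" if "p 0 = 0" "Lip p" "norm x < r" for p x
    using small[OF that(1,2), of "(1/2) *\<^sub>R x"] that(3) norm_ge_zero[of x]
      norm_triangle_ineq[of "(1/2) *\<^sub>R x" "p ((1/2) *\<^sub>R x)"] by auto
  \<comment> \<open>With \<open>E_n x = x + P n x\<close> and \<open>d y = 2 y + Q y\<close> the
    recursion reads \<open>E_(n+1) x = d (E_n (x/2))\<close>. So \<open>E_n x\<close> is the
    \<open>n\<close>-fold perturbed doubling of \<open>x / 2^n\<close>, and the start
    \<open>P 0 = 0\<close> means \<open>E_0 = id\<close>.\<close>
  define P where "P = rec_nat (\<lambda>x. 0 :: 'a) (\<lambda>n p x. 2 *\<^sub>R p ((1/2) *\<^sub>R x) + Q ((1/2) *\<^sub>R x + p ((1/2) *\<^sub>R x)))"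
  have P0: "P 0 = (\<lambda>x. 0)"
    and PSuc: "P (Suc n) = (\<lambda>x. 2 *\<^sub>R P n ((1/2) *\<^sub>R x) + Q ((1/2) *\<^sub>R x + P n ((1/2) *\<^sub>R x)))" for n
    by (simp_all add: P_def)
  have inv: "P n 0 = 0 \<and> Lip (P n)" for n
  proof (induction n)
    case 0 then show ?case using K by (auto simp: P0 Lip_def intro!: mult_nonneg_nonneg max.coboundedI1)
  next
    case (Suc n)
    define p where "p = P n"
    have p: "p 0 = 0" "Lip p" using Suc by (auto simp: p_def)
    have "Lip (P (Suc n))"
      unfolding Lip_def
    proof (intro allI impI)
      fix x y :: 'a assume x: "norm x < r" and y: "norm y < r"
      define m where "m = max (norm x) (norm y)"
      define d where "d = norm (x - y)"
      have m: "norm x \<le> m" "norm y \<le> m" "m < r" "m \<ge> 0" and d: "d \<ge> 0" using x y by (auto simp: m_def d_def max_def)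
      let ?a = "(1/2) *\<^sub>R x + p ((1/2) *\<^sub>R x)" and ?b = "(1/2) *\<^sub>R y + p ((1/2) *\<^sub>R y)"
      have a: "norm ?a \<le> 3/4 * m" "norm ?b \<le> 3/4 * m" using arg[OF p x] arg[OF p y] m by auto
      have "max (norm ((1/2) *\<^sub>R x)) (norm ((1/2) *\<^sub>R y)) = m / 2" by (simp add: m_def max_def)
      moreover have "norm ((1/2) *\<^sub>R x - (1/2) *\<^sub>R y) = d / 2"
        by (simp add: d_def flip: scaleR_diff_right)
      moreover have "norm ((1/2) *\<^sub>R x) < r" "norm ((1/2) *\<^sub>R y) < r" using x y r by auto
      ultimately have pd: "norm (p ((1/2) *\<^sub>R x) - p ((1/2) *\<^sub>R y)) \<le> K * (m/2) * (d/2)"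
        using p(2)[unfolded Lip_def, rule_format, of "(1/2) *\<^sub>R x" "(1/2) *\<^sub>R y"] by (simp only: if_True) 
      have "norm (?a - ?b) = norm (((1/2) *\<^sub>R x - (1/2) *\<^sub>R y) + (p ((1/2) *\<^sub>R x) - p ((1/2) *\<^sub>R y)))"
        by (simp add: algebra_simps)
      also have "\<dots> \<le> d/2 + K * (m/2) * (d/2)"
        by (intro norm_triangle_le add_mono pd) (simp add: d_def flip: scaleR_diff_right)
      also have "\<dots> \<le> d/2 + 1/2 * (d/2)"
      proof -
        have "K * (m/2) \<le> K * r" using K m by (intro mult_left_mono) auto
        then have "K * (m/2) \<le> 1/2" using K by linarith
        then show ?thesis using d by (intro add_left_mono mult_right_mono) auto
      qed
      finally have ab: "norm (?a - ?b) \<le> 3/4 * d" by simp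
      have "norm (Q ?a - Q ?b) \<le> C * max (norm ?a) (norm ?b) * norm (?a - ?b)"
        using a m r R by (intro Q) auto
      also have "\<dots> \<le> C * (3/4 * m) * (3/4 * d)"
        using C a ab m by (intro mult_mono) (auto simp: le_max_iff_disj)
      finally have Qab: "norm (Q ?a - Q ?b) \<le> C * (3/4 * m) * (3/4 * d)" .
      have "norm (P (Suc n) x - P (Suc n) y) = norm (2 *\<^sub>R (p ((1/2) *\<^sub>R x) - p ((1/2) *\<^sub>R y)) + (Q ?a - Q ?b))"
        by (simp add: PSuc p_def algebra_simps)
      also have "\<dots> \<le> 2 * (K * (m/2) * (d/2)) + C * (3/4 * m) * (3/4 * d)"
        using mult_left_mono[OF pd, of 2] by (intro norm_triangle_le add_mono Qab) (simp only: norm_scaleR, simp)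
      also have "\<dots> = (25/16 * C) * (m * d)" by (simp add: K_def algebra_simps)
      also have "\<dots> \<le> K * (m * d)" using C m d by (intro mult_right_mono) (auto simp: K_def)
      finally show "norm (P (Suc n) x - P (Suc n) y) \<le> K * max (norm x) (norm y) * norm (x - y)"
        by (simp add: m_def d_def mult_ac)
    qed
    then show ?case using p Q0 by (simp add: PSuc p_def)
  qed
  \<comment> \<open>One step expands a difference by at most 2 + 1/4, rounded up to 3, while the
    quadratic bound at \<open>x/2\<close> gains a factor 1/4; together this is the ratio
    3/4.\<close>
  have diff: "norm (P (Suc n) x - P n x) \<le> C * (3/4)^n * (norm x)\<^sup>2" if "norm x < r" for n x
    using that
  proof (induction n arbitrary: x)
    case 0
    have "norm (Q ((1/2) *\<^sub>R x) - Q 0) \<le> C * max (norm ((1/2) *\<^sub>R x)) (norm (0::'a)) * norm ((1/2) *\<^sub>R x - 0)"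
    proof (rule Q)
      have "norm x < R" using 0 r by linarith
      then show "norm ((1/2) *\<^sub>R x) < R" using R by simp
    qed (use R in simp)
    also have "\<dots> = C * (norm x)\<^sup>2 / 4" by (simp add: power2_eq_square max_def)
    also have "\<dots> \<le> C * (norm x)\<^sup>2" using C by simp
    finally show ?case using Q0 by (simp add: P0 PSuc)
  next
    case (Suc n)
    let ?x = "(1/2) *\<^sub>R x"
    let ?a = "?x + P (Suc n) ?x" and ?b = "?x + P n ?x"
    have a: "norm ?a \<le> 3/4 * norm x" "norm ?b \<le> 3/4 * norm x" using arg inv Suc.prems by blast+
    have ar: "norm ?a \<le> r" "norm ?b \<le> r" using a Suc.prems norm_ge_zero[of x] by linarith+
    have "norm x < 2 * r" using Suc.prems r(1) by linarith
    then have x2: "norm ?x < r" by simp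
    define e where "e = norm (P (Suc n) ?x - P n ?x)"
    have "norm (Q ?a - Q ?b) \<le> C * max (norm ?a) (norm ?b) * norm (?a - ?b)"
      using a Suc.prems r R by (intro Q) auto
    also have "\<dots> \<le> C * r * e"
      using C ar r(1) by (intro mult_mono) (auto simp: e_def le_max_iff_disj)
    also have "\<dots> \<le> 1/4 * e" by (intro mult_right_mono Cr) (simp add: e_def)
    finally have Qab: "norm (Q ?a - Q ?b) \<le> 1/4 * e" .
    have "norm (P (Suc (Suc n)) x - P (Suc n) x) = norm (2 *\<^sub>R (P (Suc n) ?x - P n ?x) + (Q ?a - Q ?b))"
      by (simp add: PSuc[of "Suc n"] PSuc[of n, THEN fun_cong, of x] scaleR_diff_right add_diff_add del: scaleR_half_double)
    also have "\<dots> \<le> 2 * e + 1/4 * e"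
      by (intro norm_triangle_le add_mono Qab) (simp add: e_def)
    also have "\<dots> \<le> 3 * e" by (simp add: e_def)
    also have "\<dots> \<le> 3 * (C * (3/4)^n * (norm ?x)\<^sup>2)" using Suc.IH[OF x2] by (simp add: e_def)
    also have "\<dots> = C * (3/4)^Suc n * (norm x)\<^sup>2" by (simp add: power2_eq_square)
    finally show ?case .
  qed
  define p where "p x = (\<Sum>n. P (Suc n) x - P n x)" for x
  have lim: "(\<lambda>n. P n x) \<longlonglongrightarrow> p x" if "norm x < r" for x
  proof -
    have "summable (\<lambda>n. P (Suc n) x - P n x)"
    proof (rule summable_norm_cancel, rule summable_comparison_test')
      show "summable (\<lambda>n. C * (3/4)^n * (norm x)\<^sup>2)"
        by (intro summable_mult2 summable_mult summable_geometric) auto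
      show "norm (norm (P (Suc n) x - P n x)) \<le> C * (3/4)^n * (norm x)\<^sup>2" if "n \<ge> 0" for n
        using diff[OF \<open>norm x < r\<close>] by simp
    qed
    from summable_LIMSEQ[OF this] show ?thesis
      unfolding p_def sum_lessThan_telescope[of "\<lambda>n. P n x"] P0 by simp
  qed
  have p0: "p 0 = 0" using inv r by (intro LIMSEQ_unique[OF lim[of 0]]) auto
  have lipp: "Lip p"
    unfolding Lip_def
  proof (intro allI impI)
    fix x y :: 'a assume x: "norm x < r" and y: "norm y < r"
    show "norm (p x - p y) \<le> K * max (norm x) (norm y) * norm (x - y)"
    proof (rule LIMSEQ_le_const2[OF tendsto_norm[OF tendsto_diff[OF lim[OF x] lim[OF y]]]])
      have "norm (P n x - P n y) \<le> K * max (norm x) (norm y) * norm (x - y)" for n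
        using inv[of n] x y unfolding Lip_def by blast
      then show "\<exists>N. \<forall>n\<ge>N. norm (P n x - P n y) \<le> K * max (norm x) (norm y) * norm (x - y)" by blast
    qed
  qed
  have eq: "p x = 2 *\<^sub>R p ((1/2) *\<^sub>R x) + Q ((1/2) *\<^sub>R x + p ((1/2) *\<^sub>R x))" if x: "norm x < r" for x
  proof (rule LIMSEQ_unique[of "\<lambda>n. P (Suc n) x"])
    show "(\<lambda>n. P (Suc n) x) \<longlonglongrightarrow> p x" using lim[OF x] by (rule LIMSEQ_Suc)
    let ?x = "(1/2) *\<^sub>R x"
    let ?a = "?x + p ?x" and ?b = "\<lambda>n. ?x + P n ?x"
    have "norm x < 2 * r" using x r(1) by linarith
    then have l: "(\<lambda>n. P n ?x) \<longlonglongrightarrow> p ?x" by (intro lim) auto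
    have "(\<lambda>n. Q (?b n)) \<longlonglongrightarrow> Q ?a"
    proof (rule LIM_zero_cancel, rule Lim_null_comparison[of _ "\<lambda>n. C * r * norm (?b n - ?a)"], intro always_eventually allI)
      fix n
      have a: "norm ?a \<le> 3/4 * norm x" "norm (?b n) \<le> 3/4 * norm x" using arg inv x p0 lipp by blast+
      have ar: "norm ?a \<le> r" "norm (?b n) \<le> r" using a x norm_ge_zero[of x] by linarith+
      have "norm (Q (?b n) - Q ?a) \<le> C * max (norm (?b n)) (norm ?a) * norm (?b n - ?a)"
        using ar r R by (intro Q) auto
      also have "\<dots> \<le> C * r * norm (?b n - ?a)"
        using C ar r(1) by (intro mult_mono) (auto simp: le_max_iff_disj)
      finally show "norm (Q (?b n) - Q ?a) \<le> C * r * norm (?b n - ?a)" .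
      show "(\<lambda>n. C * r * norm (?b n - ?a)) \<longlonglongrightarrow> 0"
        by (intro tendsto_mult_right_zero tendsto_norm_zero LIM_zero tendsto_add tendsto_const l)
    qed
    then show "(\<lambda>n. P (Suc n) x) \<longlonglongrightarrow> 2 *\<^sub>R p ?x + Q ?a"
      unfolding PSuc by (intro tendsto_add tendsto_scaleR tendsto_const l)
  qed
  show thesis
    by (rule that[of r K p, OF r K p0]) (blast intro: lipp[unfolded Lip_def, rule_format] eq)+
qed

section \<open>Bounded solutions of hyperbolic linear recursions\<close>

lemma linear_scaleC: "linear (scaleC z)"
  by (rule linearI) (auto simp: scaleC_def algebra_simps)

lemma scaleC_add_left: "scaleC (a + b) x = scaleC a x + scaleC b x"
  and scaleC_minus_left: "scaleC (- a) x = - scaleC a x"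
  and scaleC_mult: "scaleC (a * b) x = scaleC a (scaleC b x)"
  and scaleC_one: "scaleC 1 x = x"
  and scaleC_zero_left: "scaleC 0 x = 0"
  and scaleC_of_real: "scaleC (of_real r) x = r *\<^sub>R x"
  by (simp_all add: scaleC_def prod_eq_iff algebra_simps)

lemmas scaleC_add_right = linear_add[OF linear_scaleC]
  and scaleC_diff_right = linear_diff[OF linear_scaleC]
  and scaleC_minus_right = linear_neg[OF linear_scaleC]
  and scaleC_sum_right = linear_sum[OF linear_scaleC]

lemma norm_scaleC: "norm (scaleC z x) = cmod z * norm (x :: 'v::real_inner \<times> 'v)"
proof -
  have "(norm (scaleC z x))\<^sup>2 = (cmod z * norm x)\<^sup>2"
    unfolding power_mult_distrib cmod_power2
    by (simp add: power2_norm_eq_inner scaleC_def inner_prod_def inner_simps inner_commute)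
       (simp add: power2_eq_square algebra_simps)
  then show ?thesis by simp
qed

lemma bounded_linear_scaleC: "bounded_linear (scaleC z :: 'v::real_inner \<times> 'v \<Rightarrow> 'v \<times> 'v)"
  by (rule bounded_linear_intro[where K = "cmod z"])
     (auto simp: scaleC_add_right linear_scale[OF linear_scaleC] norm_scaleC)

lemma map_prod_scaleC: "linear L \<Longrightarrow> map_prod L L (scaleC z x) = scaleC z (map_prod L L x)"
  by (cases x) (simp add: scaleC_def linear_add linear_diff linear_scale)

lemma linear_map_prod: "linear L \<Longrightarrow> linear (map_prod L L)"
  by (rule linearI) (auto simp: linear_add linear_scale)

text \<open>For \<open>|z| < 1\<close> the recursion runs forward from 0, and \<open>C\<close> is
  the solution of \<open>|z| C + 1 = C\<close>. For \<open>|z| > 1\<close> forward errors would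
  grow, so each state is obtained from the future jumps:
  \<open>u_k = - (w_k / z + w_(k+1) / z^2 + ...)\<close>.\<close>

lemma bounded_solution_scaleC:
  fixes z :: complex
  assumes z: "cmod z \<noteq> 1"
  shows "\<exists>C\<ge>0. \<forall>M w. (\<forall>k. norm (w k :: 'v::finite_dim_inner \<times> 'v) \<le> M) \<longrightarrow>
    (\<exists>u. (\<forall>k. norm (u k) \<le> C * M) \<and> (\<forall>k. u (Suc k) = scaleC z (u k) + w k))"
proof (cases "cmod z < 1")
  case True
  define C where "C = 1 / (1 - cmod z)"
  have C: "C \<ge> 0" "cmod z * C + 1 = C" using True by (simp_all add: C_def field_simps)
  show ?thesis
  proof (intro exI[of _ C] conjI allI impI C(1))
    fix M and w :: "nat \<Rightarrow> 'v \<times> 'v" assume w: "\<forall>k. norm (w k) \<le> M"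
    define u where "u = rec_nat 0 (\<lambda>k v. scaleC z v + w k)"
    have u: "u 0 = 0" "u (Suc k) = scaleC z (u k) + w k" for k by (simp_all add: u_def)
    have M: "M \<ge> 0" using w norm_ge_zero order_trans by blast
    have "norm (u k) \<le> C * M" for k
    proof (induction k)
      case (Suc k)
      have "norm (u (Suc k)) \<le> cmod z * (C * M) + M"
        unfolding u(2) using Suc w by (intro norm_triangle_le add_mono) (auto simp: norm_scaleC intro: mult_left_mono)
      also have "\<dots> = (cmod z * C + 1) * M" by (simp add: algebra_simps)
      finally show ?case using C by simp
    qed (use C M u in simp)
    then show "\<exists>u. (\<forall>k. norm (u k) \<le> C * M) \<and> (\<forall>k. u (Suc k) = scaleC z (u k) + w k)"
      using u by blast
  qed
next
  case False
  with z have l1: "cmod z > 1" by simp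
  then have l0: "z \<noteq> 0" by auto
  define q where "q = 1 / cmod z"
  have q: "0 < q" "q < 1" using l1 by (auto simp: q_def divide_less_eq)
  define C where "C = q / (1 - q)"
  have C: "C \<ge> 0" using q by (simp add: C_def)
  show ?thesis
  proof (intro exI[of _ C] conjI allI impI C(1))
    fix M and w :: "nat \<Rightarrow> 'v \<times> 'v" assume w: "\<forall>k. norm (w k) \<le> M"
    define f where "f k j = scaleC (inverse z ^ Suc j) (w (k + j))" for k j
    have nf: "norm (f k j) \<le> q * M * q ^ j" for k j
    proof -
      have "norm (f k j) = q ^ Suc j * norm (w (k + j))"
        by (simp add: f_def norm_scaleC norm_mult norm_power norm_inverse q_def divide_inverse)
      also have "\<dots> \<le> q ^ Suc j * M" using q w by (intro mult_left_mono) auto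
      finally show ?thesis by (simp add: mult_ac)
    qed
    have sg: "(\<lambda>j. q * M * q ^ j) sums (q * M * (1 / (1 - q)))"
      using q by (intro sums_mult geometric_sums) auto
    have sn: "summable (\<lambda>j. norm (f k j))" for k
      by (rule summable_comparison_test'[OF sums_summable[OF sg], of 0]) (use nf in auto)
    have sf: "summable (f k)" for k by (rule summable_norm_cancel[OF sn])
    define u where "u k = - suminf (f k)" for k
    have "norm (u k) \<le> C * M" for k
    proof -
      have "norm (u k) \<le> (\<Sum>j. norm (f k j))" unfolding u_def norm_minus_cancel by (rule summable_norm[OF sn])
      also have "\<dots> \<le> (\<Sum>j. q * M * q ^ j)" by (intro suminf_le nf sn sums_summable[OF sg])
      also have "\<dots> = C * M" using sums_unique[OF sg] by (simp add: C_def)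
      finally show ?thesis .
    qed
    moreover have "u (Suc k) = scaleC z (u k) + w k" for k
    proof -
      have f0: "scaleC z (f k 0) = w k" using l0 by (simp add: f_def scaleC_one flip: scaleC_mult)
      have fS: "scaleC z (f k (Suc j)) = f (Suc k) j" for j
        using l0 by (simp add: f_def flip: scaleC_mult mult.assoc)
      have "scaleC z (suminf (f k)) = (\<Sum>j. scaleC z (f k j))"
        by (rule bounded_linear.suminf[OF bounded_linear_scaleC sf])
      also have "\<dots> = (\<Sum>j. f (Suc k) j) + w k"
        using suminf_split_initial_segment[OF bounded_linear.summable[OF bounded_linear_scaleC sf[of k]], of z 1]
        by (simp add: f0 fS)
      finally show ?thesis by (simp add: u_def scaleC_minus_right)
    qed
    ultimately show "\<exists>u. (\<forall>k. norm (u k) \<le> C * M) \<and> (\<forall>k. u (Suc k) = scaleC z (u k) + w k)" by blast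
  qed
qed

section \<open>Products of factors T - z of the complexification\<close>

definition cshift :: "('v::real_vector \<Rightarrow> 'v) \<Rightarrow> complex \<Rightarrow> 'v \<times> 'v \<Rightarrow> 'v \<times> 'v" where
  "cshift L z x = map_prod L L x - scaleC z x"

lemma linear_cshift: "linear L \<Longrightarrow> linear (cshift L z)"
  unfolding cshift_def[abs_def] by (intro linear_compose_sub linear_map_prod linear_scaleC)

lemma map_prod_cshift: "linear L \<Longrightarrow> map_prod L L (cshift L z x) = cshift L z (map_prod L L x)"
  by (simp add: cshift_def linear_diff[OF linear_map_prod] map_prod_scaleC)

primrec cshifts :: "('v::real_vector \<Rightarrow> 'v) \<Rightarrow> complex list \<Rightarrow> 'v \<times> 'v \<Rightarrow> 'v \<times> 'v" where
  "cshifts L [] x = x"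
| "cshifts L (z # zs) x = cshifts L zs (cshift L z x)"

lemma linear_cshifts: "linear L \<Longrightarrow> linear (cshifts L zs)"
proof (induction zs)
  case Nil
  then show ?case using linear_id by (simp add: id_def)
next
  case (Cons z zs)
  then show ?case using linear_compose[OF linear_cshift[OF Cons.prems] Cons.IH] by (simp add: o_def)
qed

lemma map_prod_cshifts: "linear L \<Longrightarrow> map_prod L L (cshifts L zs x) = cshifts L zs (map_prod L L x)"
  by (induction zs arbitrary: x) (simp_all add: map_prod_cshift)

text \<open>
  Each factor \<open>T - z\<close> can be split off the residual: for \<open>|z| \<noteq> 1\<close> by solving
  \<open>s\<^sub>k\<^sub>+\<^sub>1 = z s\<^sub>k - r\<^sub>k\<close> and adding the image of \<open>s\<close> to \<open>u\<close>, and otherwise by inverting \<open>T - z\<close>.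
\<close>

lemma bounded_solution_up_to_cshifts:
  fixes L :: "'v::finite_dim_inner \<Rightarrow> 'v"
  assumes L: "linear L" and zs: "\<And>z. z \<in> set zs \<Longrightarrow> cmod z = 1 \<Longrightarrow> bij (cshift L z)"
  shows "\<exists>C\<ge>0. \<forall>M w. (\<forall>k. norm (w k) \<le> M) \<longrightarrow> (\<exists>u r. (\<forall>k. norm (u k) \<le> C * M) \<and>
    (\<forall>k. norm (r k) \<le> C * M) \<and> (\<forall>k. u (Suc k) = map_prod L L (u k) + w k + cshifts L zs (r k)))"
  using zs
proof (induction zs)
  case Nil
  \<comment> \<open>The empty product is the identity, so the residual can absorb everything:
    \<open>u = 0\<close> and \<open>r = - w\<close>.\<close>
  have "\<exists>u r. (\<forall>k. norm (u k) \<le> 1 * M) \<and> (\<forall>k. norm (r k) \<le> 1 * M) \<and>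
     (\<forall>k. u (Suc k) = map_prod L L (u k) + w k + cshifts L [] (r k))"
    if "\<forall>k. norm (w k) \<le> M" for w M
    by (rule exI[of _ "\<lambda>k. 0"], rule exI[of _ "\<lambda>k. - w k"],
        use that order_trans[OF norm_ge_zero[of "w 0"], of M] in \<open>auto simp: linear_0[OF linear_map_prod[OF L]]\<close>)
  then show ?case by (intro exI[of _ 1]) auto
next
  case (Cons z zs)
  obtain C where C: "C \<ge> 0" "\<And>M w. (\<forall>k. norm (w k) \<le> M) \<Longrightarrow> (\<exists>u r. (\<forall>k. norm (u k) \<le> C * M) \<and>
    (\<forall>k. norm (r k) \<le> C * M) \<and> (\<forall>k. u (Suc k) = map_prod L L (u k) + w k + cshifts L zs (r k)))"
    using Cons by auto
  note lin = linear_cshifts[OF L, of zs]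
  show ?case
  proof (cases "cmod z = 1")
    \<comment> \<open>Such factors can occur even for hyperbolic \<open>L\<close>, because the
      annihilating product need not be minimal. Invertibility lets the old residual \<open>r\<close>
      be written as the image of \<open>I r\<close> under \<open>T - z\<close>.\<close>
    case True
    then have bij: "bij (cshift L z)" using Cons.prems by simp
    define I where "I = inv (cshift L z)"
    have I: "cshift L z (I x) = x" for x using bij by (simp add: I_def bij_is_surj surj_f_inv_f)
    have "linear I"
    proof (rule linearI)
      have inv: "I (cshift L z x) = x" for x using bij by (simp add: I_def bij_is_inj)
      note lin = linear_cshift[OF L, of z]
      show "I (x + y) = I x + I y" for x y by (metis I inv linear_add[OF lin])
      show "I (c *\<^sub>R x) = c *\<^sub>R I x" for c x by (metis I inv linear_scale[OF lin])
    qed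
    then obtain B where B: "B > 0" "\<And>x. norm (I x) \<le> norm x * B"
      using bounded_linear.pos_bounded[OF linear_imp_bounded_linear] by blast
    show ?thesis
    proof (intro exI[of _ "C * (1 + B)"] conjI allI impI)
      show "0 \<le> C * (1 + B)" using C(1) B(1) by simp
      fix M and w :: "nat \<Rightarrow> 'v \<times> 'v" assume w: "\<forall>k. norm (w k) \<le> M"
      have M: "M \<ge> 0" using w norm_ge_zero order_trans by blast
      from C(2)[OF w] obtain u r where ur: "\<And>k. norm (u k) \<le> C * M" "\<And>k. norm (r k) \<le> C * M"
        "\<And>k. u (Suc k) = map_prod L L (u k) + w k + cshifts L zs (r k)" by blast
      show "\<exists>u r. (\<forall>k. norm (u k) \<le> C * (1 + B) * M) \<and> (\<forall>k. norm (r k) \<le> C * (1 + B) * M) \<and>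
        (\<forall>k. u (Suc k) = map_prod L L (u k) + w k + cshifts L (z # zs) (r k))"
      proof (rule exI[of _ u], rule exI[of _ "\<lambda>k. I (r k)"], intro conjI allI)
        fix k
        have "C * M \<ge> 0" using C(1) M by simp
        then have B0: "0 \<le> B * (C * M)" using B(1) by simp
        show "norm (u k) \<le> C * (1 + B) * M" using ur(1)[of k] B0 by (simp add: algebra_simps)
        have "norm (I (r k)) \<le> C * M * B" using B ur(2)[of k] by (meson less_imp_le mult_right_mono order_trans)
        then show "norm (I (r k)) \<le> C * (1 + B) * M" using \<open>C * M \<ge> 0\<close> by (simp add: algebra_simps)
        show "u (Suc k) = map_prod L L (u k) + w k + cshifts L (z # zs) (I (r k))"
          using ur(3) by (simp add: I)
      qed
    qed
  next
    case False
    obtain D where D: "D \<ge> 0" "\<And>M w. (\<forall>k. norm (w k :: 'v \<times> 'v) \<le> M) \<Longrightarrow>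
      (\<exists>u. (\<forall>k. norm (u k) \<le> D * M) \<and> (\<forall>k. u (Suc k) = scaleC z (u k) + w k))"
      using bounded_solution_scaleC[OF False, where ?'v = 'v] by blast
    obtain B where B: "B > 0" "\<And>x. norm (cshifts L zs x) \<le> norm x * B"
      using bounded_linear.pos_bounded[OF linear_imp_bounded_linear[OF lin]] by blast
    show ?thesis
    proof (intro exI[of _ "C + D * C * (1 + B)"] conjI allI impI)
      show "0 \<le> C + D * C * (1 + B)" using C(1) D(1) B(1) by simp
      fix M and w :: "nat \<Rightarrow> 'v \<times> 'v" assume w: "\<forall>k. norm (w k) \<le> M"
      have M: "M \<ge> 0" using w norm_ge_zero order_trans by blast
      from C(2)[OF w] obtain u r where ur: "\<And>k. norm (u k) \<le> C * M" "\<And>k. norm (r k) \<le> C * M"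
        "\<And>k. u (Suc k) = map_prod L L (u k) + w k + cshifts L zs (r k)" by blast
      obtain s where s: "\<And>k. norm (s k) \<le> D * (C * M)" "\<And>k. s (Suc k) = scaleC z (s k) + (- r k)"
        using D(2)[of "\<lambda>k. - r k" "C * M"] ur(2) by auto
      show "\<exists>u r. (\<forall>k. norm (u k) \<le> (C + D * C * (1 + B)) * M) \<and>
        (\<forall>k. norm (r k) \<le> (C + D * C * (1 + B)) * M) \<and>
        (\<forall>k. u (Suc k) = map_prod L L (u k) + w k + cshifts L (z # zs) (r k))"
      \<comment> \<open>Write \<open>T = map_prod L L\<close> and \<open>P = cshifts L zs\<close>.
        Adding \<open>P s_(k+1) = z P s_k - P r_k\<close> cancels the old residual
        \<open>P r_k\<close>, and \<open>z P s_k = T P s_k - P (T - z) s_k\<close> leaves the new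
        residual, which has one more factor.\<close>
      proof (rule exI[of _ "\<lambda>k. u k + cshifts L zs (s k)"], rule exI[of _ "\<lambda>k. - s k"], intro conjI allI)
        fix k
        have pos: "C * M \<ge> 0" "D * (C * M) \<ge> 0" "D * (C * M) * B \<ge> 0" using C(1) M D(1) B(1) by simp_all
        have "norm (cshifts L zs (s k)) \<le> D * (C * M) * B"
          using B s(1)[of k] by (meson less_imp_le mult_right_mono order_trans)
        then have "norm (u k + cshifts L zs (s k)) \<le> C * M + D * (C * M) * B"
          using ur(1) by (intro norm_triangle_le add_mono)
        then show "norm (u k + cshifts L zs (s k)) \<le> (C + D * C * (1 + B)) * M"
          using pos by (simp add: algebra_simps)
        show "norm (- s k) \<le> (C + D * C * (1 + B)) * M" using s(1)[of k] pos by (simp add: algebra_simps)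
        show "u (Suc k) + cshifts L zs (s (Suc k)) =
          map_prod L L (u k + cshifts L zs (s k)) + w k + cshifts L (z # zs) (- s k)"
          by (simp add: ur(3) s(2) cshift_def linear_add[OF lin] linear_diff[OF lin] linear_neg[OF lin]
              linear_add[OF linear_map_prod[OF L]] linear_neg[OF linear_map_prod[OF L]]
              map_prod_cshifts[OF L] scaleC_minus_right del: map_prod_simp)
      qed
    qed
  qed
qed

section \<open>Annihilating polynomials of an endomorphism\<close>

lemma ex_nontrivial_relation:
  fixes f :: "nat \<Rightarrow> 'a::finite_dim_inner"
  shows "\<exists>n u. (\<exists>i\<le>n. u i \<noteq> 0) \<and> (\<Sum>i\<le>n. u i *\<^sub>R f i) = 0"
proof -
  obtain B :: "'a set" where B: "finite_dimensional_vector_space scaleR B" by (rule finite_dim_inner_basis)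
  then have fin: "finite B" and span: "span B = UNIV"
    by (auto simp: finite_dimensional_vector_space_def finite_dimensional_vector_space_axioms_def span_raw_def)
  \<comment> \<open>The \<open>n + 1\<close> vectors \<open>f 0, ..., f n\<close> are one more than
    the dimension. A repetition among them is a separate case, because dependence is a property of
    the set of values and not of the family.\<close>
  define n where "n = card B"
  show ?thesis
  proof (cases "inj_on f {..n}")
    case False
    then obtain i j where ij: "i \<le> n" "j \<le> n" "i \<noteq> j" "f i = f j" by (auto simp: inj_on_def)
    define u where "u k = (if k = i then 1 else if k = j then - 1 else 0 :: real)" for k
    have "(\<Sum>k\<le>n. u k *\<^sub>R f k) = (\<Sum>k\<in>{i,j}. u k *\<^sub>R f k)"
      using ij by (intro sum.mono_neutral_right) (auto simp: u_def)
    also have "\<dots> = 0" using ij by (simp add: u_def)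
    finally show ?thesis using ij(1) by (intro exI[of _ n] exI[of _ u]) (auto simp: u_def)
  next
    case True
    have "dependent (f ` {..n})"
    proof (rule ccontr)
      assume "independent (f ` {..n})"
      from independent_span_bound[OF fin this] span have "card (f ` {..n}) \<le> n" by (simp add: n_def)
      then show False using card_image[OF True] by simp
    qed
    then obtain v where v: "\<exists>x\<in>f ` {..n}. v x \<noteq> 0" "(\<Sum>x\<in>f ` {..n}. v x *\<^sub>R x) = 0"
      by (auto simp: dependent_finite)
    then show ?thesis using sum.reindex[OF True, of "\<lambda>x. v x *\<^sub>R x"]
      by (intro exI[of _ n] exI[of _ "v \<circ> f"]) auto
  qed
qed

text \<open>The vector \<open>p(T) x\<close> for the complexification
  \<open>T = map_prod L L\<close>.\<close>

definition cpoly_apply :: "('v::real_vector \<Rightarrow> 'v) \<Rightarrow> complex poly \<Rightarrow> 'v \<times> 'v \<Rightarrow> 'v \<times> 'v" where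
  "cpoly_apply L p x = (\<Sum>i\<le>degree p. scaleC (coeff p i) ((map_prod L L ^^ i) x))"

lemma cpoly_apply_upto:
  assumes "degree p \<le> n"
  shows "cpoly_apply L p x = (\<Sum>i\<le>n. scaleC (coeff p i) ((map_prod L L ^^ i) x))"
  unfolding cpoly_apply_def using assms
  by (intro sum.mono_neutral_left) (auto simp: coeff_eq_0 scaleC_zero_left)

lemma cpoly_apply_0: "cpoly_apply L 0 x = 0"
  by (simp add: cpoly_apply_def scaleC_zero_left)

lemma cpoly_apply_const: "cpoly_apply L [:a:] x = scaleC a x"
  by (simp add: cpoly_apply_def)

lemma cpoly_apply_add: "cpoly_apply L (p + q) x = cpoly_apply L p x + cpoly_apply L q x"
proof -
  define n where "n = max (degree p) (degree q)"
  have "degree p \<le> n" "degree q \<le> n" "degree (p + q) \<le> n"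
    by (auto simp: n_def intro: degree_add_le)
  then show ?thesis by (simp add: cpoly_apply_upto scaleC_add_left sum.distrib)
qed

lemma cpoly_apply_smult: "cpoly_apply L (smult a p) x = scaleC a (cpoly_apply L p x)"
  using degree_smult_le[of a p]
  by (simp add: cpoly_apply_upto[of _ "degree p"] scaleC_mult scaleC_sum_right)

lemma cpoly_apply_pCons_0:
  assumes "linear L"
  shows "cpoly_apply L (pCons 0 p) x = map_prod L L (cpoly_apply L p x)"
proof -
  have "cpoly_apply L (pCons 0 p) x = (\<Sum>i\<le>Suc (degree p). scaleC (coeff (pCons 0 p) i) ((map_prod L L ^^ i) x))"
    by (rule cpoly_apply_upto) (rule degree_pCons_le)
  also have "\<dots> = (\<Sum>i\<le>degree p. scaleC (coeff p i) (map_prod L L ((map_prod L L ^^ i) x)))"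
    by (subst sum.atMost_Suc_shift) (simp add: scaleC_zero_left)
  also have "\<dots> = map_prod L L (cpoly_apply L p x)"
    unfolding cpoly_apply_def linear_sum[OF linear_map_prod[OF assms]]
    by (simp add: map_prod_scaleC[OF assms])
  finally show ?thesis .
qed

lemma cpoly_apply_pCons:
  assumes "linear L"
  shows "cpoly_apply L (pCons a p) x = scaleC a x + map_prod L L (cpoly_apply L p x)"
proof -
  have "pCons a p = [:a:] + pCons 0 p" by simp
  then show ?thesis by (metis assms cpoly_apply_add cpoly_apply_const cpoly_apply_pCons_0)
qed

lemma cpoly_apply_mult:
  assumes "linear L"
  shows "cpoly_apply L (p * q) x = cpoly_apply L p (cpoly_apply L q x)"
proof (induction p)
  case 0
  then show ?case by (simp add: cpoly_apply_0)
next
  case (pCons a p)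
  then show ?case
    by (simp add: cpoly_apply_add cpoly_apply_smult cpoly_apply_pCons_0[OF assms] cpoly_apply_pCons[OF assms]
        scaleC_zero_left)
qed

lemma cpoly_apply_prod_list:
  assumes "linear L"
  shows "cpoly_apply L (\<Prod>z\<leftarrow>zs. [:- z, 1:]) x = cshifts L zs x"
proof (induction zs arbitrary: x)
  case Nil
  then show ?case using cpoly_apply_const[of L 1 x] by (simp add: scaleC_one one_pCons)
next
  case (Cons z zs)
  have "cpoly_apply L [:- z, 1:] x = cshift L z x"
    by (simp add: cpoly_apply_pCons[OF assms] cpoly_apply_0 linear_0[OF linear_map_prod[OF assms]]
        scaleC_one scaleC_minus_left cshift_def del: map_prod_simp)
  moreover have "(\<Prod>z\<leftarrow>z # zs. [:- z, 1:]) = (\<Prod>z\<leftarrow>zs. [:- z, 1:]) * [:- z, 1:]"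
    by (simp only: list.map prod_list.Cons mult.commute)
  ultimately show ?case
    by (simp only: cpoly_apply_mult[OF assms] Cons.IH cshifts.simps)
qed

lemma linear_cpoly_apply:
  assumes "linear L"
  shows "linear (cpoly_apply L p)"
proof (induction p)
  case 0
  then show ?case unfolding cpoly_apply_0[abs_def] by (rule linear_zero)
next
  case (pCons a p)
  have "cpoly_apply L (pCons a p) = (\<lambda>x. scaleC a x + map_prod L L (cpoly_apply L p x))"
    by (rule ext) (rule cpoly_apply_pCons[OF assms])
  then show ?case
    by (simp only:) (rule linear_compose_add[OF linear_scaleC linear_compose[OF pCons.IH linear_map_prod[OF assms], unfolded o_def]])
qed

text \<open>A linear relation among the iterates of one vector is a polynomial that kills this
  vector. Polynomials in the same endomorphism commute, so a product of such polynomials kills all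
  vectors of a finite spanning set, and hence the whole space.\<close>

lemma ex_annihilating_cpoly:
  fixes L :: "'v::finite_dim_inner \<Rightarrow> 'v"
  assumes L: "linear L"
  shows "\<exists>p \<noteq> 0. \<forall>x. cpoly_apply L p x = 0"
proof -
  have single: "\<exists>p \<noteq> 0. cpoly_apply L p x = 0" for x
  proof -
    obtain n u where u: "\<exists>i\<le>n. u i \<noteq> (0::real)" "(\<Sum>i\<le>n. u i *\<^sub>R (map_prod L L ^^ i) x) = 0"
      using ex_nontrivial_relation[of "\<lambda>i. (map_prod L L ^^ i) x"] by blast
    define p where "p = (\<Sum>i\<le>n. monom (complex_of_real (u i)) i)"
    have c: "coeff p i = (if i \<le> n then of_real (u i) else 0)" for i
      by (simp add: p_def coeff_sum)
    then have "degree p \<le> n" by (intro degree_le) auto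
    then have "cpoly_apply L p x = 0"
      using u(2) by (simp add: cpoly_apply_upto c scaleC_of_real)
    moreover have "p \<noteq> 0" using u(1) c by (metis coeff_0 of_real_eq_0_iff)
    ultimately show ?thesis by blast
  qed
  have "\<exists>p \<noteq> 0. \<forall>x\<in>B. cpoly_apply L p x = 0" if "finite B" for B
    using that
  proof (induction B)
    case empty
    then show ?case by (auto intro: exI[of _ 1])
  next
    case (insert b B)
    obtain p where p: "p \<noteq> 0" "\<forall>x\<in>B. cpoly_apply L p x = 0" using insert.IH by blast
    obtain q where q: "q \<noteq> 0" "cpoly_apply L q b = 0" using single by blast
    have "cpoly_apply L (p * q) b = 0"
      using q by (simp add: cpoly_apply_mult[OF L] linear_0[OF linear_cpoly_apply[OF L]])
    moreover have "cpoly_apply L (p * q) x = 0" if "x \<in> B" for x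
      using p that by (simp add: mult.commute[of p] cpoly_apply_mult[OF L] linear_0[OF linear_cpoly_apply[OF L]])
    ultimately show ?case using p(1) q(1) by (intro exI[of _ "p * q"]) auto
  qed
  then obtain p where p: "p \<noteq> 0" "\<And>b. b \<in> ortho_basis \<Longrightarrow> cpoly_apply L p b = 0"
    using finite_ortho_basis by metis
  have "cpoly_apply L p x = 0" for x
    using arg_cong[OF ortho_basis_expansion[of x, symmetric], of "cpoly_apply L p"] p(2)
    by (simp only: linear_sum[OF linear_cpoly_apply[OF L]] linear_scale[OF linear_cpoly_apply[OF L]]) simp
  then show ?thesis using p(1) by blast
qed

text \<open>Over the complex numbers the annihilating polynomial splits into linear factors, and its
  nonzero leading coefficient can be cancelled.\<close>

lemma ex_annihilating_cshifts:
  fixes L :: "'v::finite_dim_inner \<Rightarrow> 'v"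
  assumes L: "linear L"
  shows "\<exists>zs. \<forall>x. cshifts L zs x = 0"
proof -
  obtain p where p: "p \<noteq> 0" "\<And>x. cpoly_apply L p x = 0" using ex_annihilating_cpoly[OF L] by blast
  obtain A where A: "p = smult (lead_coeff p) (\<Prod>x\<in>#A. [:-x, 1:])"
    using alg_closed_imp_factorization[OF p(1)] by blast
  obtain zs where zs: "A = mset zs" using ex_mset by metis
  have "(\<Prod>x\<in>#A. [:-x, 1:]) = (\<Prod>z\<leftarrow>zs. [:- z, 1:])"
    unfolding zs by (simp flip: prod_mset_prod_list)
  then have eq: "p = smult (lead_coeff p) (\<Prod>z\<leftarrow>zs. [:- z, 1:])" using A by simp
  have "scaleC (lead_coeff p) (cshifts L zs x) = 0" for x
    using p(2)[of x] by (subst (asm) eq) (simp add: cpoly_apply_smult cpoly_apply_prod_list[OF L])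
  then have "cshifts L zs x = 0" for x
    using p(1) norm_scaleC[of "lead_coeff p" "cshifts L zs x"] by (metis mult_eq_0_iff norm_eq_zero leading_coeff_0_iff)
  then show ?thesis by blast
qed

text \<open>For an annihilating product the residual term vanishes, so the solution up to residual
  is exact. Real jumps are embedded as \<open>(w k, 0)\<close>; the first component then solves the
  real recursion, since \<open>map_prod L L\<close> acts componentwise.\<close>

lemma bounded_solution_hyperbolic:
  fixes L :: "'v::finite_dim_inner \<Rightarrow> 'v"
  assumes L: "linear L" and hyp: "\<And>z. cmod z = 1 \<Longrightarrow> bij (cshift L z)"
  shows "\<exists>C\<ge>0. \<forall>M w. (\<forall>k. norm (w k) \<le> M) \<longrightarrow>
    (\<exists>u. (\<forall>k. norm (u k) \<le> C * M) \<and> (\<forall>k. u (Suc k) = L (u k) + w k))"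
proof -
  obtain zs where zs: "\<And>x. cshifts L zs x = 0" using ex_annihilating_cshifts[OF L] by blast
  obtain C where C: "C \<ge> 0" "\<And>M w. (\<forall>k. norm (w k) \<le> M) \<Longrightarrow> (\<exists>u r. (\<forall>k. norm (u k) \<le> C * M) \<and>
    (\<forall>k. norm (r k) \<le> C * M) \<and> (\<forall>k. u (Suc k) = map_prod L L (u k) + w k + cshifts L zs (r k)))"
    using bounded_solution_up_to_cshifts[OF L, of zs] hyp by blast
  show ?thesis
  proof (intro exI[of _ C] conjI allI impI C(1))
    fix M and w :: "nat \<Rightarrow> 'v" assume w: "\<forall>k. norm (w k) \<le> M"
    then have "\<forall>k. norm (w k, 0 :: 'v) \<le> M" by (simp add: norm_Pair)
    from C(2)[OF this] obtain u where u: "\<And>k. norm (u k) \<le> C * M"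
      "\<And>k. u (Suc k) = map_prod L L (u k) + (w k, 0)" by (auto simp: zs)
    have "norm (fst (u k)) \<le> C * M" for k using norm_fst_le[of "fst (u k)" "snd (u k)"] u(1)[of k] by simp
    moreover have "fst (u (Suc k)) = L (fst (u k)) + w k" for k by (simp add: u(2))
    ultimately show "\<exists>u. (\<forall>k. norm (u k) \<le> C * M) \<and> (\<forall>k. u (Suc k) = L (u k) + w k)"
      by (intro exI[of _ "\<lambda>k. fst (u k)"]) auto
  qed
qed

text \<open>In finite dimension \<open>T - z\<close> also fails to be surjective, and a nonzero
  functional vanishing on its range is a left eigenvector for \<open>z\<close>. A left eigenvector
  is wanted, rather than an eigenvector, because applying it turns the vector recursion into a
  scalar one.\<close>

lemma ex_left_eigenfunctional:
  fixes L :: "'v::finite_dim_inner \<Rightarrow> 'v"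
  assumes L: "linear L" and nbij: "\<not> bij (cshift L z)"
  obtains l :: "'v \<Rightarrow> complex" and x0 where "linear l" "l x0 \<noteq> 0" "\<And>x. l (L x) = z * l x"
proof -
  obtain B :: "('v \<times> 'v) set" where "finite_dimensional_vector_space scaleR B" by (rule finite_dim_inner_basis)
  then interpret B: finite_dimensional_vector_space scaleR B .
  define S where "S = range (cshift L z)"
  have lin: "linear (cshift L z)" by (rule linear_cshift[OF L])
  have "\<not> surj (cshift L z)"
    using nbij B.linear_surj_imp_inj[OF lin[unfolded linear_def]] by (auto simp: bij_def)
  then obtain y where y: "y \<notin> S" by (auto simp: S_def)
  have "subspace S" unfolding S_def by (rule linear_subspace_image[OF lin subspace_UNIV])
  obtain C where C: "C \<subseteq> S" "independent C" "S \<subseteq> span C" using maximal_independent_subset by blast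
  have "y \<notin> span C" using y C(1) \<open>subspace S\<close> span_minimal by blast
  then have "independent (insert y C)" using C(2) by (simp add: independent_insert)
  then obtain f :: "'v \<times> 'v \<Rightarrow> real" where f: "linear f" "\<forall>x\<in>insert y C. f x = (if x = y then 1 else 0)"
    using linear_independent_extend[of "insert y C" "\<lambda>x. if x = y then 1 else 0"] by blast
  have "f x = 0" if "x \<in> C" for x
  proof -
    have "x \<noteq> y" using that y C(1) by blast
    then show ?thesis using f(2) that by simp
  qed
  then have "f x = 0" if "x \<in> S" for x
    using linear_eq_0_on_span[OF f(1)] that C(3) by blast
  then have f0: "f (cshift L z x) = 0" for x by (auto simp: S_def)
  \<comment> \<open>The standard passage from a real functional to the complex-linear one with this
    real part.\<close>
  define F where "F x = Complex (f x) (- f (scaleC \<i> x))" for x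
  have F: "linear F"
    unfolding F_def
    by (rule linearI) (simp_all add: complex_eq_iff linear_add[OF f(1)] linear_scale[OF f(1)]
        scaleC_add_right linear_scale[OF linear_scaleC])
  have Fi: "F (scaleC \<i> x) = \<i> * F x" for x
    by (simp add: F_def complex_eq_iff scaleC_minus_left scaleC_one linear_neg[OF f(1)] flip: scaleC_mult)
  have Fz: "F (scaleC w x) = w * F x" for w x
  proof -
    have "scaleC w x = Re w *\<^sub>R x + Im w *\<^sub>R scaleC \<i> x"
      by (simp add: scaleC_def prod_eq_iff)
    then show ?thesis
      by (simp add: linear_add[OF F] linear_scale[OF F] Fi complex_eq_iff)
  qed
  have FL: "F (map_prod L L x) = z * F x" for x
  proof -
    have "F (cshift L z x) = 0"
      using f0[of "scaleC \<i> x"] f0[of x]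
      by (simp add: F_def cshift_def scaleC_diff_right map_prod_scaleC[OF L] complex_eq_iff mult.commute
          flip: scaleC_mult)
    then show ?thesis by (simp add: cshift_def linear_diff[OF F] Fz del: map_prod_simp)
  qed
  \<comment> \<open>Restricting to real vectors cannot give 0: they span the complexification over
    the complex numbers, and \<open>F y\<close> is nonzero.\<close>
  define l where "l x = F (x, 0)" for x
  have "linear l"
  proof (rule linearI)
    show "l (a + b) = l a + l b" for a b using linear_add[OF F, of "(a,0)" "(b,0)"] by (simp add: l_def)
    show "l (c *\<^sub>R b) = c *\<^sub>R l b" for c b using linear_scale[OF F, of c "(b,0)"] by (simp add: l_def)
  qed
  moreover have "l (L x) = z * l x" for x using FL[of "(x, 0)"] by (simp add: l_def linear_0[OF L])
  moreover have "\<exists>x. l x \<noteq> 0"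
  proof (rule ccontr)
    assume "\<nexists>x. l x \<noteq> 0"
    then have l0: "F (x, 0) = 0" for x by (simp add: l_def)
    have "y = (fst y, 0) + scaleC \<i> (snd y, 0)" by (simp add: scaleC_def prod_eq_iff)
    then have "F y = 0" by (metis Fi l0 linear_add[OF F] add_0 mult_zero_right)
    moreover have "f y = 1" using f(2) by simp
    ultimately show False by (simp add: F_def complex_eq_iff)
  qed
  ultimately show thesis using that by blast
qed

section \<open>Shadowing in logarithmic coordinates\<close>

text \<open>The residual of an approximate solution is fed into the linear problem. Adding the
  answer leaves the new residual \<open>N k (U (Suc n) k) - N k (U n k)\<close>, which is at most
  half as large because \<open>\<epsilon> * C \<le> 1/2\<close>. The operator \<open>S\<close> is a
  mere choice of solutions, so its norm bound is all that can be exploited.\<close>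

lemma nonlinear_bounded_solution:
  fixes L :: "'e::banach \<Rightarrow> 'e" and N :: "nat \<Rightarrow> 'e \<Rightarrow> 'e"
  assumes L: "bounded_linear L" and C: "C \<ge> 0"
    and sol: "\<And>M w. (\<forall>k. norm (w k) \<le> M) \<Longrightarrow>
      \<exists>u. (\<forall>k. norm (u k) \<le> C * M) \<and> (\<forall>k. u (Suc k) = L (u k) + w k)"
    and eps: "\<epsilon> \<ge> 0" "\<epsilon> * C \<le> 1/2"
    and N: "\<And>k x y. norm x \<le> R \<Longrightarrow> norm y \<le> R \<Longrightarrow> norm (N k x - N k y) \<le> \<epsilon> * norm (x - y)"
    and N0: "\<And>k. norm (N k 0) \<le> \<delta>" and R: "2 * C * \<delta> \<le> R"
  shows "\<exists>u. (\<forall>k. norm (u k) \<le> R) \<and> (\<forall>k. u (Suc k) = L (u k) + N k (u k))"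
proof -
  interpret L: bounded_linear L by (rule L)
  have d0: "\<delta> \<ge> 0" by (rule order_trans[OF norm_ge_zero N0])
  define S where "S M w = (SOME u. (\<forall>k. norm (u k) \<le> C * M) \<and> (\<forall>k. u (Suc k) = L (u k) + w k))" for M w
  have S: "norm (S M w k) \<le> C * M" "S M w (Suc k) = L (S M w k) + w k" if "\<forall>k. norm (w k) \<le> M" for M w k
    using someI_ex[OF sol[OF that], folded S_def] by blast+
  define res where "res u k = N k (u k) + L (u k) - u (Suc k)" for u k
  define U where "U = rec_nat (\<lambda>k. 0) (\<lambda>n u k. u k + S (\<delta> * (1/2)^n) (res u) k)"
  have U0: "U 0 = (\<lambda>k. 0)" and USuc: "U (Suc n) = (\<lambda>k. U n k + S (\<delta> * (1/2)^n) (res (U n)) k)" for n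
    by (simp_all add: U_def)
  \<comment> \<open>The corrections are bounded by the geometric series
    \<open>C * \<delta> * (1/2)^j\<close> with total \<open>2 * C * \<delta>\<close>, so all
    iterates stay where \<open>N\<close> is Lipschitz.\<close>
  have le_R: "2 * C * \<delta> * (1 - (1/2)^n) \<le> R" for n
  proof -
    have "2 * C * \<delta> * (1 - (1/2)^n) \<le> 2 * C * \<delta> * 1"
      using C d0 by (intro mult_left_mono) auto
    then show ?thesis using R by simp
  qed
  have inv: "(\<forall>k. norm (U n k) \<le> 2 * C * \<delta> * (1 - (1/2)^n)) \<and> (\<forall>k. norm (res (U n) k) \<le> \<delta> * (1/2)^n)" for n
  proof (induction n)
    case 0
    show ?case using N0 by (simp add: U0 res_def L.zero)
  next
    case (Suc n)
    define d where "d = S (\<delta> * (1/2)^n) (res (U n))"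
    have d: "norm (d k) \<le> C * (\<delta> * (1/2)^n)" "d (Suc k) = L (d k) + res (U n) k" for k
      using S[of "res (U n)" "\<delta> * (1/2)^n" k] Suc by (auto simp: d_def)
    have Ueq: "U (Suc n) k = U n k + d k" for k by (simp add: USuc d_def)
    have 1: "norm (U (Suc n) k) \<le> 2 * C * \<delta> * (1 - (1/2)^Suc n)" for k
    proof -
      have "norm (U (Suc n) k) \<le> 2 * C * \<delta> * (1 - (1/2)^n) + C * (\<delta> * (1/2)^n)"
        unfolding Ueq using Suc d(1) by (intro norm_triangle_le add_mono) auto
      also have "\<dots> = 2 * C * \<delta> * (1 - (1/2)^Suc n)" by (simp add: algebra_simps)
      finally show ?thesis .
    qed
    have 2: "norm (res (U (Suc n)) k) \<le> \<delta> * (1/2)^Suc n" for k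
    proof -
      have "res (U (Suc n)) k = N k (U (Suc n) k) - N k (U n k)"
        by (simp add: res_def[of "U (Suc n)"] Ueq d(2) L.add) (simp add: res_def)
      also have "norm \<dots> \<le> \<epsilon> * norm (U (Suc n) k - U n k)"
        by (intro N order_trans[OF 1 le_R] order_trans[OF Suc[THEN conjunct1, rule_format] le_R])
      also have "\<dots> \<le> \<epsilon> * (C * (\<delta> * (1/2)^n))" using d(1)[of k] eps(1) by (simp add: Ueq mult_left_mono)
      also have "\<dots> = (\<epsilon> * C) * (\<delta> * (1/2)^n)" by simp
      also have "\<dots> \<le> 1/2 * (\<delta> * (1/2)^n)" using eps d0 by (intro mult_right_mono) auto
      finally show ?thesis by simp
    qed
    show ?case using 1 2 by blast
  qed
  have inc: "norm (U (Suc n) k - U n k) \<le> C * \<delta> * (1/2)^n" for n k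
    using S(1)[of "res (U n)" "\<delta> * (1/2)^n" k] inv[of n] by (simp add: USuc mult_ac)
  define u where "u k = (\<Sum>n. U (Suc n) k - U n k)" for k
  have lim: "(\<lambda>n. U n k) \<longlonglongrightarrow> u k" for k
  proof -
    have "summable (\<lambda>n. U (Suc n) k - U n k)"
    proof (rule summable_norm_cancel, rule summable_comparison_test')
      show "summable (\<lambda>n. C * \<delta> * (1/2)^n)" by (intro summable_mult summable_geometric) auto
      show "norm (norm (U (Suc n) k - U n k)) \<le> C * \<delta> * (1/2)^n" if "n \<ge> 0" for n
        using inc by simp
    qed
    from summable_LIMSEQ[OF this] show ?thesis
      unfolding u_def sum_lessThan_telescope[of "\<lambda>n. U n k"] U0 by simp
  qed
  have UR: "norm (U n k) \<le> R" for n k using inv[of n] le_R[of n] order_trans by blast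
  have uR: "norm (u k) \<le> R" for k
    by (rule LIMSEQ_le_const2[OF tendsto_norm[OF lim]]) (use UR in blast)
  have "(\<lambda>n. res (U n) k) \<longlonglongrightarrow> 0" for k
  proof (rule Lim_null_comparison[of _ "\<lambda>n. \<delta> * (1/2)^n"])
    show "(\<lambda>n. \<delta> * (1/2)^n) \<longlonglongrightarrow> 0" by (intro tendsto_mult_right_zero LIMSEQ_power_zero) auto
  qed (use inv in auto)
  moreover have "(\<lambda>n. res (U n) k) \<longlonglongrightarrow> N k (u k) + L (u k) - u (Suc k)" for k
  proof -
    have "(\<lambda>n. N k (U n k)) \<longlonglongrightarrow> N k (u k)"
    proof (rule LIM_zero_cancel, rule Lim_null_comparison[of _ "\<lambda>n. \<epsilon> * norm (U n k - u k)"])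
      show "(\<lambda>n. \<epsilon> * norm (U n k - u k)) \<longlonglongrightarrow> 0"
        by (intro tendsto_mult_right_zero tendsto_norm_zero LIM_zero lim)
    qed (use N UR uR in auto)
    then show ?thesis unfolding res_def by (intro tendsto_add tendsto_diff L.tendsto lim)
  qed
  ultimately have "N k (u k) + L (u k) - u (Suc k) = 0" for k using LIMSEQ_unique by blast
  then have "u (Suc k) = L (u k) + N k (u k)" for k by (metis add.commute eq_iff_diff_eq_0)
  then show ?thesis using uR by blast
qed

text \<open>The equivalence holds for each fixed pair \<open>U\<close>, \<open>V\<close>. The left
  uniformity puts errors and jumps on the right of a product, so the factor
  \<open>(\<alpha> ^^ k) y\<close> cancels without any commutativity.\<close>

lemma has_shadowing_iff:
  fixes \<alpha> :: "'g::topological_group_add \<Rightarrow> 'g"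
  assumes hom: "\<And>x y. \<alpha> (x + y) = \<alpha> x + \<alpha> y"
  shows "has_shadowing \<alpha> \<longleftrightarrow> (\<forall>U. 0 \<in> interior U \<longrightarrow> (\<exists>V. 0 \<in> interior V \<and>
     (\<forall>v. (\<forall>k. v k \<in> V) \<longrightarrow> (\<exists>u. (\<forall>k. u k \<in> U) \<and> (\<forall>k. u (Suc k) = \<alpha> (u k) + v k)))))"
proof -
  have "(\<forall>x. pseudo_orbit \<alpha> V x \<longrightarrow> (\<exists>y. shadowed_by \<alpha> U x y)) \<longleftrightarrow>
    (\<forall>v. (\<forall>k. v k \<in> V) \<longrightarrow> (\<exists>u. (\<forall>k. u k \<in> U) \<and> (\<forall>k. u (Suc k) = \<alpha> (u k) + v k)))" (is "?A \<longleftrightarrow> ?B") for U V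
  proof
    assume A: ?A
    show ?B
    proof (intro allI impI)
      fix v :: "nat \<Rightarrow> 'g" assume v: "\<forall>k. v k \<in> V"
      \<comment> \<open>Any sequence of jumps is realized by a pseudo-orbit; its starting point 0 is
        arbitrary.\<close>
      define x where "x = rec_nat 0 (\<lambda>k y. \<alpha> y + v k)"
      have x: "x (Suc k) = \<alpha> (x k) + v k" for k by (simp add: x_def)
      have "pseudo_orbit \<alpha> V x" using v by (simp add: pseudo_orbit_def x add.assoc[symmetric])
      with A obtain y where y: "\<And>k. - (\<alpha> ^^ k) y + x k \<in> U" by (auto simp: shadowed_by_def)
      define u where "u k = - (\<alpha> ^^ k) y + x k" for k
      have "\<alpha> (x k) = \<alpha> ((\<alpha> ^^ k) y) + \<alpha> (u k)" for k
        by (simp add: u_def add.assoc[symmetric] flip: hom)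
      then have "u (Suc k) = \<alpha> (u k) + v k" for k
        by (simp add: u_def[of "Suc k"] x add.assoc[symmetric])
      then show "\<exists>u. (\<forall>k. u k \<in> U) \<and> (\<forall>k. u (Suc k) = \<alpha> (u k) + v k)"
        using y by (intro exI[of _ u]) (auto simp: u_def)
    qed
  next
    assume B: ?B
    show ?A
    proof (intro allI impI)
      fix x assume "pseudo_orbit \<alpha> V x"
      then obtain u where u: "\<And>k. u k \<in> U" "\<And>k. u (Suc k) = \<alpha> (u k) + (- \<alpha> (x k) + x (Suc k))"
        using B[rule_format, of "\<lambda>k. - \<alpha> (x k) + x (Suc k)"] by (auto simp: pseudo_orbit_def)
      \<comment> \<open>The only possible choice, forced by \<open>y + u 0 = x 0\<close>.\<close>
      define y where "y = x 0 - u 0"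
      have "(\<alpha> ^^ k) y + u k = x k" for k
      proof (induction k)
        case (Suc k)
        have "(\<alpha> ^^ Suc k) y + u (Suc k) = \<alpha> ((\<alpha> ^^ k) y + u k) + (- \<alpha> (x k) + x (Suc k))"
          by (simp add: u(2) hom add.assoc)
        then show ?case by (simp add: Suc add.assoc[symmetric])
      qed (simp add: y_def)
      then have "- (\<alpha> ^^ k) y + x k = u k" for k by (metis minus_add_cancel)
      then show "\<exists>y. shadowed_by \<alpha> U x y" using u(1) by (intro exI[of _ y]) (simp add: shadowed_by_def)
    qed
  qed
  then show ?thesis unfolding has_shadowing_def by simp
qed

text \<open>
  The last condition says that in these coordinates the product has, at the
  origin, the addition as its strict derivative. It is phrased through \<open>e\<close> to avoid its partial inverse.
\<close>

locale log_coordinates =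
  fixes e :: "'e::finite_dim_inner \<Rightarrow> 'g::{topological_group_add, t2_space}" and \<rho> :: real
  assumes rho: "\<rho> > 0" and e0: "e 0 = 0"
    and cont: "continuous_on (ball 0 \<rho>) e"
    and inj: "inj_on e (ball 0 \<rho>)"
    and open_image: "\<And>U. open U \<Longrightarrow> U \<subseteq> ball 0 \<rho> \<Longrightarrow> open (e ` U)"
    and double: "\<And>x. norm x < \<rho> / 2 \<Longrightarrow> e (2 *\<^sub>R x) = e x + e x"
    and strict: "\<And>\<epsilon>. \<epsilon> > 0 \<Longrightarrow> \<exists>r>0. \<forall>x y z x' y' z'.
      norm x < r \<longrightarrow> norm y < r \<longrightarrow> norm z < r \<longrightarrow> norm x' < r \<longrightarrow> norm y' < r \<longrightarrow> norm z' < r \<longrightarrow>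
      e x + e y = e z \<longrightarrow> e x' + e y' = e z' \<longrightarrow>
      norm ((z - z') - (x - x') - (y - y')) \<le> \<epsilon> * (norm (x - x') + norm (y - y'))"
begin

lemma tendsto_e: "(e \<longlongrightarrow> 0) (nhds 0)"
proof -
  have "isCont e 0" using cont rho by (simp add: continuous_on_eq_continuous_at)
  then show ?thesis using tendsto_at_iff_tendsto_nhds[of e 0] by (simp add: isCont_def e0)
qed

lemma open_e_ball: "r \<le> \<rho> \<Longrightarrow> open (e ` ball 0 r)"
  by (intro open_image) auto

text \<open>The additional bound by \<open>\<rho>\<close> keeps \<open>z\<close> where
  \<open>e\<close> is injective, which makes \<open>z\<close> unique.\<close>

lemma eventually_in_e_ball:
  assumes "r > 0" and f: "(f \<longlongrightarrow> 0) F"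
  shows "\<forall>\<^sub>F x in F. \<exists>z. norm z < r \<and> norm z < \<rho> \<and> f x = e z"
proof -
  have "0 \<in> e ` ball 0 (min r \<rho>)" using e0 assms(1) rho by (intro image_eqI[of _ _ 0]) auto
  from topological_tendstoD[OF f open_e_ball this]
  have "\<forall>\<^sub>F x in F. f x \<in> e ` ball 0 (min r \<rho>)" by simp
  then show ?thesis by (rule eventually_mono) auto
qed

lemma small_hom:
  fixes \<alpha> :: "'g \<Rightarrow> 'g"
  assumes "r > 0" "continuous_on UNIV \<alpha>" "\<alpha> 0 = 0"
  obtains s where "s > 0" "\<And>x. norm x < s \<Longrightarrow> \<exists>z. norm z < r \<and> norm z < \<rho> \<and> \<alpha> (e x) = e z"
proof -
  have "isCont \<alpha> 0" using assms(2) by (simp add: continuous_on_eq_continuous_at)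
  then have "(\<alpha> \<longlongrightarrow> 0) (nhds 0)"
    using assms(3) tendsto_at_iff_tendsto_nhds[of \<alpha> 0] by (simp add: isCont_def)
  then have "((\<lambda>x. \<alpha> (e x)) \<longlongrightarrow> 0) (nhds 0)" by (rule filterlim_compose[OF _ tendsto_e])
  from eventually_in_e_ball[OF assms(1) this] obtain s where "s > 0"
    "\<And>x. dist x 0 < s \<Longrightarrow> \<exists>z. norm z < r \<and> norm z < \<rho> \<and> \<alpha> (e x) = e z"
    unfolding eventually_nhds_metric by blast
  then show thesis using that[of s] by (simp add: dist_norm)
qed

lemma small_op:
  assumes "r > 0" and f: "((\<lambda>p. f (e (fst p)) (e (snd p))) \<longlongrightarrow> 0) (nhds (0, 0))"
  obtains s where "s > 0"
    "\<And>x y. norm x < s \<Longrightarrow> norm y < s \<Longrightarrow> \<exists>z. norm z < r \<and> norm z < \<rho> \<and> f (e x) (e y) = e z"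
proof -
  from eventually_in_e_ball[OF assms] obtain d where d: "d > 0"
    "\<And>p. dist p (0, 0) < d \<Longrightarrow> \<exists>z. norm z < r \<and> norm z < \<rho> \<and> f (e (fst p)) (e (snd p)) = e z"
    unfolding eventually_nhds_metric by blast
  show thesis
  proof (rule that[of "d/2"])
    fix x y :: 'e assume "norm x < d/2" "norm y < d/2"
    then have "norm (x, y) < d" using norm_Pair_le[of x y] by linarith
    then show "\<exists>z. norm z < r \<and> norm z < \<rho> \<and> f (e x) (e y) = e z"
      using d(2)[of "(x, y)"] by (simp add: dist_norm flip: zero_prod_def)
  qed (use d(1) in simp)
qed

lemma tendsto_e_fst: "((\<lambda>p. e (fst p)) \<longlongrightarrow> 0) (nhds (0, 0 :: 'e))"
  and tendsto_e_snd: "((\<lambda>p. e (snd p)) \<longlongrightarrow> 0) (nhds (0 :: 'e, 0))"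
proof -
  have t: "(fst \<longlongrightarrow> (0::'e)) (nhds (0, 0 :: 'e))" "(snd \<longlongrightarrow> (0::'e)) (nhds (0 :: 'e, 0))"
    unfolding nhds_prod by (rule filterlim_fst, rule filterlim_snd)
  show "((\<lambda>p. e (fst p)) \<longlongrightarrow> 0) (nhds (0, 0 :: 'e))"
    by (rule filterlim_compose[OF tendsto_e t(1)])
  show "((\<lambda>p. e (snd p)) \<longlongrightarrow> 0) (nhds (0 :: 'e, 0))"
    by (rule filterlim_compose[OF tendsto_e t(2)])
qed

lemma small_sum:
  assumes "r > 0"
  obtains s where "s > 0"
    "\<And>x y. norm x < s \<Longrightarrow> norm y < s \<Longrightarrow> \<exists>z. norm z < r \<and> norm z < \<rho> \<and> e x + e y = e z"
proof -
  have t: "((\<lambda>p. e (fst p) + e (snd p)) \<longlongrightarrow> 0) (nhds (0, 0))"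
    using tendsto_add[OF tendsto_e_fst tendsto_e_snd] by simp
  show thesis by (rule small_op[OF assms t]) (rule that)
qed

lemma small_diff:
  assumes "r > 0"
  obtains s where "s > 0"
    "\<And>x y. norm x < s \<Longrightarrow> norm y < s \<Longrightarrow> \<exists>z. norm z < r \<and> norm z < \<rho> \<and> - e x + e y = e z"
proof -
  have t: "((\<lambda>p. - e (fst p) + e (snd p)) \<longlongrightarrow> 0) (nhds (0, 0))"
    using tendsto_add[OF tendsto_minus[OF tendsto_e_fst] tendsto_e_snd] by simp
  show thesis by (rule small_op[OF assms t]) (rule that)
qed

end

section \<open>Continuous homomorphisms are linear in logarithmic coordinates\<close>

context log_coordinates
begin

text \<open>In coordinates \<open>\<alpha>\<close> becomes a map \<open>T\<close> that commutes with
  doubling. This exact scaling first turns mere boundedness into a linear norm bound. It then turns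
  additivity up to a small relative error near 0, supplied by \<open>strict\<close>, into exact
  additivity.\<close>

lemma hom_linear:
  fixes \<alpha> :: "'g \<Rightarrow> 'g"
  assumes cont_\<alpha>: "continuous_on UNIV \<alpha>" and hom: "\<And>x y. \<alpha> (x + y) = \<alpha> x + \<alpha> y"
  obtains L s where "bounded_linear L" "s > 0" "\<And>x. norm x < s \<Longrightarrow> norm (L x) < \<rho>"
    "\<And>x. norm x < s \<Longrightarrow> \<alpha> (e x) = e (L x)"
proof -
  have \<alpha>0: "\<alpha> 0 = 0" by (metis hom add.right_neutral add_left_cancel)
  define T where "T x = inv_into (ball 0 \<rho>) e (\<alpha> (e x))" for x
  have T_eq: "T x = z" if "norm z < \<rho>" "\<alpha> (e x) = e z" for x z
    unfolding T_def that(2) using inj that(1) by (intro inv_into_f_f) auto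
  have T_small: "\<exists>s>0. \<forall>x. norm x < s \<longrightarrow> norm (T x) < r \<and> norm (T x) < \<rho> \<and> \<alpha> (e x) = e (T x)"
    if r: "r > 0" for r
  proof -
    obtain s where s: "s > 0" "\<And>x. norm x < s \<Longrightarrow> \<exists>z. norm z < r \<and> norm z < \<rho> \<and> \<alpha> (e x) = e z"
      by (rule small_hom[OF r cont_\<alpha> \<alpha>0]) (rule that)
    then show ?thesis using T_eq by (intro exI[of _ s]) metis
  qed
  obtain s1 where s1: "s1 > 0" "\<And>x. norm x < s1 \<Longrightarrow> norm (T x) < \<rho>/2 \<and> norm (T x) < \<rho> \<and> \<alpha> (e x) = e (T x)"
    using T_small[of "\<rho>/2"] rho by auto
  define s where "s = min s1 (\<rho>/2)"
  have s: "s > 0" and s_s1: "s \<le> s1" and s_rho: "s \<le> \<rho>/2" using s1(1) rho by (auto simp: s_def)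
  have T: "norm (T x) < \<rho>/2" "\<alpha> (e x) = e (T x)" if "norm x < s" for x
    using s1(2)[of x] that s_s1 by auto
  have T2: "T (2 *\<^sub>R x) = 2 *\<^sub>R T x" if x: "norm x < s" for x
  proof (rule T_eq)
    show "norm (2 *\<^sub>R T x) < \<rho>" using T(1)[OF x] by simp
    have "\<alpha> (e (2 *\<^sub>R x)) = e (T x) + e (T x)"
      using double[of x] x s_rho by (simp add: hom T(2))
    then show "\<alpha> (e (2 *\<^sub>R x)) = e (2 *\<^sub>R T x)" using double[OF T(1)[OF x]] by simp
  qed
  have Tn: "T (2^n *\<^sub>R x) = 2^n *\<^sub>R T x" if "2^n * norm x < s" for x n
    using that
  proof (induction n)
    case (Suc n)
    have "2^n * norm x \<le> 2^Suc n * norm x" by (intro mult_right_mono power_increasing) auto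
    then have "2^n * norm x < s" using Suc.prems by linarith
    with Suc.IH T2[of "2^n *\<^sub>R x"] show ?case by simp
  qed simp
  \<comment> \<open>Repeated doubling moves a nonzero \<open>x\<close> into the shell between
    \<open>s/2\<close> and \<open>s\<close>, where \<open>T\<close> is bounded by
    \<open>\<rho>\<close>; homogeneity carries the ratio back to \<open>x\<close>.\<close>
  define K where "K = 2 * \<rho> / s"
  have K: "K > 0" using rho s by (simp add: K_def)
  have T_bound: "norm (T x) \<le> K * norm x" if x: "norm x < s" for x
  proof (cases "x = 0")
    case True
    then show ?thesis using T_eq[of 0 0] rho \<alpha>0 e0 by simp
  next
    case False
    obtain m where m: "s < real m * norm x" using ex_less_of_nat_mult[of "norm x" s] False by auto
    have "real m \<le> 2^m" using of_nat_less_two_power[of m, where ?'a = real] by simp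
    also have "\<dots> \<le> (2::real)^Suc m" by (rule power_increasing) auto
    finally have "real m * norm x \<le> 2^(Suc m) * norm x" by (rule mult_right_mono) simp
    with m have ex: "s \<le> 2^(Suc m) * norm x" by linarith
    define n where "n = (LEAST n. s \<le> 2^(Suc n) * norm x)"
    have n: "s \<le> 2^(Suc n) * norm x" unfolding n_def using ex by (rule LeastI)
    have nl: "2^n * norm x < s"
    proof (cases n)
      case (Suc k)
      then have "\<not> s \<le> 2^(Suc k) * norm x" unfolding n_def using not_less_Least by (metis lessI)
      then show ?thesis using Suc by simp
    qed (use x in simp)
    have "2^n * norm (T x) = norm (T (2^n *\<^sub>R x))" unfolding Tn[OF nl] by simp
    also have "\<dots> \<le> \<rho>" using T(1)[of "2^n *\<^sub>R x"] nl rho by simp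
    finally have "2^n * norm (T x) * s \<le> \<rho> * (2^(Suc n) * norm x)"
      using n s rho by (intro mult_mono) auto
    then have "2^n * (norm (T x) * s) \<le> 2^n * (2 * \<rho> * norm x)" by (simp add: mult_ac)
    then have "norm (T x) * s \<le> 2 * \<rho> * norm x" by (subst (asm) mult_le_cancel_left_pos) auto
    then show ?thesis using s by (simp add: K_def field_simps)
  qed
  \<comment> \<open>The homomorphism property concerns the product \<open>e z = e a + e b\<close>,
    not \<open>e (a + b)\<close>. The two differ by a factor \<open>e c\<close> with
    \<open>c\<close> of relative size \<open>2 * \<epsilon>\<close>. Replacing \<open>T z\<close> by
    \<open>T (a + b)\<close> costs \<open>4 * K * \<epsilon>\<close>, and comparing
    \<open>T z\<close> with \<open>T a + T b\<close> costs another
    \<open>K * \<epsilon>\<close>.\<close>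
  have T_approx: "\<exists>d>0. \<forall>a b. norm a < d \<longrightarrow> norm b < d \<longrightarrow>
      norm (T (a + b) - T a - T b) \<le> 5 * K * \<epsilon> * (norm a + norm b)"
    if eps: "0 < \<epsilon>" "\<epsilon> \<le> 1/2" for \<epsilon>
  proof -
    obtain r where r: "r > 0" and str: "\<And>x y z x' y' z'.
      norm x < r \<Longrightarrow> norm y < r \<Longrightarrow> norm z < r \<Longrightarrow> norm x' < r \<Longrightarrow> norm y' < r \<Longrightarrow> norm z' < r \<Longrightarrow>
      e x + e y = e z \<Longrightarrow> e x' + e y' = e z' \<Longrightarrow>
      norm ((z - z') - (x - x') - (y - y')) \<le> \<epsilon> * (norm (x - x') + norm (y - y'))"
      using strict[OF eps(1)] by metis
    obtain q where q: "q > 0" "\<And>x. norm x < q \<Longrightarrow> norm (T x) < r \<and> norm (T x) < \<rho> \<and> \<alpha> (e x) = e (T x)"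
      using T_small[OF r] by blast
    \<comment> \<open>The radii are chosen backwards: products of vectors below \<open>d\<close> lie
      below \<open>c1\<close>, hence the correction \<open>c\<close> lies below \<open>p\<close>,
      where both the vectors and their images under \<open>T\<close> admit the strict
      estimate.\<close>
    define p where "p = min q (min r s)"
    have p: "p > 0" "p \<le> q" "p \<le> r" "p \<le> s" using q(1) r s by (auto simp: p_def)
    obtain c0 where c0: "c0 > 0" "\<And>x y. norm x < c0 \<Longrightarrow> norm y < c0 \<Longrightarrow>
        \<exists>z. norm z < p \<and> norm z < \<rho> \<and> - e x + e y = e z"
      by (rule small_diff[OF p(1)]) (rule that)
    define c1 where "c1 = min c0 p"
    have c1: "c1 > 0" "c1 \<le> c0" "c1 \<le> p" using c0(1) p(1) by (auto simp: c1_def)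
    obtain d0 where d0: "d0 > 0" "\<And>x y. norm x < d0 \<Longrightarrow> norm y < d0 \<Longrightarrow>
        \<exists>z. norm z < c1 \<and> norm z < \<rho> \<and> e x + e y = e z"
      by (rule small_sum[OF c1(1)]) (rule that)
    define d where "d = min d0 (c1/2)"
    have d: "d > 0" "d \<le> d0" "d \<le> c1/2" using d0(1) c1(1) by (auto simp: d_def)
    show ?thesis
    proof (intro exI[of _ d] conjI allI impI d(1))
      fix a b :: 'e assume a: "norm a < d" and b: "norm b < d"
      obtain z where z: "norm z < c1" "e a + e b = e z" using d0(2)[of a b] a b d(2) by auto
      have ab: "norm (a + b) < c1" using norm_triangle_ineq[of a b] a b d(3) by linarith
      obtain c where c: "norm c < p" "- e (a + b) + e z = e c"
        using c0(2)[of "a + b" z] ab z(1) c1(2) by auto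
      have ec: "e (a + b) + e c = e z" by (simp flip: c(2))
      have sm: "norm a < p" "norm b < p" "norm z < p" "norm (a + b) < p"
        using a b z(1) ab d(3) c1(1,3) by linarith+
      have small: "norm x < r" "norm (T x) < r" "\<alpha> (e x) = e (T x)" "norm (T x) \<le> K * norm x"
        if "norm x < p" for x
        using q(2)[of x] T_bound[of x] that p by auto
      have small0: "norm (0::'e) < r" "norm (0::'e) < p" using r p by auto
      have Ta: "e (T a) + e (T b) = e (T z)" 
        using small(3)[OF sm(1)] small(3)[OF sm(2)] small(3)[OF sm(3)] z(2) by (metis hom)
      have Tc: "e (T (a + b)) + e (T c) = e (T z)"
        using small(3)[OF sm(4)] small(3)[OF c(1)] small(3)[OF sm(3)] ec by (metis hom)
      have 1: "norm (z - a - b) \<le> \<epsilon> * (norm a + norm b)"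
        using str[of a b z 0 0 0] small(1) sm small0 z(2) e0 by simp
      have 2: "norm (z - (a + b) - c) \<le> \<epsilon> * norm c"
        using str[of "a + b" c z "a + b" 0 "a + b"] small(1) sm c(1) small0 ec e0 by simp
      have 3: "norm (T z - T a - T b) \<le> \<epsilon> * (norm (T a) + norm (T b))"
        using str[of "T a" "T b" "T z" 0 0 0] small(2) sm small0 Ta e0 by simp
      have 4: "norm (T z - T (a + b) - T c) \<le> \<epsilon> * norm (T c)"
        using str[of "T (a + b)" "T c" "T z" "T (a + b)" 0 "T (a + b)"] small(2) sm c(1) small0 Tc e0 by simp
      have "norm c \<le> norm (z - a - b) + norm (z - (a + b) - c)"
        using norm_triangle_ineq4[of "z - a - b" "z - (a + b) - c"] by (simp add: algebra_simps)
      also have "\<dots> \<le> \<epsilon> * (norm a + norm b) + 1/2 * norm c"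
        using 1 2 mult_right_mono[OF eps(2), of "norm c"] by (intro add_mono) auto
      finally have nc: "norm c \<le> 2 * \<epsilon> * (norm a + norm b)" by simp
      have "norm (T z - T (a + b)) \<le> norm (T z - T (a + b) - T c) + norm (T c)"
        using norm_triangle_ineq[of "T z - T (a + b) - T c" "T c"] by simp
      also have "\<dots> \<le> 1 * norm (T c) + norm (T c)"
        using 4 mult_right_mono[of \<epsilon> 1 "norm (T c)"] eps by (intro add_mono) auto
      also have "\<dots> \<le> 2 * (K * norm c)" using small(4)[OF c(1)] by simp
      also have "\<dots> \<le> 2 * (K * (2 * \<epsilon> * (norm a + norm b)))" using nc K by (intro mult_left_mono) auto
      finally have 5: "norm (T z - T (a + b)) \<le> 4 * K * \<epsilon> * (norm a + norm b)" by (simp add: mult_ac)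
      have "\<epsilon> * (norm (T a) + norm (T b)) \<le> \<epsilon> * (K * norm a + K * norm b)"
        using small(4) sm eps by (intro mult_left_mono add_mono) auto
      then have 6: "norm (T z - T a - T b) \<le> K * \<epsilon> * (norm a + norm b)" using 3 by (simp add: algebra_simps)
      have "norm (T (a + b) - T a - T b) \<le> norm (T z - T a - T b) + norm (T z - T (a + b))"
        using norm_triangle_ineq4[of "T z - T a - T b" "T z - T (a + b)"] by (simp add: algebra_simps)
      also have "\<dots> \<le> 5 * K * \<epsilon> * (norm a + norm b)" using 5 6 by (simp add: algebra_simps)
      finally show "norm (T (a + b) - T a - T b) \<le> 5 * K * \<epsilon> * (norm a + norm b)" .
    qed
  qed
  have T_add: "T (x + y) = T x + T y" if xy: "norm x < s" "norm y < s" "norm (x + y) < s" for x y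
  proof -
    have bound: "norm (T (x + y) - T x - T y) \<le> 5 * K * \<epsilon> * (norm x + norm y)" if eps: "0 < \<epsilon>" "\<epsilon> \<le> 1/2" for \<epsilon>
    proof -
      obtain d where d: "d > 0" "\<And>a b. norm a < d \<Longrightarrow> norm b < d \<Longrightarrow>
        norm (T (a + b) - T a - T b) \<le> 5 * K * \<epsilon> * (norm a + norm b)"
        using T_approx[OF eps] by blast
      \<comment> \<open>Division by \<open>2^n\<close> reaches the range of the estimate. Defect and
        bound both scale by exactly \<open>2^n\<close>, so the bound with the factor
        \<open>\<epsilon>\<close> returns to the original scale.\<close>
      obtain n where n: "max (norm x) (norm y) / d < 2 ^ n" using real_arch_pow[of 2] by auto
      then have nd: "max (norm x) (norm y) < 2 ^ n * d" using d(1) by (simp add: field_simps)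
      define h where "h v = (1/2^n) *\<^sub>R v" for v :: 'e
      have sc: "T v = 2 ^ n *\<^sub>R T (h v)" if "norm v < s" for v
        using Tn[of n "h v"] that by (simp add: h_def)
      have hd: "norm (h x) < d" "norm (h y) < d" using nd by (simp_all add: h_def field_simps)
      have hxy: "h (x + y) = h x + h y" by (simp add: h_def scaleR_add_right)
      have "norm (T (x + y) - T x - T y) = 2 ^ n * norm (T (h x + h y) - T (h x) - T (h y))"
        unfolding sc[OF xy(1)] sc[OF xy(2)] sc[OF xy(3)] hxy by (simp flip: scaleR_diff_right)
      also have "\<dots> \<le> 2 ^ n * (5 * K * \<epsilon> * (norm (h x) + norm (h y)))"
        using d(2)[OF hd] by (intro mult_left_mono) auto
      also have "\<dots> = 5 * K * \<epsilon> * (norm x + norm y)" by (simp add: h_def field_simps)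
      finally show ?thesis .
    qed
    have "norm (T (x + y) - T x - T y) \<le> 0"
    proof (rule field_le_epsilon)
      fix \<eta> :: real assume \<eta>: "\<eta> > 0"
      define M where "M = 5 * K * (norm x + norm y) + 1"
      have M: "M > 0" using K by (simp add: M_def add_nonneg_pos)
      define \<epsilon> where "\<epsilon> = min (1/2) (\<eta> / M)"
      have "norm (T (x + y) - T x - T y) \<le> 5 * K * \<epsilon> * (norm x + norm y)"
      proof (rule bound)
        show "\<epsilon> \<le> 1/2" unfolding \<epsilon>_def by (rule min.cobounded1)
      qed (use \<eta> M in \<open>auto simp: \<epsilon>_def\<close>)
      also have "\<dots> \<le> M * \<epsilon>" using \<eta> M by (simp add: M_def algebra_simps \<epsilon>_def)
      also have "\<dots> \<le> M * (\<eta> / M)" using M by (intro mult_left_mono) (auto simp: \<epsilon>_def)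
      also have "\<dots> = \<eta>" using M by simp
      finally show "norm (T (x + y) - T x - T y) \<le> 0 + \<eta>" by simp
    qed
    then show ?thesis by (simp add: algebra_simps)
  qed
  obtain L where L: "bounded_linear L" "\<And>x. norm x < s \<Longrightarrow> L x = T x"
    using local_additive_extends[of s T K, OF s T_add T_bound] by blast
  show thesis
  proof (rule that[OF L(1) s])
    fix x :: 'e assume x: "norm x < s"
    show "norm (L x) < \<rho>" "\<alpha> (e x) = e (L x)" using T[OF x] L(2)[OF x] rho by auto
  qed
qed

end

section \<open>The two implications in logarithmic coordinates\<close>

context log_coordinates
begin

text \<open>With \<open>m\<close> the group law in coordinates, the recursion is
  \<open>u_(k+1) = L u_k + N_k (u_k)\<close> for \<open>N_k x = m (L x) w_k - L x\<close>. Strict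
  differentiability, applied with equal jumps, gives \<open>N_k\<close> a small Lipschitz constant,
  and \<open>N_k 0 = w_k\<close> is small.\<close>

lemma hyperbolic_imp_has_shadowing:
  fixes \<alpha> :: "'g \<Rightarrow> 'g"
  assumes hom: "\<And>x y. \<alpha> (x + y) = \<alpha> x + \<alpha> y" and L: "bounded_linear L" and s: "s > 0"
    and \<alpha>: "\<And>x. norm x < s \<Longrightarrow> \<alpha> (e x) = e (L x)"
    and hyp: "\<And>z. cmod z = 1 \<Longrightarrow> bij (cshift L z)"
  shows "has_shadowing \<alpha>"
  unfolding has_shadowing_iff[OF hom]
proof (intro allI impI)
  fix U :: "'g set" assume U: "0 \<in> interior U"
  interpret L: bounded_linear L by (rule L)
  obtain KL where KL: "KL > 0" "\<And>x. norm (L x) \<le> norm x * KL" using L.pos_bounded by blast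
  obtain C0 where C0: "C0 \<ge> 0" "\<And>M w. (\<forall>k. norm (w k) \<le> M) \<Longrightarrow>
      \<exists>u. (\<forall>k. norm (u k) \<le> C0 * M) \<and> (\<forall>k. u (Suc k) = L (u k) + w k)"
    using bounded_solution_hyperbolic[OF L.linear hyp] by blast
  \<comment> \<open>A positive constant, since \<open>C\<close> is divided by below.\<close>
  define C where "C = C0 + 1"
  have C: "C > 0" using C0(1) by (simp add: C_def)
  have sol: "\<exists>u. (\<forall>k. norm (u k) \<le> C * M) \<and> (\<forall>k. u (Suc k) = L (u k) + w k)"
    if "\<forall>k. norm (w k) \<le> M" for M w
  proof -
    have "M \<ge> 0" using that[rule_format, of 0] norm_ge_zero[of "w 0"] by linarith
    then have "C0 * M \<le> C * M" by (intro mult_right_mono) (simp_all add: C_def)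
    then show ?thesis using C0(2)[OF that] by (meson order_trans)
  qed
  \<comment> \<open>The Lipschitz constant of \<open>N k\<close> will be
    \<open>\<epsilon> * KL\<close>; its product with \<open>C\<close> has to be at most 1/2.\<close>
  define \<epsilon> where "\<epsilon> = 1 / (2 * KL * C)"
  have eps: "\<epsilon> > 0" "\<epsilon> * KL * C = 1/2" using KL(1) C by (simp_all add: \<epsilon>_def)
  obtain r where r: "r > 0" and str: "\<And>x y z x' y' z'.
      norm x < r \<Longrightarrow> norm y < r \<Longrightarrow> norm z < r \<Longrightarrow> norm x' < r \<Longrightarrow> norm y' < r \<Longrightarrow> norm z' < r \<Longrightarrow>
      e x + e y = e z \<Longrightarrow> e x' + e y' = e z' \<Longrightarrow>
      norm ((z - z') - (x - x') - (y - y')) \<le> \<epsilon> * (norm (x - x') + norm (y - y'))"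
    using strict[OF eps(1)] by metis
  obtain q0 where q0: "q0 > 0" "\<And>x y. norm x < q0 \<Longrightarrow> norm y < q0 \<Longrightarrow>
      \<exists>z. norm z < r \<and> norm z < \<rho> \<and> e x + e y = e z"
    by (rule small_sum[OF r]) (rule that)
  define q where "q = min q0 (min r \<rho>)"
  have q: "q > 0" "q \<le> q0" "q \<le> r" "q \<le> \<rho>" using q0(1) r rho by (auto simp: q_def)
  have "\<forall>\<^sub>F x in nhds 0. e x \<in> interior U"
    using topological_tendstoD[OF tendsto_e _ U] by simp
  then obtain t where t: "t > 0" "\<And>x. dist x 0 < t \<Longrightarrow> e x \<in> interior U"
    unfolding eventually_nhds_metric by blast
  \<comment> \<open>Below \<open>t\<close> the point \<open>e x\<close> lies in \<open>U\<close>,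
    below \<open>s\<close> the map \<open>\<alpha>\<close> is given by \<open>L\<close>, and below
    \<open>q / KL\<close> the vector \<open>L x\<close> can be multiplied by jumps. The final
    halving makes all three bounds strict.\<close>
  define R where "R = min (min t s) (q / KL) / 2"
  have Rpos: "R > 0" using t(1) s q(1) KL(1) by (simp add: R_def)
  have "2 * R \<le> t" "2 * R \<le> s" "2 * R \<le> q / KL" by (simp_all add: R_def)
  then have R: "R < t" "R < s" "R < q / KL" using Rpos by linarith+
  have RL: "norm (L x) < q" if "norm x \<le> R" for x
  proof -
    have "norm (L x) \<le> R * KL" using KL that by (meson less_imp_le mult_right_mono order_trans)
    also have "\<dots> < q" using R(3) KL(1) by (simp add: field_simps)
    finally show ?thesis .
  qed
  define \<delta> where "\<delta> = min q (R / (2 * C))"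
  have \<delta>: "\<delta> > 0" "\<delta> \<le> q" "2 * C * \<delta> \<le> R"
  proof -
    have "2 * C * \<delta> \<le> 2 * C * (R / (2 * C))" unfolding \<delta>_def using C by (intro mult_left_mono) auto
    then show "2 * C * \<delta> \<le> R" using C by simp
  qed (use q(1) Rpos C in \<open>auto simp: \<delta>_def\<close>)
  define m where "m x w = (SOME z. norm z < r \<and> norm z < \<rho> \<and> e x + e w = e z)" for x w
  have m: "norm (m x w) < r" "norm (m x w) < \<rho>" "e x + e w = e (m x w)"
    if "norm x < q" "norm w < q" for x w
    using someI_ex[OF q0(2)[of x w], folded m_def] that q(2) by auto
  show "\<exists>V. 0 \<in> interior V \<and> (\<forall>v. (\<forall>k. v k \<in> V) \<longrightarrow>
      (\<exists>u. (\<forall>k. u k \<in> U) \<and> (\<forall>k. u (Suc k) = \<alpha> (u k) + v k)))"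
  proof (intro exI[of _ "e ` ball 0 \<delta>"] conjI allI impI)
    have "open (e ` ball 0 \<delta>)" using \<delta>(2) q(4) by (intro open_e_ball) auto
    moreover have "0 \<in> e ` ball 0 \<delta>" using e0 \<delta>(1) by (intro image_eqI[of _ _ 0]) auto
    ultimately show "0 \<in> interior (e ` ball 0 \<delta>)" by (simp add: interior_open)
    fix v :: "nat \<Rightarrow> 'g" assume v: "\<forall>k. v k \<in> e ` ball 0 \<delta>"
    have "\<exists>w. norm w < \<delta> \<and> v k = e w" for k
      using v[rule_format, of k] by auto
    then obtain w where w: "\<And>k. norm (w k) < \<delta>" "\<And>k. v k = e (w k)" by metis
    have wq: "norm (w k) < q" for k using w(1)[of k] \<delta>(2) by linarith
    define N where "N k x = m (L x) (w k) - L x" for k x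
    have "\<exists>u. (\<forall>k. norm (u k) \<le> R) \<and> (\<forall>k. u (Suc k) = L (u k) + N k (u k))"
    proof (rule nonlinear_bounded_solution[OF L less_imp_le[OF C] sol])
      show "0 \<le> \<epsilon> * KL" "\<epsilon> * KL * C \<le> 1/2" using eps KL(1) by simp_all
      show "2 * C * \<delta> \<le> R" by (rule \<delta>)
      fix k
      have "m 0 (w k) = w k"
        using m[of 0 "w k"] wq[of k] q e0 by (intro inj_onD[OF inj]) auto
      then show "norm (N k 0) \<le> \<delta>" using w(1)[of k] by (simp add: N_def L.zero)
      fix x y :: 'e assume x: "norm x \<le> R" and y: "norm y \<le> R"
      have "norm ((m (L x) (w k) - m (L y) (w k)) - (L x - L y) - (w k - w k))
          \<le> \<epsilon> * (norm (L x - L y) + norm (w k - w k))"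
        using RL[OF x] RL[OF y] wq[of k] q(3) m[OF RL[OF x] wq] m[OF RL[OF y] wq]
        by (intro str) auto
      then have "norm (N k x - N k y) \<le> \<epsilon> * norm (L (x - y))"
        by (simp add: N_def L.diff algebra_simps)
      also have "\<dots> \<le> \<epsilon> * (norm (x - y) * KL)" using eps(1) KL(2) by (intro mult_left_mono) auto
      finally show "norm (N k x - N k y) \<le> \<epsilon> * KL * norm (x - y)" by (simp add: mult_ac)
    qed
    then obtain u where u: "\<And>k. norm (u k) \<le> R" "\<And>k. u (Suc k) = m (L (u k)) (w k)"
      by (auto simp: N_def)
    have "e (u k) \<in> U" for k
      using t(2)[of "u k"] u(1)[of k] R(1) interior_subset[of U] by (auto simp: dist_norm)
    moreover have "e (u (Suc k)) = \<alpha> (e (u k)) + v k" for k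
      using m(3)[OF RL[OF u(1)[of k]] wq[of k]] \<alpha>[of "u k"] u(1)[of k] R(2) by (simp add: u(2) w(2))
    ultimately show "\<exists>u. (\<forall>k. u k \<in> U) \<and> (\<forall>k. u (Suc k) = \<alpha> (u k) + v k)"
      by (intro exI[of _ "\<lambda>k. e (u k)"]) auto
  qed
qed

text \<open>
  The drift caused by the jumps survives because the nonlinear error of a step is small relative to
  the jump \<open>w\<^sub>k\<close>, and not only relative to \<open>u\<^sub>k\<close>.
\<close>

lemma has_shadowing_imp_hyperbolic:
  fixes \<alpha> :: "'g \<Rightarrow> 'g"
  assumes hom: "\<And>x y. \<alpha> (x + y) = \<alpha> x + \<alpha> y" and L: "bounded_linear L" and s: "s > 0"
    and \<alpha>: "\<And>x. norm x < s \<Longrightarrow> \<alpha> (e x) = e (L x)"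
    and shadowing: "has_shadowing \<alpha>" and z: "cmod z = 1"
  shows "bij (cshift L z)"
proof (rule ccontr)
  assume nbij: "\<not> bij (cshift L z)"
  interpret L: bounded_linear L by (rule L)
  obtain l :: "'e \<Rightarrow> complex" and x0 where l: "linear l" "l x0 \<noteq> 0" "\<And>x. l (L x) = z * l x"
    by (rule ex_left_eigenfunctional[OF L.linear nbij]) (rule that)
  interpret l: bounded_linear l by (rule linear_imp_bounded_linear[OF l(1)])
  \<comment> \<open>\<open>g\<close> produces jumps with prescribed value under \<open>l\<close>.
    The range of \<open>l\<close> is only known to be a real subspace of the complex numbers, so the
    targets \<open>z^n c\<close> must be exhibited as values of \<open>l\<close>; this is why
    \<open>c\<close> is taken as \<open>l x0\<close>.\<close>
  obtain g where g: "linear g" "\<And>x. l (g (l x)) = l x"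
    using linear_exists_right_inverse_on[OF l(1) subspace_UNIV] by auto
  define c where "c = l x0"
  have c: "c \<noteq> 0" using l(2) by (simp add: c_def)
  have zc: "z ^ n * c = l ((L ^^ n) x0)" for n
    by (induction n) (simp_all add: c_def l(3))
  obtain KL where KL: "KL > 0" "\<And>x. norm (L x) \<le> norm x * KL" using L.pos_bounded by blast
  obtain Kl where Kl: "Kl > 0" "\<And>x. norm (l x) \<le> norm x * Kl" using l.pos_bounded by blast
  obtain Kg where Kg: "Kg > 0" "\<And>x. norm (g x) \<le> norm x * Kg"
    using bounded_linear.pos_bounded[OF linear_imp_bounded_linear[OF g(1)]] by blast
  \<comment> \<open>Chosen so that the nonlinear error, seen through \<open>l\<close>, eats up at
    most half of each jump.\<close>
  define \<epsilon> where "\<epsilon> = 1 / (2 * Kl * Kg)"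
  have eps: "\<epsilon> > 0" "\<epsilon> * Kg * Kl = 1/2" using Kl(1) Kg(1) by (simp_all add: \<epsilon>_def)
  obtain r where r: "r > 0" and str: "\<And>x y z x' y' z'.
      norm x < r \<Longrightarrow> norm y < r \<Longrightarrow> norm z < r \<Longrightarrow> norm x' < r \<Longrightarrow> norm y' < r \<Longrightarrow> norm z' < r \<Longrightarrow>
      e x + e y = e z \<Longrightarrow> e x' + e y' = e z' \<Longrightarrow>
      norm ((z - z') - (x - x') - (y - y')) \<le> \<epsilon> * (norm (x - x') + norm (y - y'))"
    using strict[OF eps(1)] by metis
  define R where "R = min (min s \<rho>) (min r (r / KL))"
  have R: "R > 0" "R \<le> s" "R \<le> \<rho>" "R \<le> r" "R \<le> r / KL" using s rho r KL(1) by (auto simp: R_def)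
  have RL: "norm (L x) < r" if "norm x < R" for x
  proof -
    have "norm (L x) \<le> norm x * KL" by (rule KL)
    also have "\<dots> < r / KL * KL" using that R(5) KL(1) by (intro mult_strict_right_mono) auto
    finally show ?thesis using KL(1) by simp
  qed
  have "open (e ` ball 0 R)" using R(3) by (intro open_e_ball)
  moreover have "0 \<in> e ` ball 0 R" using e0 R(1) by (intro image_eqI[of _ _ 0]) auto
  ultimately have "0 \<in> interior (e ` ball 0 R)" by (simp add: interior_open)
  then obtain V where V: "0 \<in> interior V" "\<And>v. (\<forall>k. v k \<in> V) \<Longrightarrow>
      \<exists>u. (\<forall>k. u k \<in> e ` ball 0 R) \<and> (\<forall>k. u (Suc k) = \<alpha> (u k) + v k)"
    using shadowing unfolding has_shadowing_iff[OF hom] by blast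
  have "\<forall>\<^sub>F x in nhds 0. e x \<in> interior V"
    using topological_tendstoD[OF tendsto_e _ V(1)] by simp
  then obtain t where t: "t > 0" "\<And>x. dist x 0 < t \<Longrightarrow> e x \<in> interior V"
    unfolding eventually_nhds_metric by blast
  \<comment> \<open>The jumps will have norm at most \<open>\<tau> * cmod c * Kg\<close>, which this
    choice keeps below \<open>t\<close>, for membership in \<open>V\<close>, and below
    \<open>r\<close>, for the strict estimate.\<close>
  define \<tau> where "\<tau> = min t r / (2 * cmod c * Kg)"
  have \<tau>: "\<tau> > 0" "\<tau> * cmod c * Kg < t" "\<tau> * cmod c * Kg < r"
    using t(1) r c Kg(1) by (auto simp: \<tau>_def)
  define w where "w k = g (\<tau> *\<^sub>R (z ^ Suc k * c))" for k
  have lw: "l (w k) = \<tau> *\<^sub>R (z ^ Suc k * c)" for k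
    unfolding w_def zc by (simp add: linear_scale[OF g(1)] l.scaleR g(2))
  have wb: "norm (w k) \<le> \<tau> * cmod c * Kg" for k
    using Kg(2)[of "\<tau> *\<^sub>R (z ^ Suc k * c)"] z \<tau>(1) by (simp add: w_def norm_mult norm_power)
  have "e (w k) \<in> V" for k
    using t(2)[of "w k"] wb[of k] \<tau>(2) interior_subset[of V] by (auto simp: dist_norm)
  then obtain u' where u': "\<And>k. u' k \<in> e ` ball 0 R" "\<And>k. u' (Suc k) = \<alpha> (u' k) + e (w k)"
    using V(2)[of "\<lambda>k. e (w k)"] by blast
  have "\<exists>x. norm x < R \<and> u' k = e x" for k using u'(1)[of k] by auto
  then obtain u where u: "\<And>k. norm (u k) < R" "\<And>k. u' k = e (u k)" by metis
  have step: "norm (u (Suc k) - L (u k) - w k) \<le> \<epsilon> * norm (w k)" for k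
  proof -
    have "e (L (u k)) + e (w k) = e (u (Suc k))"
      using u'(2)[of k] \<alpha>[of "u k"] u(1)[of k] R(2) by (simp add: u(2))
    \<comment> \<open>The comparison product has the same first factor \<open>L (u k)\<close> and
      jump 0, so the first-factor terms cancel and the error is relative to \<open>w k\<close>
      alone.\<close>
    then have "norm ((u (Suc k) - L (u k)) - (L (u k) - L (u k)) - (w k - 0))
        \<le> \<epsilon> * (norm (L (u k) - L (u k)) + norm (w k - 0))"
      using RL[OF u(1)] wb[of k] \<tau>(3) u(1)[of "Suc k"] R(4) r e0 by (intro str) auto
    then show ?thesis by simp
  qed
  \<comment> \<open>Dividing by \<open>z^k c\<close> undoes the rotation, so that all jumps push in
    the same real direction.\<close>
  define y where "y k = Re (l (u k) / (z ^ k * c))" for k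
  have z0: "z \<noteq> 0" using z by auto
  have y_step: "y (Suc k) \<ge> y k + \<tau> / 2" for k
  proof -
    define d where "d = u (Suc k) - L (u k) - w k"
    have "u (Suc k) = L (u k) + w k + d" by (simp add: d_def)
    then have "l (u (Suc k)) = z * l (u k) + \<tau> *\<^sub>R (z ^ Suc k * c) + l d"
      by (simp only: l.add l(3) lw)
    then have "l (u (Suc k)) / (z ^ Suc k * c) = l (u k) / (z ^ k * c) + of_real \<tau> + l d / (z ^ Suc k * c)"
      using z0 c by (simp add: add_divide_distrib scaleR_conv_of_real)
    then have "y (Suc k) = y k + \<tau> + Re (l d / (z ^ Suc k * c))" by (simp add: y_def)
    moreover have "\<bar>Re (l d / (z ^ Suc k * c))\<bar> \<le> \<tau> / 2"
    proof -
      have "norm (l d) \<le> norm d * Kl" by (rule Kl)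
      also have "\<dots> \<le> (\<epsilon> * (\<tau> * cmod c * Kg)) * Kl"
        using step[of k] wb[of k] eps(1) Kl(1)
        by (intro mult_right_mono order_trans[OF step[of k, folded d_def]] mult_left_mono) auto
      also have "\<dots> = (\<epsilon> * Kg * Kl) * (\<tau> * cmod c)" by simp
      also have "\<dots> = \<tau> / 2 * cmod c" unfolding eps(2) by simp
      finally have "norm (l d / (z ^ Suc k * c)) \<le> \<tau> / 2"
        using z c by (simp add: norm_divide norm_mult norm_power divide_le_eq)
      then show ?thesis using abs_Re_le_cmod order_trans by blast
    qed
    ultimately show ?thesis by linarith
  qed
  have y_lower: "y k \<ge> y 0 + real k * (\<tau> / 2)" for k
  proof (induction k)
    case (Suc k)
    then show ?case using y_step[of k] by (simp add: algebra_simps add_divide_distrib)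
  qed simp
  have y_bound: "\<bar>y k\<bar> \<le> R * Kl / cmod c" for k
  proof -
    have "\<bar>y k\<bar> \<le> norm (l (u k) / (z ^ k * c))" unfolding y_def by (rule abs_Re_le_cmod)
    also have "\<dots> = norm (l (u k)) / cmod c" using z by (simp add: norm_divide norm_mult norm_power)
    also have "norm (l (u k)) \<le> R * Kl"
      using Kl u(1)[of k] by (meson less_imp_le mult_right_mono order_trans)
    finally show ?thesis using c by (simp add: divide_right_mono)
  qed
  \<comment> \<open>The factor 2 is needed because \<open>y 0\<close> may lie at the lower end of
    the bounded interval.\<close>
  obtain n :: nat where "2 * (R * Kl / cmod c) < real n * (\<tau> / 2)"
    using ex_less_of_nat_mult[of "\<tau> / 2" "2 * (R * Kl / cmod c)"] \<tau>(1) by fastforce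
  then show False using y_lower[of n] y_bound[of n] y_bound[of 0] by linarith
qed

end

section \<open>Logarithmic coordinates of a Lie group\<close>

lemma inv_into_map_prod:
  assumes "inj_on f A" "inj_on g B" "x \<in> f ` A" "y \<in> g ` B"
  shows "inv_into (A \<times> B) (map_prod f g) (x, y) = (inv_into A f x, inv_into B g y)"
proof -
  have "map_prod f g (inv_into A f x, inv_into B g y) = (x, y)"
    using assms by (simp add: f_inv_into_f)
  moreover have "inj_on (map_prod f g) (A \<times> B)" using assms(1,2) by (rule map_prod_inj_on)
  moreover have "(inv_into A f x, inv_into B g y) \<in> A \<times> B" using assms by (simp add: inv_into_into)
  ultimately show ?thesis by (metis inv_into_f_f)
qed

lemma is_chart_facts:
  assumes "is_chart c"
  shows "open (fst c)" "open (snd c ` fst c)" "inj_on (snd c) (fst c)"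
    "continuous_on (fst c) (snd c)" "continuous_on (snd c ` fst c) (inv_into (fst c) (snd c))"
    "\<And>g. g \<in> fst c \<Longrightarrow> inv_into (fst c) (snd c) (snd c g) = g"
    "\<And>x. x \<in> snd c ` fst c \<Longrightarrow> snd c (inv_into (fst c) (snd c) x) = x"
    "\<And>x. x \<in> snd c ` fst c \<Longrightarrow> inv_into (fst c) (snd c) x \<in> fst c"
  using assms unfolding is_chart_def homeomorphism_def
  by (auto intro!: inj_on_inverseI simp: f_inv_into_f inv_into_into)

text \<open>In a chart recentred at the identity the group law is \<open>\<mu>\<close> with
  \<open>\<mu> x 0 = x = \<mu> 0 x\<close>. Mixed differences bound its deviation from addition, so
  doubling is a quadratic perturbation of multiplication by 2, and \<open>F = id + p\<close>
  straightens it. The assertions on \<open>F\<close> besides \<open>log_coordinates\<close> serve to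
  read off the differential in the chart \<open>c\<close>.\<close>

lemma lie_group_log_coordinates:
  fixes A :: "('g::{topological_group_add, t2_space}, 'e::finite_dim_inner) chart set"
  assumes A: "lie_group A"
  obtains c e F \<rho> K where "c \<in> charts_at A 0" "log_coordinates e \<rho>"
    "\<And>x. norm x < \<rho> \<Longrightarrow> e x \<in> fst c \<and> snd c (e x) = snd c 0 + F x"
    "\<And>x. norm x < \<rho> \<Longrightarrow> norm (F x - x) \<le> K * norm x * norm x"
    "\<And>x. norm x < \<rho> \<Longrightarrow> norm x \<le> 2 * norm (F x)"
    "open (F ` ball 0 \<rho>)" "F 0 = 0"
proof -
  have atlas: "smooth_atlas A" and smooth_add: "smooth_map (prod_atlas A A) A (\<lambda>(x, y). x + y)"
    using A by (auto simp: lie_group_def)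
  have "0 \<in> (\<Union>c\<in>A. fst c)" using atlas by (simp only: smooth_atlas_def UNIV_I)
  then obtain c where c: "c \<in> A" "0 \<in> fst c" by blast
  have chart: "is_chart c" using atlas c(1) by (simp add: smooth_atlas_def)
  define W where "W = fst c"
  define \<kappa> where "\<kappa> = snd c"
  define \<psi> where "\<psi> = inv_into W \<kappa>"
  define \<Omega> where "\<Omega> = \<kappa> ` W"
  note ch = is_chart_facts[OF chart, folded W_def \<kappa>_def, folded \<psi>_def \<Omega>_def]
  define a where "a = \<kappa> 0"
  have a: "a \<in> \<Omega>" "\<psi> a = 0" using c(2) ch(6)[of 0] by (auto simp: a_def \<Omega>_def W_def)
  define f where "f = local_rep (W \<times> W, map_prod \<kappa> \<kappa>) c (\<lambda>(x, y). x + y)"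
  define S where "S = local_dom (W \<times> W, map_prod \<kappa> \<kappa>) c (\<lambda>(x, y). x + y)"
  have "(W \<times> W, map_prod \<kappa> \<kappa>) \<in> prod_atlas A A"
    unfolding prod_atlas_def W_def \<kappa>_def using c(1) by blast
  with smooth_add c(1) have smooth: "smooth_on S f"
    unfolding smooth_map_def S_def f_def by blast
  have f_eq: "f (x, y) = \<kappa> (\<psi> x + \<psi> y)" if "x \<in> \<Omega>" "y \<in> \<Omega>" for x y
    using inv_into_map_prod[of \<kappa> W \<kappa> W x y] ch(3) that
    by (simp add: f_def local_rep_def \<kappa>_def[symmetric] \<psi>_def \<Omega>_def)
  have S_eq: "S = {p \<in> \<Omega> \<times> \<Omega>. \<psi> (fst p) + \<psi> (snd p) \<in> W}" (is "S = ?S")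
  proof (intro equalityI subsetI)
    fix p assume "p \<in> S"
    then obtain g h where "g \<in> W" "h \<in> W" "g + h \<in> W" "p = (\<kappa> g, \<kappa> h)"
      by (auto simp: S_def local_dom_def W_def)
    then show "p \<in> ?S" using ch(6) by (simp add: \<Omega>_def)
  next
    fix p assume p: "p \<in> ?S"
    then have "p = map_prod \<kappa> \<kappa> (\<psi> (fst p), \<psi> (snd p))" using ch(7) by (auto simp: prod_eq_iff)
    moreover have "(\<psi> (fst p), \<psi> (snd p)) \<in> (W \<times> W) \<inter> (\<lambda>(x, y). x + y) -` W"
      using p ch(8) by auto
    ultimately show "p \<in> S" unfolding S_def local_dom_def W_def[symmetric] by (metis fst_conv snd_conv image_eqI)
  qed
  have "open S"
  proof -
    have "continuous_on (\<Omega> \<times> \<Omega>) (\<lambda>p. \<psi> (fst p) + \<psi> (snd p))"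
      by (intro continuous_on_add continuous_on_compose2[OF ch(5)] continuous_on_fst continuous_on_snd
          continuous_on_id) auto
    from continuous_open_preimage[OF this open_Times[OF ch(2) ch(2)] ch(1)]
    show ?thesis by (simp add: S_eq vimage_def Int_def)
  qed
  have aS: "(a, a) \<in> S" using a c(2) by (simp add: S_eq W_def)
  have C2: "C_on 2 S f" using smooth by (simp add: smooth_on_def)
  obtain R0 where R0: "R0 > 0" "ball (a, a) R0 \<subseteq> S" using \<open>open S\<close> aS open_contains_ball by blast
  have inS: "(a + x, a + y) \<in> S" if "norm x < R0/2" "norm y < R0/2" for x y
  proof -
    have "dist (a, a) (a + x, a + y) = norm (x, y)" by (simp add: dist_Pair_Pair norm_Pair dist_norm)
    also have "\<dots> < R0" using norm_Pair_le[of x y] that by linarith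
    finally show ?thesis using R0(2) by auto
  qed
  have bl: "bounded_linear (\<lambda>x :: 'e. (x, 0 :: 'e))" "bounded_linear (\<lambda>y :: 'e. (0 :: 'e, y))"
    by (intro bounded_linear_Pair bounded_linear_ident bounded_linear_zero)+
  \<comment> \<open>The group may be noncommutative, so one estimate varies the right factor and a
    second one the left factor.\<close>
  obtain C1 R1 where C1: "C1 > 0" "R1 > 0" "\<And>x y y'. norm x < R1 \<Longrightarrow> norm y < R1 \<Longrightarrow> norm y' < R1 \<Longrightarrow>
      norm (f (a + x, a + y) - f (a + x, a + y') - (f (a, a + y) - f (a, a + y'))) \<le> C1 * norm x * norm (y - y')"
    using C2_mixed_difference[OF C2 \<open>open S\<close> aS bl(1) bl(2)] by auto
  obtain C2' R2 where C2': "C2' > 0" "R2 > 0" "\<And>x y y'. norm x < R2 \<Longrightarrow> norm y < R2 \<Longrightarrow> norm y' < R2 \<Longrightarrow>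
      norm (f (a + y, a + x) - f (a + y', a + x) - (f (a + y, a) - f (a + y', a))) \<le> C2' * norm x * norm (y - y')"
    using C2_mixed_difference[OF C2 \<open>open S\<close> aS bl(2) bl(1)] by auto
  define C where "C = C1 + C2'"
  have C: "C > 0" "C1 \<le> C" "C2' \<le> C" using C1(1) C2'(1) by (auto simp: C_def)
  define R where "R = min (R0/2) (min R1 R2)"
  have R: "R > 0" "R \<le> R0/2" "R \<le> R1" "R \<le> R2" using R0 C1(2) C2'(2) by (auto simp: R_def)
  define \<mu> where "\<mu> x y = \<kappa> (\<psi> (a + x) + \<psi> (a + y)) - a" for x y
  have om: "a + x \<in> \<Omega>" if "norm x < R" for x
    using inS[of x 0] R that by (simp add: S_eq)
  have f_mu: "f (a + x, a + y) = a + \<mu> x y" if "norm x < R" "norm y < R" for x y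
    using f_eq[OF om om, OF that] by (simp add: \<mu>_def)
  have mu0: "\<mu> 0 y = y" "\<mu> y 0 = y" if "norm y < R" for y
    using om[OF that] a(2) ch(7) by (auto simp: \<mu>_def)
  have psi_mu: "\<psi> (a + \<mu> x y) = \<psi> (a + x) + \<psi> (a + y)" if "norm x < R" "norm y < R" for x y
    using inS[of x y] R that ch(6)[of "\<psi> (a + x) + \<psi> (a + y)"] by (simp add: S_eq \<mu>_def)
  have M1: "norm (\<mu> x y - \<mu> x y' - (y - y')) \<le> C * norm x * norm (y - y')"
    if n: "norm x < R" "norm y < R" "norm y' < R" for x y y'
  proof -
    have "norm (\<mu> x y - \<mu> x y' - (y - y')) \<le> C1 * norm x * norm (y - y')"
      using C1(3)[of x y y'] n R f_mu[OF n(1,2)] f_mu[OF n(1,3)] f_mu[OF _ n(2), of 0] f_mu[OF _ n(3), of 0]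
        mu0(1)[OF n(2)] mu0(1)[OF n(3)] by simp
    also have "\<dots> \<le> C * norm x * norm (y - y')" using C by (intro mult_right_mono) auto
    finally show ?thesis .
  qed
  have M2: "norm (\<mu> x y - \<mu> x' y - (x - x')) \<le> C * norm y * norm (x - x')"
    if n: "norm y < R" "norm x < R" "norm x' < R" for x y x'
  proof -
    have "norm (\<mu> x y - \<mu> x' y - (x - x')) \<le> C2' * norm y * norm (x - x')"
      using C2'(3)[of y x x'] n R f_mu[OF n(2,1)] f_mu[OF n(3,1)] f_mu[OF n(2), of 0] f_mu[OF n(3), of 0]
        mu0(2)[OF n(2)] mu0(2)[OF n(3)] by simp
    also have "\<dots> \<le> C * norm y * norm (x - x')" using C by (intro mult_right_mono) auto
    finally show ?thesis .
  qed
  define Q where "Q x = \<mu> x x - 2 *\<^sub>R x" for x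
  have Q0: "Q 0 = 0" using mu0(1)[of 0] R(1) by (simp add: Q_def)
  have Q: "norm (Q x - Q y) \<le> (2 * C) * max (norm x) (norm y) * norm (x - y)"
    if n: "norm x < R" "norm y < R" for x y
  proof -
    \<comment> \<open>The passage from \<open>(x, x)\<close> to \<open>(y, y)\<close> goes through
      \<open>(x, y)\<close>, changing one factor at a time.\<close>
    have "Q x - Q y = (\<mu> x x - \<mu> x y - (x - y)) + (\<mu> x y - \<mu> y y - (x - y))"
      by (simp add: Q_def scaleR_2 algebra_simps)
    also have "norm \<dots> \<le> C * norm x * norm (x - y) + C * norm y * norm (x - y)"
      by (intro norm_triangle_le add_mono M1 M2 n)
    also have "\<dots> \<le> C * max (norm x) (norm y) * norm (x - y) + C * max (norm x) (norm y) * norm (x - y)"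
      using C by (intro add_mono mult_right_mono mult_left_mono) auto
    finally show ?thesis by (simp add: mult_ac)
  qed
  have C0: "2 * C \<ge> 0" using C(1) by simp
  obtain \<rho> K p where rho: "\<rho> > 0" "\<rho> \<le> R/2" and K: "K \<ge> 0" "K * \<rho> \<le> 1/2" and p0: "p 0 = 0"
    and p_lip: "\<And>x y. norm x < \<rho> \<Longrightarrow> norm y < \<rho> \<Longrightarrow> norm (p x - p y) \<le> K * max (norm x) (norm y) * norm (x - y)"
    and p_eq: "\<And>x. norm x < \<rho> \<Longrightarrow> p x = 2 *\<^sub>R p ((1/2) *\<^sub>R x) + Q ((1/2) *\<^sub>R x + p ((1/2) *\<^sub>R x))"
    by (rule ex_conjugation_of_doubling[OF R(1) C0 Q0 Q]) (assumption | rule that)+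
  define F where "F x = x + p x" for x
  have F0: "F 0 = 0" by (simp add: F_def p0)
  have p_lip_le: "norm (p x - p y) \<le> K * r * norm (x - y)" if "norm x < r" "norm y < r" "r \<le> \<rho>" for x y r
  proof -
    have "norm (p x - p y) \<le> K * max (norm x) (norm y) * norm (x - y)" using that by (intro p_lip) auto
    also have "\<dots> \<le> K * r * norm (x - y)" using that K by (intro mult_right_mono mult_left_mono) auto
    finally show ?thesis .
  qed
  have p_half: "norm (p x - p y) \<le> 1/2 * norm (x - y)" if "norm x < \<rho>" "norm y < \<rho>" for x y
    using p_lip_le[OF that order_refl] mult_right_mono[OF K(2), of "norm (x - y)"] by simp
  have F_lower: "norm (x - y) \<le> 2 * norm (F x - F y)" if "norm x < \<rho>" "norm y < \<rho>" for x y
    unfolding F_def by (rule near_identity_expands[OF p_half[OF that]])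
  have F_upper: "norm (F x - F y) \<le> 3/2 * norm (x - y)" if "norm x < \<rho>" "norm y < \<rho>" for x y
    using p_half[OF that] norm_triangle_ineq[of "x - y" "p x - p y"] by (simp add: F_def algebra_simps)
  have FR: "norm (F x) < R" if "norm x < \<rho>" for x
    using F_upper[OF that, of 0] rho that by (simp add: F0)
  have F_om: "a + F x \<in> \<Omega>" if "norm x < \<rho>" for x using om FR that by blast
  define e where "e x = \<psi> (a + F x)" for x
  have ke: "e x \<in> W" "\<kappa> (e x) = a + F x" if "norm x < \<rho>" for x
    using ch(7,8) F_om[OF that] by (auto simp: e_def)
  have "log_coordinates e \<rho>"
  proof
    show "\<rho> > 0" by (rule rho)
    show "e 0 = 0" using a by (simp add: e_def F0)
    have "(1/2)-lipschitz_on (ball 0 \<rho>) p" using p_half by (auto simp: lipschitz_on_def dist_norm)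
    then have "continuous_on (ball 0 \<rho>) p" by (rule lipschitz_on_continuous_on)
    then have "continuous_on (ball 0 \<rho>) (\<lambda>x. a + F x)" unfolding F_def by (intro continuous_intros)
    then show "continuous_on (ball 0 \<rho>) e"
      unfolding e_def[abs_def] by (rule continuous_on_compose2[OF ch(5)]) (use F_om in auto)
    show "inj_on e (ball 0 \<rho>)"
    proof (rule inj_onI)
      fix x y assume "x \<in> ball 0 \<rho>" "y \<in> ball 0 \<rho>" "e x = e y"
      then have "F x = F y" "norm x < \<rho>" "norm y < \<rho>" using ke(2)[of x] ke(2)[of y] by auto
      then show "x = y" using F_lower[of x y] by simp
    qed
    show "open (e ` U)" if U: "open U" "U \<subseteq> ball 0 \<rho>" for U
    proof -
      have "open (F ` U)"
        unfolding F_def by (rule near_identity_open[OF p_half U(1)]) (use U(2) in auto)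
      then have V: "open ((+) a ` F ` U)" by (rule open_translation)
      have "e ` U = W \<inter> \<kappa> -` ((+) a ` F ` U)"
      proof (intro equalityI subsetI)
        fix g assume "g \<in> e ` U"
        then obtain x where "x \<in> U" "g = e x" by blast
        then show "g \<in> W \<inter> \<kappa> -` ((+) a ` F ` U)" using ke[of x] U(2) by auto
      next
        fix g assume "g \<in> W \<inter> \<kappa> -` ((+) a ` F ` U)"
        then obtain x where "g \<in> W" "x \<in> U" "\<kappa> g = a + F x" by auto
        then have "g = e x" using ch(6)[of g] by (simp add: e_def)
        then show "g \<in> e ` U" using \<open>x \<in> U\<close> by blast
      qed
      moreover have "open (W \<inter> \<kappa> -` ((+) a ` F ` U))"
        by (rule continuous_open_preimage[OF ch(4) ch(1) V])
      ultimately show ?thesis by simp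
    qed
    show "e (2 *\<^sub>R x) = e x + e x" if "norm x < \<rho> / 2" for x
    proof -
      have x: "norm x < \<rho>" using that norm_ge_zero[of x] by linarith
      have "p (2 *\<^sub>R x) = 2 *\<^sub>R p x + Q (F x)" using p_eq[of "2 *\<^sub>R x"] that by (simp add: F_def)
      then have "F (2 *\<^sub>R x) = \<mu> (F x) (F x)" by (simp add: F_def Q_def scaleR_add_right)
      then show ?thesis using psi_mu[OF FR FR, OF x x] by (simp add: e_def)
    qed
    fix \<epsilon> :: real assume eps: "\<epsilon> > 0"
    \<comment> \<open>\<open>9/4 * C\<close> is the deviation of \<open>\<mu>\<close> from addition,
      with two factors 3/2 from \<open>F\<close>. The differences of \<open>p\<close> contribute
      \<open>K\<close> for the two factors and \<open>K * (9/2 * C + 3)\<close> for the product. The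
      1 ensures positivity.\<close>
    define B where "B = 9/4 * C + 4 * K + 9/2 * K * C + 1"
    have B: "B > 0" using C K by (simp add: B_def add_nonneg_pos)
    define r where "r = min \<rho> (min 1 (\<epsilon> / B))"
    have r: "r > 0" "r \<le> \<rho>" "r \<le> 1" "r \<le> \<epsilon> / B" using rho eps B by (auto simp: r_def)
    have rB: "r * B \<le> \<epsilon>" using r(4) B by (simp add: field_simps)
    show "\<exists>r>0. \<forall>x y z x' y' z'. norm x < r \<longrightarrow> norm y < r \<longrightarrow> norm z < r \<longrightarrow> norm x' < r \<longrightarrow> norm y' < r \<longrightarrow>
      norm z' < r \<longrightarrow> e x + e y = e z \<longrightarrow> e x' + e y' = e z' \<longrightarrow>
      norm ((z - z') - (x - x') - (y - y')) \<le> \<epsilon> * (norm (x - x') + norm (y - y'))"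
    proof (intro exI[of _ r] conjI allI impI r(1))
      fix x y z x' y' z' assume n: "norm x < r" "norm y < r" "norm z < r" "norm x' < r" "norm y' < r" "norm z' < r"
        and eq: "e x + e y = e z" "e x' + e y' = e z'"
      have lt: "norm u < \<rho>" if "norm u < r" for u :: 'e using that r(2) by linarith
      define D where "D = norm (x - x') + norm (y - y')"
      have D: "D \<ge> 0" by (simp add: D_def)
      have Z: "F z = \<mu> (F x) (F y)" "F z' = \<mu> (F x') (F y')"
        using eq ke(2)[OF lt] n by (simp_all add: \<mu>_def e_def[symmetric])
      define E where "E = (F z - F z') - (F x - F x') - (F y - F y')"
      have small: "norm (F u) \<le> 3/2 * r" if "norm u < r" for u
        using F_upper[OF lt[OF that], of 0] rho that by (simp add: F0)
      have "E = (\<mu> (F x) (F y) - \<mu> (F x') (F y) - (F x - F x')) + (\<mu> (F x') (F y) - \<mu> (F x') (F y') - (F y - F y'))"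
        by (simp add: E_def Z)
      also have "norm \<dots> \<le> C * norm (F y) * norm (F x - F x') + C * norm (F x') * norm (F y - F y')"
        by (intro norm_triangle_le add_mono M1 M2 FR lt n)
      also have "\<dots> \<le> C * (3/2 * r) * (3/2 * norm (x - x')) + C * (3/2 * r) * (3/2 * norm (y - y'))"
        using C r(1) by (intro add_mono mult_mono small F_upper lt n) auto
      also have "\<dots> = 9/4 * C * r * D" by (simp add: D_def algebra_simps)
      finally have E: "norm E \<le> 9/4 * C * r * D" .
      have "F z - F z' = E + ((F x - F x') + (F y - F y'))" by (simp add: E_def)
      also have "norm \<dots> \<le> 9/4 * C * r * D + (3/2 * norm (x - x') + 3/2 * norm (y - y'))"
        by (intro norm_triangle_le add_mono E F_upper lt n)
      also have "3/2 * norm (x - x') + 3/2 * norm (y - y') = 3/2 * D" by (simp add: D_def)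
      finally have FF: "norm (F z - F z') \<le> 9/4 * C * r * D + 3/2 * D" .
      \<comment> \<open>An a priori bound on \<open>z - z'\<close>, since the term
        \<open>p z - p z'\<close> involves the product itself and not only the factors.\<close>
      have "norm (z - z') \<le> 2 * (9/4 * C * r * D + 3/2 * D)"
        by (rule order_trans[OF F_lower[OF lt lt, OF n(3,6)]]) (rule mult_left_mono[OF FF], simp)
      also have "\<dots> \<le> 2 * (9/4 * C * 1 * D + 3/2 * D)"
        using C r D by (intro mult_left_mono add_right_mono mult_right_mono) auto
      finally have zz: "norm (z - z') \<le> (9/2 * C + 3) * D" by (simp add: algebra_simps)
      have pz: "norm (p z - p z') \<le> K * r * ((9/2 * C + 3) * D)"
        using p_lip_le[OF n(3,6) r(2)] mult_left_mono[OF zz, of "K * r"] K(1) r(1) by (simp add: mult.assoc)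
      have "(z - z') - (x - x') - (y - y') = E + ((p x - p x') + ((p y - p y') + (p z' - p z)))"
        by (simp add: E_def F_def)
      also have "norm \<dots> \<le> 9/4 * C * r * D + (K * r * norm (x - x') + (K * r * norm (y - y') + K * r * ((9/2 * C + 3) * D)))"
        using pz by (intro norm_triangle_le add_mono E p_lip_le n r(2)) (simp add: norm_minus_commute)
      also have "\<dots> = r * (9/4 * C + 4 * K + 9/2 * K * C) * D" by (simp add: D_def algebra_simps)
      also have "\<dots> \<le> r * B * D" using r(1) D by (intro mult_right_mono mult_left_mono) (auto simp: B_def)
      also have "\<dots> \<le> \<epsilon> * D" using rB D by (intro mult_right_mono) auto
      finally show "norm ((z - z') - (x - x') - (y - y')) \<le> \<epsilon> * (norm (x - x') + norm (y - y'))"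
        by (simp add: D_def)
    qed
  qed
  moreover have "norm (F x - x) \<le> K * norm x * norm x" if "norm x < \<rho>" for x
    using p_lip[OF that, of 0] rho by (simp add: F_def p0 max.absorb1)
  moreover have "open (F ` ball 0 \<rho>)"
    unfolding F_def by (rule near_identity_open[OF p_half]) auto
  moreover have "norm x \<le> 2 * norm (F x)" if "norm x < \<rho>" for x
    using F_lower[OF that, of 0] rho by (simp add: F0)
  ultimately show thesis
    using that[of c e \<rho> F K] c ke F0 by (auto simp: charts_at_def W_def \<kappa>_def a_def)
qed

section \<open>The differential in a chart\<close>

lemma open_chart_image:
  assumes "is_chart c" "open X"
  shows "open (snd c ` (fst c \<inter> X))"
proof -
  note ch = is_chart_facts[OF assms(1)]
  have "snd c ` (fst c \<inter> X) = (snd c ` fst c) \<inter> inv_into (fst c) (snd c) -` X"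
    using ch(6-8) by force
  then show ?thesis using continuous_open_preimage[OF ch(5) ch(2) assms(2)] by simp
qed

text \<open>Because of the inverse chart in the middle, the composed representations agree with that
  of \<open>g \<circ> f\<close> only on \<open>U\<close>. Continuity of \<open>f\<close> makes
  \<open>U\<close> a neighbourhood, which is enough for derivatives.\<close>

lemma local_rep_has_derivative_compose:
  fixes c :: "('m::topological_space, 'e::real_normed_vector) chart"
    and d :: "('n::topological_space, 'f::real_normed_vector) chart"
    and d' :: "('k::topological_space, 'h::real_normed_vector) chart"
  assumes charts: "is_chart c" "is_chart d"
    and p: "p \<in> fst c" "f p \<in> fst d" and cont: "continuous_on UNIV f"
    and Df: "(local_rep c d f has_derivative Df) (at (snd c p))"
    and Dg: "(local_rep d d' g has_derivative Dg) (at (snd d (f p)))"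
  shows "(local_rep c d' (g \<circ> f) has_derivative Dg \<circ> Df) (at (snd c p))"
proof -
  note c = is_chart_facts[OF charts(1)] and d = is_chart_facts[OF charts(2)]
  define U where "U = snd c ` (fst c \<inter> f -` fst d)"
  have "open (f -` fst d)" using d(1) cont by (simp add: continuous_on_open_vimage)
  then have U: "open U" unfolding U_def by (rule open_chart_image[OF charts(1)])
  have "snd c p \<in> U" using p by (auto simp: U_def)
  have at_p: "local_rep c d f (snd c p) = snd d (f p)" using c(6)[OF p(1)] by (simp add: local_rep_def)
  have "((\<lambda>x. local_rep d d' g (local_rep c d f x)) has_derivative (\<lambda>x. Dg (Df x))) (at (snd c p))"
    by (rule has_derivative_compose[OF Df]) (simp add: at_p Dg)
  moreover have "local_rep d d' g (local_rep c d f x) = local_rep c d' (g \<circ> f) x" if xU: "x \<in> U" for x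
  proof -
    obtain q where q: "q \<in> fst c" "f q \<in> fst d" "x = snd c q" using xU by (auto simp: U_def)
    then show ?thesis using c(6)[OF q(1)] d(6)[OF q(2)] by (simp add: local_rep_def)
  qed
  ultimately have "(local_rep c d' (g \<circ> f) has_derivative (\<lambda>x. Dg (Df x))) (at (snd c p))"
    using has_derivative_transform_within_open[OF _ U \<open>snd c p \<in> U\<close>] by blast
  then show ?thesis by (simp add: o_def)
qed

lemma local_rep_id_has_derivative:
  assumes "smooth_atlas A" "c \<in> charts_at A p" "d \<in> charts_at A p"
  shows "(local_rep c d id has_derivative frechet_derivative (local_rep c d id) (at (snd c p))) (at (snd c p))"
proof -
  have "smooth_on (local_dom c d id) (local_rep c d id)"
    using assms by (auto simp: smooth_atlas_def charts_at_def)
  then have "C_on (Suc 0) (local_dom c d id) (local_rep c d id)" unfolding smooth_on_def by blast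
  moreover have "snd c p \<in> local_dom c d id" using assms by (auto simp: charts_at_def local_dom_def)
  ultimately show ?thesis unfolding C_on.simps by (simp add: frechet_derivative_works)
qed

lemma local_rep_self_has_derivative:
  assumes "is_chart c" "p \<in> fst c"
  shows "(local_rep c c id has_derivative id) (at (snd c p))"
proof -
  note c = is_chart_facts[OF assms(1)]
  have "(id has_derivative id) (at (snd c p))" unfolding id_def by (rule has_derivative_ident)
  then show ?thesis
  proof (rule has_derivative_transform_within_open[OF _ c(2)])
    show "id x = local_rep c c id x" if "x \<in> snd c ` fst c" for x
      using c(7)[OF that] by (simp add: local_rep_def)
  qed (use assms(2) in simp)
qed

text \<open>\<open>F\<close> is tangent to the identity, so conjugation by it keeps the derivative:
  at \<open>y = F x\<close> the error is \<open>(F (L x) - L x) - L (F x - x)\<close>, quadratic in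
  \<open>x\<close>. Openness of the image writes every small \<open>y\<close> as some
  \<open>F x\<close>. Applied to \<open>\<alpha>\<close> in a chart, this derives differentiability
  at the identity from continuity.\<close>

lemma conjugate_has_derivative:
  fixes F :: "'e::real_normed_vector \<Rightarrow> 'e" and f :: "'e \<Rightarrow> 'e"
  assumes L: "bounded_linear L" and r: "r > 0" "s > 0"
    and lower: "\<And>x. norm x < r \<Longrightarrow> norm x \<le> 2 * norm (F x)"
    and quad: "\<And>x. norm x < r \<Longrightarrow> norm (F x - x) \<le> K * norm x * norm x"
    and F0: "F 0 = 0" and openF: "open (F ` ball 0 r)"
    and f: "\<And>x. norm x < s \<Longrightarrow> norm x < r \<Longrightarrow> f (a + F x) = b + F (L x)"
    and Lr: "\<And>x. norm x < s \<Longrightarrow> norm (L x) < r"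
  shows "(f has_derivative L) (at a)"
proof -
  interpret L: bounded_linear L by (rule L)
  obtain KL where KL: "KL > 0" "\<And>x. norm (L x) \<le> norm x * KL" using L.pos_bounded by blast
  \<comment> \<open>The factor 4 is the square of the 2 in
    \<open>norm x \<le> 2 * norm y\<close>.\<close>
  define M where "M = 4 * (\<bar>K\<bar> * KL\<^sup>2 + \<bar>K\<bar> * KL)"
  have "0 \<in> F ` ball 0 r" using F0 r by (intro image_eqI[of _ _ 0]) auto
  then obtain t0 where t0: "t0 > 0" "ball 0 t0 \<subseteq> F ` ball 0 r" using openF open_contains_ball by blast
  define t where "t = min t0 (s / 2)"
  have t: "t > 0" "t \<le> t0" "2 * t \<le> s" using t0(1) r by (auto simp: t_def)
  have main: "norm (f (a + y) - f a - L y) \<le> M * norm y * norm y" if y: "norm y < t" for y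
  proof -
    have "y \<in> F ` ball 0 r" using t0(2) y t(2) by (intro subsetD[OF t0(2)]) auto
    then obtain x where x: "norm x < r" "y = F x" by auto
    have xy: "norm x \<le> 2 * norm y" using lower[OF x(1)] x(2) by simp
    then have xs: "norm x < s" using y t(3) by linarith
    have quad': "norm (F x - x) \<le> \<bar>K\<bar> * norm x * norm x" if "norm x < r" for x
      using quad[OF that] mult_right_mono[OF abs_ge_self[of K], of "norm x * norm x"] by (simp add: mult.assoc)
    have fa: "f a = b" using f[of 0] r F0 by (simp add: L.zero)
    have "f (a + y) - f a - L y = (F (L x) - L x) - L (F x - x)"
      using f[OF xs x(1)] by (simp add: fa x(2) L.diff)
    also have "norm \<dots> \<le> norm (F (L x) - L x) + norm (L (F x - x))" by (rule norm_triangle_ineq4)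
    also have "\<dots> \<le> \<bar>K\<bar> * (norm x * KL) * (norm x * KL) + (\<bar>K\<bar> * norm x * norm x) * KL"
    proof (intro add_mono)
      show "norm (F (L x) - L x) \<le> \<bar>K\<bar> * (norm x * KL) * (norm x * KL)"
        using KL by (intro order_trans[OF quad'[OF Lr[OF xs]]] mult_mono) auto
      show "norm (L (F x - x)) \<le> \<bar>K\<bar> * norm x * norm x * KL"
        using KL quad'[OF x(1)] by (meson less_imp_le mult_right_mono order_trans)
    qed
    also have "\<dots> = (\<bar>K\<bar> * KL\<^sup>2 + \<bar>K\<bar> * KL) * (norm x * norm x)"
      by (simp add: power2_eq_square algebra_simps)
    also have "\<dots> \<le> (\<bar>K\<bar> * KL\<^sup>2 + \<bar>K\<bar> * KL) * ((2 * norm y) * (2 * norm y))"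
      using xy KL(1) by (intro mult_left_mono mult_mono) auto
    finally show ?thesis by (simp add: M_def algebra_simps)
  qed
  show ?thesis
    unfolding has_derivative_at
  proof (rule conjI[OF L], rule Lim_null_comparison[of _ "\<lambda>h. M * norm h"])
    show "\<forall>\<^sub>F h in at 0. norm (norm (f (a + h) - f a - L h) / norm h) \<le> M * norm h"
      unfolding eventually_at
    proof (intro exI[of _ t] conjI t(1) ballI impI)
      fix h :: 'e assume h: "h \<noteq> 0 \<and> dist h 0 < t"
      then show "norm (norm (f (a + h) - f a - L h) / norm h) \<le> M * norm h"
        using main[of h] by (simp add: divide_le_eq)
    qed
    show "(\<lambda>h. M * norm h) \<midarrow>0\<rightarrow> 0" by (rule tendsto_mult_right_zero[OF tendsto_norm_zero[OF tendsto_ident_at]])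
  qed
qed

lemma bij_betw_conjugate:
  assumes \<Phi>: "bij_betw \<Phi> S UNIV" and G: "\<And>x. x \<in> S \<Longrightarrow> G x \<in> S" and eq: "\<And>x. x \<in> S \<Longrightarrow> H (\<Phi> x) = \<Phi> (G x)"
  shows "bij_betw G S S \<longleftrightarrow> bij H"
proof -
  have "bij_betw (\<Phi> \<circ> G) S UNIV \<longleftrightarrow> bij_betw (H \<circ> \<Phi>) S UNIV" by (rule bij_betw_cong) (simp add: eq)
  moreover have "bij_betw (\<Phi> \<circ> G) S UNIV \<longleftrightarrow> bij_betw G S S"
    using G by (intro bij_betw_comp_iff2[OF \<Phi>, symmetric]) auto
  moreover have "bij_betw (H \<circ> \<Phi>) S UNIV \<longleftrightarrow> bij H"
    by (rule bij_betw_comp_iff[OF \<Phi>, symmetric])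
  ultimately show ?thesis by blast
qed

lemma tangent_spaceI:
  assumes "\<And>c. c \<notin> charts_at A p \<Longrightarrow> v c = 0"
    and "\<And>c d. c \<in> charts_at A p \<Longrightarrow> d \<in> charts_at A p \<Longrightarrow>
      v d = frechet_derivative (local_rep c d id) (at (snd c p)) (v c)"
  shows "v \<in> tangent_space A p"
  unfolding tangent_space_def using assms by blast

lemma tangent_space_outside: "v \<in> tangent_space A p \<Longrightarrow> c \<notin> charts_at A p \<Longrightarrow> v c = 0"
  unfolding tangent_space_def by blast

lemma tangent_space_transition:
  "v \<in> tangent_space A p \<Longrightarrow> c \<in> charts_at A p \<Longrightarrow> d \<in> charts_at A p \<Longrightarrow>
    v d = frechet_derivative (local_rep c d id) (at (snd c p)) (v c)"
  unfolding tangent_space_def by blast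

text \<open>A tangent vector is determined by its component in one chart, and by the cocycle rule
  every component \<open>w\<close> extends to a tangent vector \<open>E w\<close>. This settles
  existence and uniqueness for the definite description in \<open>differential\<close>.\<close>

lemma differential_in_chart:
  fixes A :: "('g::{topological_group_add, t2_space}, 'e::finite_dim_inner) chart set"
  assumes A: "smooth_atlas A" and c: "c \<in> charts_at A 0"
    and \<alpha>: "continuous_on UNIV \<alpha>" "\<alpha> 0 = 0"
    and D\<alpha>: "(local_rep c c \<alpha> has_derivative L) (at (snd c 0))"
  shows "bij_betw (\<lambda>v. v c) (tangent_space A 0) UNIV"
    and "v \<in> tangent_space A 0 \<Longrightarrow> differential A A \<alpha> 0 v \<in> tangent_space A 0"
    and "v \<in> tangent_space A 0 \<Longrightarrow> differential A A \<alpha> 0 v c = L (v c)"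
proof -
  define CH where "CH = charts_at A 0"
  define \<tau> where "\<tau> c d = frechet_derivative (local_rep c d id) (at (snd c 0))" for c d :: "('g, 'e) chart"
  have chart: "is_chart d" "0 \<in> fst d" if "d \<in> CH" for d
    using that A by (auto simp: CH_def charts_at_def smooth_atlas_def)
  have D\<tau>: "(local_rep d d' id has_derivative \<tau> d d') (at (snd d 0))" if "d \<in> CH" "d' \<in> CH" for d d'
    using local_rep_id_has_derivative[OF A] that by (simp add: CH_def \<tau>_def)
  have cocycle: "\<tau> d2 d3 (\<tau> d1 d2 w) = \<tau> d1 d3 w" if "d1 \<in> CH" "d2 \<in> CH" "d3 \<in> CH" for d1 d2 d3 w
  proof -
    have "(local_rep d1 d3 (id \<circ> id) has_derivative \<tau> d2 d3 \<circ> \<tau> d1 d2) (at (snd d1 0))"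
      using that chart D\<tau> by (intro local_rep_has_derivative_compose[where d = d2]) (auto simp: continuous_on_id)
    from has_derivative_unique[OF this[simplified] D\<tau>[OF that(1,3)]] show ?thesis
      by (metis comp_apply)
  qed
  have self: "\<tau> d d w = w" if "d \<in> CH" for d w
    using has_derivative_unique[OF local_rep_self_has_derivative D\<tau>[OF that that]] chart[OF that]
    by (metis id_apply)
  have cCH: "c \<in> CH" using c by (simp add: CH_def)
  define E where "E w d = (if d \<in> CH then \<tau> c d w else 0)" for w d
  have E_T: "E w \<in> tangent_space A 0" for w
    using cocycle cCH by (simp add: tangent_space_def E_def CH_def[symmetric] \<tau>_def[symmetric])
  have E_c: "E w c = w" for w using self cCH by (simp add: E_def)
  have T_\<tau>: "v d' = \<tau> d d' (v d)" if "v \<in> tangent_space A 0" "d \<in> CH" "d' \<in> CH" for v d d'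
    using tangent_space_transition[OF that(1)] that(2,3) unfolding CH_def \<tau>_def by blast
  have T_0: "v d = 0" if "v \<in> tangent_space A 0" "d \<notin> CH" for v d
    using tangent_space_outside[OF that(1)] that(2) unfolding CH_def by blast
  have E_v: "E (v c) = v" if "v \<in> tangent_space A 0" for v
    using T_\<tau>[OF that cCH] T_0[OF that] by (intro ext) (metis E_def)
  show "bij_betw (\<lambda>v. v c) (tangent_space A 0) UNIV"
    by (rule bij_betw_byWitness[where f' = E]) (use E_v E_c E_T in auto)
  \<comment> \<open>The chain rule through \<open>c\<close> expresses the derivative in every pair
    of charts by the one in \<open>c\<close>.\<close>
  have D\<alpha>': "frechet_derivative (local_rep d d' \<alpha>) (at (snd d 0)) w = \<tau> c d' (L (\<tau> d c w))"
    if "d \<in> CH" "d' \<in> CH" for d d' w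
  proof -
    have "(local_rep d c (\<alpha> \<circ> id) has_derivative L \<circ> \<tau> d c) (at (snd d 0))"
      using that chart cCH D\<tau> D\<alpha> by (intro local_rep_has_derivative_compose[where d = c]) (auto simp: continuous_on_id)
    then have "(local_rep d d' (id \<circ> \<alpha>) has_derivative \<tau> c d' \<circ> (L \<circ> \<tau> d c)) (at (snd d 0))"
      using that chart cCH D\<tau> \<alpha> by (intro local_rep_has_derivative_compose[where d = c]) auto
    from frechet_derivative_at[OF this] have "frechet_derivative (local_rep d d' \<alpha>) (at (snd d 0)) = \<tau> c d' \<circ> (L \<circ> \<tau> d c)"
      by simp
    then show ?thesis by simp
  qed
  have diff: "differential A A \<alpha> 0 v = E (L (v c))" if v: "v \<in> tangent_space A 0" for v
    unfolding differential_def \<alpha>(2) CH_def[symmetric]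
  proof (rule the_equality, intro conjI ballI E_T)
    fix d d' assume d: "d \<in> CH" "d' \<in> CH"
    have "\<tau> d c (v d) = v c" using T_\<tau>[OF v d(1) cCH] by simp
    then show "E (L (v c)) d' = frechet_derivative (local_rep d d' \<alpha>) (at (snd d 0)) (v d)"
      using d by (simp add: D\<alpha>' E_def)
  next
    fix w assume w: "w \<in> tangent_space A 0 \<and>
      (\<forall>d\<in>CH. \<forall>d'\<in>CH. w d' = frechet_derivative (local_rep d d' \<alpha>) (at (snd d 0)) (v d))"
    then have "w c = L (v c)" using cCH D\<alpha>'[OF cCH cCH] self by simp
    then show "w = E (L (v c))" using E_v w by metis
  qed
  show "differential A A \<alpha> 0 v \<in> tangent_space A 0" "differential A A \<alpha> 0 v c = L (v c)"
    if "v \<in> tangent_space A 0"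
    using diff[OF that] E_T E_c by simp_all
qed

lemma subspace_tangent_space:
  assumes "smooth_atlas A"
  shows "subspace (tangent_space A p)"
proof -
  have lin: "linear (frechet_derivative (local_rep c d id) (at (snd c p)))"
    if "c \<in> charts_at A p" "d \<in> charts_at A p" for c d
    by (rule has_derivative_linear[OF local_rep_id_has_derivative[OF assms that]])
  show ?thesis
    unfolding subspace_def
  proof (intro conjI ballI allI)
    show "0 \<in> tangent_space A p" by (auto simp: tangent_space_def linear_0[OF lin])
    fix v assume v: "v \<in> tangent_space A p"
    show "r *\<^sub>R v \<in> tangent_space A p" for r
    proof (rule tangent_spaceI)
      fix c d assume c: "c \<in> charts_at A p" and d: "d \<in> charts_at A p"
      show "(r *\<^sub>R v) d = frechet_derivative (local_rep c d id) (at (snd c p)) ((r *\<^sub>R v) c)"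
        by (simp only: scaleR_fun_def linear_scale[OF lin[OF c d]] tangent_space_transition[OF v c d])
    qed (simp add: scaleR_fun_def tangent_space_outside[OF v])
    fix w assume w: "w \<in> tangent_space A p"
    show "v + w \<in> tangent_space A p"
    proof (rule tangent_spaceI)
      fix c d assume c: "c \<in> charts_at A p" and d: "d \<in> charts_at A p"
      show "(v + w) d = frechet_derivative (local_rep c d id) (at (snd c p)) ((v + w) c)"
        by (simp only: plus_fun_apply linear_add[OF lin[OF c d]]
            tangent_space_transition[OF v c d] tangent_space_transition[OF w c d])
    qed (simp add: tangent_space_outside[OF v] tangent_space_outside[OF w])
  qed
qed

text \<open>Taking the component in the chart \<open>c\<close> is a linear isomorphism from the Lie
  algebra onto the model space that carries the differential to \<open>L\<close>, so the two
  complexified shifts are conjugate.\<close>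

lemma hyperbolic_on_lie_algebra_iff:
  fixes A :: "('g::{topological_group_add, t2_space}, 'e::finite_dim_inner) chart set"
  assumes A: "smooth_atlas A" and c: "c \<in> charts_at A 0"
    and \<alpha>: "continuous_on UNIV \<alpha>" "\<alpha> 0 = 0"
    and D\<alpha>: "(local_rep c c \<alpha> has_derivative L) (at (snd c 0))"
  shows "hyperbolic_on (lie_algebra A) (differential A A \<alpha> 0) \<longleftrightarrow> (\<forall>z. cmod z = 1 \<longrightarrow> bij (cshift L z))"
proof -
  define T where "T = tangent_space A 0"
  define D where "D = differential A A \<alpha> 0"
  note d = differential_in_chart[OF assms, folded T_def D_def]
  have sub: "subspace T" unfolding T_def by (rule subspace_tangent_space[OF A])
  have "bij_betw (\<lambda>x. map_prod D D x - scaleC z x) (T \<times> T) (T \<times> T) \<longleftrightarrow> bij (cshift L z)" for z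
  proof (rule bij_betw_conjugate)
    show "bij_betw (map_prod (\<lambda>v. v c) (\<lambda>v. v c)) (T \<times> T) UNIV"
      using bij_betw_map_prod[OF d(1) d(1)] by simp
    fix x assume "x \<in> T \<times> T"
    then show "map_prod D D x - scaleC z x \<in> T \<times> T"
      by (auto simp: scaleC_def d(2) intro!: subspace_diff[OF sub] subspace_add[OF sub] subspace_scale[OF sub])
    show "cshift L z (map_prod (\<lambda>v. v c) (\<lambda>v. v c) x) = map_prod (\<lambda>v. v c) (\<lambda>v. v c) (map_prod D D x - scaleC z x)"
      using \<open>x \<in> T \<times> T\<close> by (auto simp: cshift_def scaleC_def scaleR_fun_def d(3))
  qed
  then show ?thesis
    unfolding hyperbolic_on_def complex_spectrum_def T_def[symmetric] D_def[symmetric] by auto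
qed

theorem theorem1:
  fixes A :: "('g::{topological_group_add, t2_space}, 'e::finite_dim_inner) chart set"
    and \<alpha> :: "'g \<Rightarrow> 'g"
  assumes "lie_group A"
    and "continuous_on UNIV \<alpha>"
    and "\<And>x y. \<alpha> (x + y) = \<alpha> x + \<alpha> y"
  shows "has_shadowing \<alpha> \<longleftrightarrow> hyperbolic_on (lie_algebra A) (differential A A \<alpha> 0)"
proof -
  note hom = assms(3)
  have A: "smooth_atlas A" using assms(1) by (simp add: lie_group_def)
  have \<alpha>0: "\<alpha> 0 = 0" by (metis hom add.right_neutral add_left_cancel)
  obtain c and e :: "'e \<Rightarrow> 'g" and F \<rho> K where c: "c \<in> charts_at A 0" and log: "log_coordinates e \<rho>"
    and e: "\<And>x. norm x < \<rho> \<Longrightarrow> e x \<in> fst c \<and> snd c (e x) = snd c 0 + F x"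
    and F: "\<And>x. norm x < \<rho> \<Longrightarrow> norm (F x - x) \<le> K * norm x * norm x"
      "\<And>x. norm x < \<rho> \<Longrightarrow> norm x \<le> 2 * norm (F x)" "open (F ` ball 0 \<rho>)" "F 0 = 0"
    by (rule lie_group_log_coordinates[OF assms(1)]) (rule that)
  interpret log_coordinates e \<rho> by (rule log)
  obtain L s where L: "bounded_linear L" and s: "s > 0" "\<And>x. norm x < s \<Longrightarrow> norm (L x) < \<rho>"
    "\<And>x. norm x < s \<Longrightarrow> \<alpha> (e x) = e (L x)"
    by (rule hom_linear[OF assms(2) hom]) (rule that)
  have "is_chart c" using A c by (auto simp: smooth_atlas_def charts_at_def)
  note ch = is_chart_facts[OF this]
  \<comment> \<open>In the chart \<open>\<alpha>\<close> is \<open>L\<close> conjugated by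
    \<open>F\<close>. So the \<open>L\<close> that governs the recursion is also the coordinate form
    of the differential.\<close>
  have "local_rep c c \<alpha> (snd c 0 + F x) = snd c 0 + F (L x)" if "norm x < s" "norm x < \<rho>" for x
  proof -
    have "inv_into (fst c) (snd c) (snd c 0 + F x) = e x" using ch(6)[of "e x"] e[OF that(2)] by simp
    then show ?thesis using s(3)[OF that(1)] e[OF s(2)[OF that(1)]] by (simp add: local_rep_def)
  qed
  then have "(local_rep c c \<alpha> has_derivative L) (at (snd c 0))"
    using L rho s(1,2) F by (intro conjugate_has_derivative[where F = F and r = \<rho> and s = s and K = K]) auto
  note iff = hyperbolic_on_lie_algebra_iff[OF A c assms(2) \<alpha>0 this]
  show ?thesis
    unfolding iff using hyperbolic_imp_has_shadowing[OF hom L s(1,3)]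
      has_shadowing_imp_hyperbolic[OF hom L s(1,3)] by blast
qed

end
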